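(* Let $d := p\cdot n$ satisfy $\log n \ll d \ll n$. Suppose that $i = i(n)\in\mathbb{N}$ is such that $d^i \ll n$ and $d^{i+1}/n - 2\log n \to \infty$. Then asymptotically almost surely $G\in \mathcal{G}(n,p)$ satisfies \[ \left(\log d - 3\log\log n\right)\frac{n}{d^i} \le \zeta(G) \le (1+o(1))\left(\log d + 2\log\log n\right)\frac{n}{d^i}. \] As a result, if $d \ge (\log n)^{\omega}$ for some $\omega=\omega(n)\to\infty$ as $n\to\infty$, then a.a.s. $\zeta(G)\sim \frac{n\log d}{d^i}$. In particular, if there exists $i\in\mathbb{N}$ such that $d = n^{x+o(1)}$ for some $x\in\left(\frac{1}{i+1},\frac{1}{i}\right)$, then a.a.s. $\zeta(G)\sim \frac{x\, n\log n}{d^i}$.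
   Context: $\mathcal{G}(n,p)$ is the binomial random graph on vertex set $[n]$ where each pair is an edge independently with probability $p=p(n)$. A property holds asymptotically almost surely (a.a.s.) if its probability tends to $1$ as $n\to\infty$. Notation: $f\ll g$ means $f/g\to 0$; $f\sim g$ means $f=(1+o(1))g$; $\log$ is the natural logarithm. Quantities that should be integers are rounded. Localization game with $k$ sensors on a connected graph $G$: in round $1$ the cops choose a set $S_1\subseteq V(G)$ with $|S_1|=k$, then the (invisible) robber chooses a vertex $v_1$; in each round $t\ge 2$ the cops choose a new set $S_t$ of size $k$ (based on all previous information), then the robber moves to a vertex $v_t$ at distance at most $1$ from $v_{t-1}$. After each round the cops learn the vector of graph distances from the robber's current vertex to the vertices of $S_t$. The cops win in round $t$ if every two walks $(w_1,\dots,w_t)$, $(x_1,\dots,x_t)$ (consecutive vertices equal or adjacent) which produce the same sequence of distance vectors with respect to $(S_1,\dots,S_t)$ satisfy $w_t=x_t$. The localization number $\zeta(G)$ is the least $k$ such that the cops can win in finite time against every robber strategy. *)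

theory Defs
  imports "HOL-Probability.Probability" "HOL-Library.Landau_Symbols"
begin

text \<open>A simple graph is given by its vertex set \<open>V\<close> and a set \<open>E\<close> of two-element subsets of \<open>V\<close>.\<close>

definition walk_betw :: "'a set \<Rightarrow> 'a set set \<Rightarrow> 'a \<Rightarrow> 'a list \<Rightarrow> 'a \<Rightarrow> bool" where
  "walk_betw V E u xs v \<longleftrightarrow>
     xs \<noteq> [] \<and> set xs \<subseteq> V \<and> successively (\<lambda>x y. {x, y} \<in> E) xs \<and> hd xs = u \<and> last xs = v"

definition connected_graph :: "'a set \<Rightarrow> 'a set set \<Rightarrow> bool" where
  "connected_graph V E \<longleftrightarrow> V \<noteq> {} \<and> (\<forall>u\<in>V. \<forall>v\<in>V. \<exists>xs. walk_betw V E u xs v)"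

text \<open>The infimum over the empty set is \<open>\<infinity>\<close>, so vertices in different components are at
  distance \<open>\<infinity>\<close>.\<close>

definition graph_dist :: "'a set \<Rightarrow> 'a set set \<Rightarrow> 'a \<Rightarrow> 'a \<Rightarrow> enat" where
  "graph_dist V E u v = (INF xs\<in>{xs. walk_betw V E u xs v}. enat (length xs - 1))"

definition dist_vector :: "'a set \<Rightarrow> 'a set set \<Rightarrow> 'a set \<Rightarrow> 'a \<Rightarrow> ('a \<Rightarrow> enat)" where
  "dist_vector V E S v = restrict (\<lambda>s. graph_dist V E s v) S"

text \<open>Trajectories are functions on the rounds \<open>1, 2, \<dots>\<close>; the value at \<open>0\<close> is irrelevant.\<close>

definition trajectory :: "'a set \<Rightarrow> 'a set set \<Rightarrow> nat \<Rightarrow> (nat \<Rightarrow> 'a) \<Rightarrow> bool" where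
  "trajectory V E t w \<longleftrightarrow>
     (\<forall>j\<in>{1..t}. w j \<in> V) \<and>
     (\<forall>j\<in>{1..<t}. w (Suc j) = w j \<or> {w j, w (Suc j)} \<in> E)"

text \<open>A cop strategy maps the list of distance vectors seen so far to the next sensor set. The
  earlier sensor sets need not be part of the argument, since the strategy determines them from
  the distance vectors.\<close>

type_synonym 'a cop_strategy = "('a \<Rightarrow> enat) list \<Rightarrow> 'a set"

definition legal_strategy :: "'a set \<Rightarrow> nat \<Rightarrow> 'a cop_strategy \<Rightarrow> bool" where
  "legal_strategy V k \<sigma> \<longleftrightarrow> (\<forall>h. \<sigma> h \<subseteq> V \<and> card (\<sigma> h) = k)"

primrec observations ::
  "'a set \<Rightarrow> 'a set set \<Rightarrow> 'a cop_strategy \<Rightarrow> (nat \<Rightarrow> 'a) \<Rightarrow> nat \<Rightarrow> ('a \<Rightarrow> enat) list" where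
  "observations V E \<sigma> v 0 = []"
| "observations V E \<sigma> v (Suc t) =
     observations V E \<sigma> v t @ [dist_vector V E (\<sigma> (observations V E \<sigma> v t)) (v (Suc t))]"

definition sensors ::
  "'a set \<Rightarrow> 'a set set \<Rightarrow> 'a cop_strategy \<Rightarrow> (nat \<Rightarrow> 'a) \<Rightarrow> nat \<Rightarrow> 'a set" where
  "sensors V E \<sigma> v j = \<sigma> (observations V E \<sigma> v (j - 1))"

text \<open>The trajectories \<open>w\<close> and \<open>x\<close> range over those that are compatible with what the cops have
  actually observed while the robber followed \<open>v\<close>. Comparing all pairs \<open>w\<close>, \<open>x\<close> that agree with
  each other but not with the observations would make the answers of the sensors irrelevant and
  turn this into a non-adaptive game.\<close>

definition cops_win_in_round ::
  "'a set \<Rightarrow> 'a set set \<Rightarrow> 'a cop_strategy \<Rightarrow> (nat \<Rightarrow> 'a) \<Rightarrow> nat \<Rightarrow> bool" where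
  "cops_win_in_round V E \<sigma> v t \<longleftrightarrow>
     (\<forall>w x. trajectory V E t w \<and> trajectory V E t x \<and>
        (\<forall>j\<in>{1..t}.
           dist_vector V E (sensors V E \<sigma> v j) (w j) = dist_vector V E (sensors V E \<sigma> v j) (v j) \<and>
           dist_vector V E (sensors V E \<sigma> v j) (x j) = dist_vector V E (sensors V E \<sigma> v j) (v j))
        \<longrightarrow> w t = x t)"

text \<open>Against a fixed deterministic cop strategy, a robber strategy amounts to an infinite
  trajectory.\<close>

definition cops_can_win :: "'a set \<Rightarrow> 'a set set \<Rightarrow> nat \<Rightarrow> bool" where
  "cops_can_win V E k \<longleftrightarrow>
     (\<exists>\<sigma>. legal_strategy V k \<sigma> \<and>
        (\<forall>v. (\<forall>t. trajectory V E t v) \<longrightarrow> (\<exists>t\<ge>1. cops_win_in_round V E \<sigma> v t)))"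

text \<open>For finite \<open>V\<close> the minimum exists, as the cops win in the first round with
  \<open>S\<^sub>1 = V\<close>.\<close>

definition localization_number :: "'a set \<Rightarrow> 'a set set \<Rightarrow> nat" where
  "localization_number V E = (LEAST k. cops_can_win V E k)"

definition vertex_pairs :: "nat \<Rightarrow> nat set set" where
  "vertex_pairs n = {e. e \<subseteq> {1..n} \<and> card e = 2}"

text \<open>The random graph on \<open>{1..n}\<close>, as a distribution on edge sets.\<close>

definition gnp :: "nat \<Rightarrow> real \<Rightarrow> nat set set pmf" where
  "gnp n p = map_pmf (\<lambda>X. {e \<in> vertex_pairs n. X e})
               (Pi_pmf (vertex_pairs n) False (\<lambda>_. bernoulli_pmf p))"

definition aas :: "(nat \<Rightarrow> real) \<Rightarrow> (nat \<Rightarrow> nat set set \<Rightarrow> bool) \<Rightarrow> bool" where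
  "aas p Q \<longleftrightarrow> (\<lambda>n. measure_pmf.prob (gnp n (p n)) {E. Q n E}) \<longlonglongrightarrow> 1"

text \<open>A.a.s. \<open>\<zeta>(G) \<sim> f\<close>: the error term is a deterministic null sequence. The localization
  number is only considered on connected graphs, so connectedness is part of the event.\<close>

definition aas_localization_number_sim :: "(nat \<Rightarrow> real) \<Rightarrow> (nat \<Rightarrow> real) \<Rightarrow> bool" where
  "aas_localization_number_sim p f \<longleftrightarrow>
     (\<exists>\<epsilon>. \<epsilon> \<longlonglongrightarrow> 0 \<and>
        aas p (\<lambda>n E. connected_graph {1..n} E \<and>
                     \<bar>real (localization_number {1..n} E) - f n\<bar> \<le> \<epsilon> n * \<bar>f n\<bar>))"

end

theory Submission
  imports Defs "HOL-Real_Asymp.Real_Asymp"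
begin

text \<open>
  Upper bound. In \<open>G(n, p)\<close> all balls of radius \<open>i\<close> have size about \<open>d ^ i\<close> and any two of them are
  almost disjoint, so two vertices are told apart by about \<open>2 d ^ i\<close> sensors. Random sensors, about
  \<open>(ln d + 2 ln ln n) n / d ^ i\<close> in number, leave a given pair of vertices undistinguished with
  probability at most about \<open>1 / (d\<^sup>2 (ln n) ^ 4)\<close>. If \<open>A\<close> is the set of possible positions of the
  robber, the next position lies among at most about \<open>d |A|\<close> vertices, and a suitable choice of sensors
  leaves fewer than \<open>|A|\<^sup>2 / 2\<close> undistinguished pairs of them; hence the set of possible positions
  shrinks in every round.

  Lower bound. It is trivial for \<open>d < (ln n) ^ 3\<close>. Otherwise let \<open>k < (ln d - 3 ln ln n) n / d ^ i\<close>. Any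
  \<open>k\<close> sensors leave at least about \<open>n (ln n) ^ (5/2) / d\<close> vertices at distance more than \<open>i\<close>,
  almost all of which are at distance exactly \<open>i + 1\<close> from every sensor. As any two sets
  of \<open>4 n ln n / d\<close> vertices are joined by an edge, the robber can always move within these vertices
  and the cops never learn anything but that all distances are \<open>i + 1\<close>. This breaks down if
  \<open>p > ln ln n / (2 ln n)\<close>, but then \<open>i = 1\<close>, the diameter is 2, and by a birthday argument, for each
  choice of the sensors, every vertex has two neighbours that the sensors do not distinguish.

  Only few vertices are farther than \<open>i + 1\<close> from a given vertex. This, unlike a bound on the
  diameter, needs no more than the order of magnitude of the sizes of balls.
\<close>

section \<open>Balls and distances\<close>

text \<open>Where the logarithms go. A sensor separates a given pair with probability about 2 d ^ i
  / n, and (d |A|)^2 pairs must shrink below |A|^2 / 2; the factor d^2 accounts for ln d. In the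
  lower bound, k sensors leave n exp(- k d ^ i / n) vertices unseen, that is n (ln n)^3 / d. This
  must hold for all sensor sets at once: the union bound costs (ln n)^2. Of the last logarithm a
  factor (ln n)^(1/2) pays for replacing 1 - p by exp(- p), and the rest is margin. That payment
  suffices while p < ln ln n / (2 ln n), hence the separate dense case. The obstacle is that the
  balls of radius i - 1 around the sensors depend on the graph. The union bound therefore ranges
  over arbitrary vertex sets of the size of such a ball and looks only at the edges leaving them.
  The condition on d ^ (i + 1) / n is spent on far vertices: a layer of 3/4 d ^ i vertices misses a
  given vertex with probability at most n^(-3/2), so four missed vertices have probability at most n
  (n^(-1/2))^4 = 1 / n.\<close>

definition nbh :: "'a set \<Rightarrow> 'a set set \<Rightarrow> 'a set \<Rightarrow> 'a set" where
  "nbh V E A = A \<union> {v \<in> V. \<exists>u\<in>A. {u, v} \<in> E}"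

text \<open>Balls are iterates of the robber's one-move map and may have a set as centre. The same
  operator then describes candidate sets, breadth-first exploration, the vertices seen by a sensor
  set, and unions of two balls.\<close>

definition gball :: "'a set \<Rightarrow> 'a set set \<Rightarrow> 'a set \<Rightarrow> nat \<Rightarrow> 'a set" where
  "gball V E W j = (nbh V E ^^ j) W"

lemma nbh_mono: "A \<subseteq> B \<Longrightarrow> nbh V E A \<subseteq> nbh V E B"
  by (auto simp: nbh_def)

lemma nbh_Un: "nbh V E (A \<union> B) = nbh V E A \<union> nbh V E B"
  by (auto simp: nbh_def)

lemma nbh_eq_UN: "nbh V E A = (\<Union>a\<in>A. nbh V E {a})"
  by (auto simp: nbh_def)

lemma nbh_subset: "A \<subseteq> V \<Longrightarrow> nbh V E A \<subseteq> V"
  by (auto simp: nbh_def)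

lemma subset_nbh: "A \<subseteq> nbh V E A"
  by (auto simp: nbh_def)

lemma nbh_self: "nbh V E V = V"
  by (auto simp: nbh_def)

lemma gball_0 [simp]: "gball V E W 0 = W"
  by (simp add: gball_def)

lemma gball_Suc: "gball V E W (Suc j) = nbh V E (gball V E W j)"
  by (simp add: gball_def)

lemma gball_subset: "W \<subseteq> V \<Longrightarrow> gball V E W j \<subseteq> V"
  by (induction j) (simp_all add: gball_Suc nbh_subset)

lemma gball_mono: "i \<le> j \<Longrightarrow> gball V E W i \<subseteq> gball V E W j"
  by (rule lift_Suc_mono_le) (auto simp: gball_Suc intro: subset_nbh[THEN subsetD])

lemma gball_Un: "gball V E (A \<union> B) j = gball V E A j \<union> gball V E B j"
  by (induction j) (auto simp: gball_Suc nbh_Un)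

lemma gball_eq_UN: "gball V E W j = (\<Union>w\<in>W. gball V E {w} j)"
proof (induction j)
  case (Suc j)
  have "gball V E W (Suc j) = nbh V E (\<Union>w\<in>W. gball V E {w} j)"
    using Suc by (simp add: gball_Suc)
  also have "\<dots> = (\<Union>w\<in>W. nbh V E (gball V E {w} j))"
    by (auto simp: nbh_def)
  finally show ?case by (simp add: gball_Suc)
qed auto

lemma walk_betw_rev: "walk_betw V E u xs v \<Longrightarrow> walk_betw V E v (rev xs) u"
  by (auto simp: walk_betw_def hd_rev last_rev insert_commute)

lemma graph_dist_commute: "graph_dist V E u v = graph_dist V E v u"
proof -
  have "(\<lambda>xs. enat (length xs - 1)) ` {xs. walk_betw V E a xs b}
      \<subseteq> (\<lambda>xs. enat (length xs - 1)) ` {xs. walk_betw V E b xs a}" for a b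
    by (auto intro!: image_eqI[of _ _ "rev _"] walk_betw_rev)
  then show ?thesis
    unfolding graph_dist_def by (metis subset_antisym)
qed

lemma gball_walk:
  assumes "u \<in> V" "v \<in> gball V E {u} j"
  shows "\<exists>xs. walk_betw V E u xs v \<and> length xs \<le> Suc j"
  using assms(2)
proof (induction j arbitrary: v)
  case 0
  then have "walk_betw V E u [u] v" using assms(1) by (auto simp: walk_betw_def)
  then show ?case by fastforce
next
  case (Suc j)
  then consider "v \<in> gball V E {u} j" | w where "v \<in> V" "w \<in> gball V E {u} j" "{w, v} \<in> E"
    by (auto simp: gball_Suc nbh_def)
  then show ?case
  proof cases
    case 1
    then show ?thesis using Suc.IH by (meson le_SucI)
  next
    case 2
    then obtain xs where xs: "walk_betw V E u xs w" "length xs \<le> Suc j"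
      using Suc.IH by blast
    then have "walk_betw V E u (xs @ [v]) v"
      using 2 by (auto simp: walk_betw_def successively_append_iff)
    then show ?thesis using xs(2) by (intro exI[of _ "xs @ [v]"]) auto
  qed
qed

lemma walk_gball:
  assumes "walk_betw V E u xs v"
  shows "v \<in> gball V E {u} (length xs - 1)"
  using assms
proof (induction xs arbitrary: v rule: rev_induct)
  case Nil
  then show ?case by (simp add: walk_betw_def)
next
  case (snoc x xs)
  show ?case
  proof (cases "xs = []")
    case True
    then show ?thesis using snoc.prems by (auto simp: walk_betw_def)
  next
    case False
    then have "walk_betw V E u xs (last xs)" "{last xs, v} \<in> E" "v \<in> V"
      using snoc.prems by (auto simp: walk_betw_def successively_append_iff)
    then have "v \<in> nbh V E (gball V E {u} (length xs - 1))"
      using snoc.IH by (auto simp: nbh_def)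
    moreover have "length (xs @ [x]) - 1 = Suc (length xs - 1)"
      using False by (cases xs) auto
    ultimately show ?thesis by (simp only: gball_Suc)
  qed
qed

text \<open>From here on distances are treated as ball membership. The infimum over walks is
  attained because \<open>enat\<close> is well-ordered.\<close>

lemma graph_dist_le_iff:
  assumes "u \<in> V"
  shows "graph_dist V E u v \<le> enat j \<longleftrightarrow> v \<in> gball V E {u} j"
proof
  assume le: "graph_dist V E u v \<le> enat j"
  define X where "X = (\<lambda>xs. enat (length xs - 1)) ` {xs. walk_betw V E u xs v}"
  \<comment> \<open>Over the empty set the infimum is infinite, so a finite bound forces a walk to
    exist.\<close>
  have "X \<noteq> {}"
  proof
    assume "X = {}"
    then have "graph_dist V E u v = Inf {}" by (simp only: graph_dist_def X_def)
    then show False using le by (simp add: Inf_enat_def)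
  qed
  then have "Inf X \<in> X" by (meson wellorder_InfI ex_in_conv)
  then obtain xs where xs: "walk_betw V E u xs v" "graph_dist V E u v = enat (length xs - 1)"
    by (auto simp: X_def graph_dist_def)
  then have "v \<in> gball V E {u} (length xs - 1)" "length xs - 1 \<le> j"
    using walk_gball le by auto
  then show "v \<in> gball V E {u} j" using gball_mono[of "length xs - 1" j V E "{u}"] by auto
next
  assume "v \<in> gball V E {u} j"
  then obtain xs where "walk_betw V E u xs v" "length xs \<le> Suc j"
    using gball_walk[OF assms] by blast
  then have "graph_dist V E u v \<le> enat (length xs - 1)" "length xs - 1 \<le> j"
    by (auto simp: graph_dist_def intro: INF_lower)
  then show "graph_dist V E u v \<le> enat j"
    by (cases "graph_dist V E u v") auto
qed

lemma mem_gball_commute: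
  "u \<in> V \<Longrightarrow> v \<in> V \<Longrightarrow> v \<in> gball V E {u} j \<longleftrightarrow> u \<in> gball V E {v} j"
  using graph_dist_le_iff[of u V E v j] graph_dist_le_iff[of v V E u j] graph_dist_commute[of V E u v]
  by simp

lemma graph_dist_eq_Suc:
  assumes "s \<in> V" "v \<in> gball V E {s} (Suc j)" "v \<notin> gball V E {s} j"
  shows "graph_dist V E s v = enat (Suc j)"
proof -
  have "graph_dist V E s v \<le> enat (Suc j)" "\<not> graph_dist V E s v \<le> enat j"
    using assms by (simp_all add: graph_dist_le_iff)
  then show ?thesis by (cases "graph_dist V E s v") auto
qed

lemma dist_vector_eq_iff:
  "dist_vector V E S v = dist_vector V E S w \<longleftrightarrow> (\<forall>s\<in>S. graph_dist V E s v = graph_dist V E s w)"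
  by (auto simp: dist_vector_def restrict_def fun_eq_iff)

lemma card_nbh_le:
  assumes "finite A" "\<And>v. v \<in> A \<Longrightarrow> real (card (nbh V E {v})) \<le> g"
  shows "real (card (nbh V E A)) \<le> real (card A) * g"
proof -
  have "card (nbh V E A) \<le> (\<Sum>a\<in>A. card (nbh V E {a}))"
    by (subst nbh_eq_UN) (rule card_UN_le[OF assms(1)])
  then have "real (card (nbh V E A)) \<le> (\<Sum>a\<in>A. real (card (nbh V E {a})))"
    by (simp flip: of_nat_sum)
  also have "\<dots> \<le> real (card A) * g"
    using assms(2) by (rule sum_bounded_above)
  finally show ?thesis .
qed

text \<open>Random sensors, derandomised: by averaging, some single sensor separates at least the
  fraction \<open>D / card V\<close> of what is still unseparated, and greedy choice multiplies the
  savings. The cardinality is only bounded above because a greedy choice may repeat.\<close>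

lemma exists_separating_set:
  fixes sep :: "'a \<Rightarrow> 'b \<Rightarrow> bool" and D :: real
  assumes V: "finite V" "V \<noteq> {}" and P: "finite P"
    and D: "\<And>z. z \<in> P \<Longrightarrow> D \<le> real (card {s \<in> V. sep s z})"
    and le: "D \<le> real (card V)"
  shows "\<exists>S\<subseteq>V. card S \<le> k \<and>
    real (card {z \<in> P. \<forall>s\<in>S. \<not> sep s z}) \<le> real (card P) * (1 - D / card V) ^ k"
proof (induction k)
  case 0
  show ?case by (intro exI[of _ "{}"]) auto
next
  case (Suc k)
  then obtain S where S: "S \<subseteq> V" "card S \<le> k"
    "real (card {z \<in> P. \<forall>s\<in>S. \<not> sep s z}) \<le> real (card P) * (1 - D / card V) ^ k"
    by blast
  define n where "n = real (card V)"
  have n: "n > 0" using V by (simp add: n_def card_gt_0_iff)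
  define B where "B = {z \<in> P. \<forall>s\<in>S. \<not> sep s z}"
  have fB: "finite B" using P by (simp add: B_def)
  \<comment> \<open>Double counting of the incidences between sensors and unseparated
    elements.\<close>
  have "(\<Sum>s\<in>V. card {z \<in> B. sep s z}) = (\<Sum>z\<in>B. card {s \<in> V. sep s z})"
    by (rule sum_multicount_gen) (use V fB in auto)
  then have "(\<Sum>s\<in>V. real (card {z \<in> B. sep s z})) = (\<Sum>z\<in>B. real (card {s \<in> V. sep s z}))"
    by (simp flip: of_nat_sum)
  moreover have "(\<Sum>z\<in>B. real (card {s \<in> V. sep s z})) \<ge> card B * D"
    by (rule sum_bounded_below) (use D B_def in auto)
  ultimately have ge: "card B * D \<le> (\<Sum>s\<in>V. real (card {z \<in> B. sep s z}))" by simp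
  have "\<exists>s\<in>V. real (card {z \<in> B. sep s z}) \<ge> card B * D / n"
  proof (rule ccontr)
    assume "\<not> ?thesis"
    then have "(\<Sum>s\<in>V. real (card {z \<in> B. sep s z})) < (\<Sum>s\<in>V. card B * D / n)"
      by (intro sum_strict_mono) (use V in auto)
    also have "\<dots> = card B * D" using n by (simp add: n_def)
    finally show False using ge by simp
  qed
  then obtain s where s: "s \<in> V" "real (card {z \<in> B. sep s z}) \<ge> card B * D / n" by blast
  have "card B = card {z \<in> B. sep s z} + card {z \<in> B. \<not> sep s z}"
    using card_Int_Diff[OF fB, of "{z. sep s z}"] by (simp add: Int_def set_diff_eq)
  then have "real (card {z \<in> B. \<not> sep s z}) \<le> card B * (1 - D / n)"
    using s(2) by (simp add: algebra_simps add_divide_distrib)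
  also have "\<dots> \<le> (real (card P) * (1 - D / n) ^ k) * (1 - D / n)"
    by (rule mult_right_mono) (use S(3) le n in \<open>auto simp: B_def n_def\<close>)
  finally have "real (card {z \<in> B. \<not> sep s z}) \<le> real (card P) * (1 - D / n) ^ Suc k"
    by (simp add: mult_ac)
  moreover have "{z \<in> B. \<not> sep s z} = {z \<in> P. \<forall>s\<in>insert s S. \<not> sep s z}"
    by (auto simp: B_def)
  moreover have "card (insert s S) \<le> Suc k"
    using S finite_subset[OF S(1) V(1)] by (simp add: card_insert_if)
  ultimately show ?case
    using S s by (intro exI[of _ "insert s S"]) (auto simp: n_def)
qed

text \<open>Legal strategies use exactly \<open>k\<close> sensors; padding can only separate
  more.\<close>

lemma exists_separating_set_card:
  fixes sep :: "'a \<Rightarrow> 'b \<Rightarrow> bool" and D :: real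
  assumes V: "finite V" "V \<noteq> {}" and P: "finite P"
    and D: "\<And>z. z \<in> P \<Longrightarrow> D \<le> real (card {s \<in> V. sep s z})"
    and le: "D \<le> real (card V)" and k: "k \<le> card V"
  shows "\<exists>S\<subseteq>V. card S = k \<and>
    real (card {z \<in> P. \<forall>s\<in>S. \<not> sep s z}) \<le> real (card P) * (1 - D / card V) ^ k"
proof -
  obtain S where S: "S \<subseteq> V" "card S \<le> k"
    "real (card {z \<in> P. \<forall>s\<in>S. \<not> sep s z}) \<le> real (card P) * (1 - D / card V) ^ k"
    using exists_separating_set[where sep = sep and k = k, OF V P D le] by auto
  obtain T where T: "S \<subseteq> T" "T \<subseteq> V" "card T = k"
    using exists_subset_between[OF S(2) k S(1) V(1)] by blast
  have "card {z \<in> P. \<forall>s\<in>T. \<not> sep s z} \<le> card {z \<in> P. \<forall>s\<in>S. \<not> sep s z}"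
    by (rule card_mono) (use P T in auto)
  then show ?thesis using S(3) T by (intro exI[of _ T]) auto
qed

section \<open>Strategies\<close>

text \<open>The next position lies in \<open>nbh V E A\<close>, of size at most
  \<open>g * card A\<close>, and some \<open>k\<close> sensors leave fewer than
  \<open>(card A)\<^sup>2 / 2\<close> ordered pairs of it unseparated. An answer class of size b >=
  2 contributes b (b - 1) >= b^2 / 2 such pairs, so it is smaller than \<open>A\<close>.\<close>

lemma separating_sensors:
  fixes g D :: real
  assumes V: "finite V" "V \<noteq> {}"
    and g: "\<And>v. v \<in> V \<Longrightarrow> real (card (nbh V E {v})) \<le> g"
    and D: "\<And>w x. w \<in> V \<Longrightarrow> x \<in> V \<Longrightarrow> w \<noteq> x \<Longrightarrow>
      D \<le> real (card {s \<in> V. graph_dist V E s w \<noteq> graph_dist V E s x})"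
    and le: "D \<le> real (card V)" and k: "k \<le> card V"
    and small: "g\<^sup>2 * (1 - D / card V) ^ k < 1/2"
    and A: "A \<subseteq> V" "A \<noteq> {}"
  shows "\<exists>S\<subseteq>V. card S = k \<and> (\<forall>B \<subseteq> nbh V E A.
    (\<forall>w\<in>B. \<forall>x\<in>B. dist_vector V E S w = dist_vector V E S x) \<longrightarrow> card B \<le> max 1 (card A - 1))"
proof -
  define N where "N = nbh V E A"
  have N: "N \<subseteq> V" "finite N" "finite A"
    using nbh_subset[OF A(1)] V(1) A(1) by (auto simp: N_def dest: finite_subset)
  define P where "P = {z \<in> N \<times> N. fst z \<noteq> snd z}"
  have P: "finite P" "card P \<le> (card N)\<^sup>2"
    using N card_mono[of "N \<times> N" P] by (auto simp: P_def power2_eq_square)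
  define sep where "sep s z \<longleftrightarrow> graph_dist V E s (fst z) \<noteq> graph_dist V E s (snd z)" for s z
  have "D \<le> real (card {s \<in> V. sep s z})" if "z \<in> P" for z
    using D[of "fst z" "snd z"] that N(1) subsetD[OF N(1)] unfolding P_def sep_def by auto
  from exists_separating_set_card[where sep = sep and k = k, OF V P(1) this le k] obtain S where S: "S \<subseteq> V" "card S = k"
    "real (card {z \<in> P. \<forall>s\<in>S. \<not> sep s z}) \<le> real (card P) * (1 - D / card V) ^ k" by auto
  have cA: "card A > 0" using A N(3) by (simp add: card_gt_0_iff)
  have cV: "card V > 0" using V by (simp add: card_gt_0_iff)
  have q: "0 \<le> (1 - D / card V) ^ k" using le cV by simp
  have "real (card N) \<le> real (card A) * g"
    unfolding N_def by (rule card_nbh_le) (use N A g in auto)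
  then have "(real (card N))\<^sup>2 \<le> (real (card A) * g)\<^sup>2" by (rule power_mono) auto
  then have "real (card P) \<le> (real (card A))\<^sup>2 * g\<^sup>2"
    using P(2) by (metis of_nat_mono of_nat_power order_trans power_mult_distrib)
  then have "real (card P) * (1 - D / card V) ^ k \<le> (real (card A))\<^sup>2 * g\<^sup>2 * (1 - D / card V) ^ k"
    using q by (rule mult_right_mono)
  also have "\<dots> < (real (card A))\<^sup>2 * (1/2)"
    unfolding mult.assoc by (rule mult_strict_left_mono) (use small cA in auto)
  finally have bad: "2 * real (card {z \<in> P. \<forall>s\<in>S. \<not> sep s z}) < (real (card A))\<^sup>2" using S(3) by simp
  have "card B \<le> max 1 (card A - 1)"
    if B: "B \<subseteq> N" "\<forall>w\<in>B. \<forall>x\<in>B. dist_vector V E S w = dist_vector V E S x" for B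
  proof (rule ccontr)
    assume "\<not> ?thesis"
    then have c: "card B \<ge> 2" "card B \<ge> card A" by auto
    have fB: "finite B" using B N finite_subset by blast
    have sub: "B \<times> B - (\<lambda>x. (x, x)) ` B \<subseteq> {z \<in> P. \<forall>s\<in>S. \<not> sep s z}"
    proof
      fix z assume z: "z \<in> B \<times> B - (\<lambda>x. (x, x)) ` B"
      then have m: "fst z \<in> B" "snd z \<in> B" "fst z \<noteq> snd z" by (auto simp: image_iff prod_eq_iff)
      then have "dist_vector V E S (fst z) = dist_vector V E S (snd z)" using B(2) by blast
      then have "\<forall>s\<in>S. \<not> sep s z" by (simp add: dist_vector_eq_iff sep_def)
      moreover have "z \<in> P" using m B(1) by (auto simp: P_def mem_Times_iff)
      ultimately show "z \<in> {z \<in> P. \<forall>s\<in>S. \<not> sep s z}" by simp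
    qed
    have "card (B \<times> B - (\<lambda>x. (x, x)) ` B) = card (B \<times> B) - card ((\<lambda>x. (x, x)) ` B)"
      by (rule card_Diff_subset) (use fB in auto)
    also have "card ((\<lambda>x. (x, x)) ` B) = card B" by (intro card_image inj_onI) auto
    finally have "card B * card B - card B \<le> card {z \<in> P. \<forall>s\<in>S. \<not> sep s z}"
      using card_mono[OF _ sub] P(1) by (simp add: card_cartesian_product)
    then have "real (card B * card B - card B) \<le> real (card {z \<in> P. \<forall>s\<in>S. \<not> sep s z})"
      by (rule of_nat_mono)
    moreover have "real (card B * card B - card B) = real (card B) * real (card B) - real (card B)"
      using le_square[of "card B"] by (subst of_nat_diff) auto
    moreover have "2 * real (card B) \<le> real (card B) * real (card B)"
      by (rule mult_right_mono) (use c in auto)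
    moreover have "(real (card A))\<^sup>2 \<le> real (card B) * real (card B)"
      unfolding power2_eq_square by (rule mult_mono) (use c in auto)
    ultimately show False using bad by simp
  qed
  then show ?thesis using S by (auto simp: N_def)
qed

text \<open>The cops keep track of the candidates compatible with the answers. This set loses a
  vertex per round until it is a singleton, so \<open>card V\<close> rounds suffice.\<close>

proposition cops_can_win_if_separating:
  fixes g D :: real
  assumes V: "finite V" "V \<noteq> {}"
    and g: "\<And>v. v \<in> V \<Longrightarrow> real (card (nbh V E {v})) \<le> g"
    and D: "\<And>w x. w \<in> V \<Longrightarrow> x \<in> V \<Longrightarrow> w \<noteq> x \<Longrightarrow>
      D \<le> real (card {s \<in> V. graph_dist V E s w \<noteq> graph_dist V E s x})"
    and le: "D \<le> real (card V)" and k: "k \<le> card V"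
    and small: "g\<^sup>2 * (1 - D / card V) ^ k < 1/2"
  shows "cops_can_win V E k"
proof -
  \<comment> \<open>For an empty \<open>A\<close>, or one outside \<open>V\<close>, only a
    \<open>k\<close>-subset of \<open>V\<close> is asked for: \<open>legal_strategy\<close>
    quantifies over all histories, including impossible ones.\<close>
  define good where "good A S \<longleftrightarrow> S \<subseteq> V \<and> card S = k \<and> (A \<subseteq> V \<and> A \<noteq> {} \<longrightarrow> (\<forall>B \<subseteq> nbh V E A.
    (\<forall>w\<in>B. \<forall>x\<in>B. dist_vector V E S w = dist_vector V E S x) \<longrightarrow> card B \<le> max 1 (card A - 1)))" for A S
  have "\<exists>S. good A S" for A
  proof (cases "A \<subseteq> V \<and> A \<noteq> {}")
    case True
    then show ?thesis using separating_sensors[OF V g D le k small, of A] unfolding good_def by blast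
  next
    case False
    then show ?thesis using obtain_subset_with_card_n[OF k] unfolding good_def by metis
  qed
  then obtain F where F: "\<And>A. good A (F A)" by metis
  define upd where "upd A obs = {v \<in> nbh V E A. dist_vector V E (F A) v = obs}" for A obs
  \<comment> \<open>Starting from \<open>V\<close> makes round 1 an ordinary round, because
    \<open>nbh V E V = V\<close>.\<close>
  define cand where "cand h = foldl upd V h" for h
  define \<sigma> where "\<sigma> h = F (cand h)" for h
  have legal: "legal_strategy V k \<sigma>"
    using F by (auto simp: legal_strategy_def \<sigma>_def good_def)
  have "\<exists>t\<ge>1. cops_win_in_round V E \<sigma> v t" if v: "\<forall>t. trajectory V E t v" for v
  proof -
    define C where "C t = cand (observations V E \<sigma> v t)" for t
    have C0: "C 0 = V" by (simp add: C_def cand_def)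
    have CS: "C (Suc t) = upd (C t) (dist_vector V E (F (C t)) (v (Suc t)))" for t
      by (simp add: C_def cand_def \<sigma>_def)
    have sens: "sensors V E \<sigma> v (Suc t) = F (C t)" for t
      by (simp add: sensors_def C_def \<sigma>_def)
    \<comment> \<open>Every trajectory that explains the answers stays among the candidates, the
      robber's own included. Hence the candidates are never empty, and a singleton identifies the
      robber.\<close>
    have mem: "w t \<in> C t"
      if t: "t \<ge> 1" and w: "trajectory V E t w"
        "\<forall>j\<in>{1..t}. dist_vector V E (sensors V E \<sigma> v j) (w j) = dist_vector V E (sensors V E \<sigma> v j) (v j)" for w t
      using that
    proof (induction t rule: nat_induct_at_least)
      case base
      then have "w 1 \<in> V" by (auto simp: trajectory_def)
      then have "w 1 \<in> nbh V E (C 0)" by (simp add: C0 nbh_self)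
      then show ?case using base sens[of 0] CS[of 0] by (auto simp: upd_def)
    next
      case (Suc t)
      have "trajectory V E t w" using Suc.prems by (auto simp: trajectory_def)
      then have wt: "w t \<in> C t" using Suc by auto
      have "w (Suc t) = w t \<or> {w t, w (Suc t)} \<in> E" "w (Suc t) \<in> V"
        using Suc by (auto simp: trajectory_def)
      then have "w (Suc t) \<in> nbh V E (C t)" using wt by (auto simp: nbh_def)
      moreover have "dist_vector V E (F (C t)) (w (Suc t)) = dist_vector V E (F (C t)) (v (Suc t))"
        using bspec[OF Suc.prems(2), of "Suc t"] sens[of t] by simp
      ultimately show ?case by (simp add: CS upd_def)
    qed
    have ne: "C t \<noteq> {}" for t
    proof (cases t)
      case 0 then show ?thesis using C0 V by simp
    next
      case (Suc m) then show ?thesis using mem[of t v] v by auto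
    qed
    have sub: "C t \<subseteq> V" for t
      by (induction t) (auto simp: C0 CS upd_def dest: nbh_subset)
    have step: "card (C (Suc t)) \<le> max 1 (card (C t) - 1)" for t
      using F[of "C t"] ne[of t] sub[of t] by (auto simp: good_def CS upd_def)
    have card: "card (C t) \<le> max 1 (card V - t)" for t
    proof (induction t)
      case (Suc t)
      then show ?case using step[of t] by simp
    qed (simp add: C0)
    define t where "t = card V"
    have t: "t \<ge> 1" using V by (simp add: t_def Suc_le_eq card_gt_0_iff)
    have c1: "card (C t) \<le> 1" using card[of t] by (simp add: t_def)
    have fC: "finite (C t)" using sub V(1) finite_subset by blast
    have eq: "x = y" if "x \<in> C t" "y \<in> C t" for x y
      using that c1 fC by (metis card_le_Suc0_iff_eq One_nat_def)
    have "cops_win_in_round V E \<sigma> v t"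
      unfolding cops_win_in_round_def
    proof (intro allI impI, elim conjE)
      fix w x assume "trajectory V E t w" "trajectory V E t x"
        "\<forall>j\<in>{1..t}.
           dist_vector V E (sensors V E \<sigma> v j) (w j) = dist_vector V E (sensors V E \<sigma> v j) (v j) \<and>
           dist_vector V E (sensors V E \<sigma> v j) (x j) = dist_vector V E (sensors V E \<sigma> v j) (v j)"
      then have "w t \<in> C t" "x t \<in> C t" using mem[OF t] by auto
      then show "w t = x t" by (rule eq)
    qed
    then show ?thesis using t by blast
  qed
  then show ?thesis using legal unfolding cops_can_win_def by blast
qed

section \<open>Candidate sets that the robber can preserve, and Koenig's lemma\<close>

lemma finite_path_through_layers:
  fixes A :: "nat \<Rightarrow> 'a set" and R :: "'a \<Rightarrow> 'a \<Rightarrow> bool"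
  assumes pred: "\<And>t y. y \<in> A (Suc t) \<Longrightarrow> \<exists>x\<in>A t. R x y" and "y \<in> A T"
  shows "\<exists>w. w T = y \<and> (\<forall>l\<le>T. w l \<in> A l) \<and> (\<forall>l<T. R (w l) (w (Suc l)))"
  using assms(2)
proof (induction T arbitrary: y)
  case 0
  then show ?case by (intro exI[of _ "\<lambda>_. y"]) auto
next
  case (Suc T)
  \<comment> \<open>The path is built backwards, as the layers come with predecessors only.\<close>
  then obtain z where z: "z \<in> A T" "R z y" using pred by blast
  then obtain w where w: "w T = z" "\<forall>l\<le>T. w l \<in> A l" "\<forall>l<T. R (w l) (w (Suc l))"
    using Suc.IH by blast
  show ?case
    by (intro exI[of _ "w(Suc T := y)"]) (use w z Suc.prems in \<open>auto simp: less_Suc_eq le_Suc_eq\<close>)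
qed

text \<open>Koenig's lemma. An element of a layer may have no successor, so the path has to follow
  elements from which every later layer can be reached.\<close>

lemma koenig_layers:
  fixes A :: "nat \<Rightarrow> 'a set" and R :: "'a \<Rightarrow> 'a \<Rightarrow> bool"
  assumes fin: "\<And>t. finite (A t)" and ne: "\<And>t. A t \<noteq> {}"
    and pred: "\<And>t y. y \<in> A (Suc t) \<Longrightarrow> \<exists>x\<in>A t. R x y"
  shows "\<exists>v. \<forall>t. v t \<in> A t \<and> R (v t) (v (Suc t))"
proof -
  define reach where "reach j x T \<longleftrightarrow> (\<exists>w. w j = x \<and> (\<forall>l\<in>{j..T}. w l \<in> A l) \<and>
    (\<forall>l\<in>{j..<T}. R (w l) (w (Suc l))))" for j x T
  have anti: "reach j x T'" if "reach j x T" "T' \<le> T" for j x T T'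
    using that unfolding reach_def by (auto intro: exI)
  \<comment> \<open>Compactness: if each member of the finite set \<open>X\<close> failed at some
    layer \<open>f x\<close>, none would reach the largest of these layers, since
    \<open>reach\<close> is antitone in its last argument.\<close>
  have pull: "\<exists>x\<in>X. \<forall>T. reach j x T"
    if X: "finite X" "\<And>T. \<exists>x\<in>X. reach j x T" for X j
  proof (rule ccontr)
    assume "\<not> ?thesis"
    then obtain f where f: "\<And>x. x \<in> X \<Longrightarrow> \<not> reach j x (f x)" by metis
    obtain x where x: "x \<in> X" "reach j x (Max (f ` X))" using X(2) by blast
    have "f x \<le> Max (f ` X)" using x X(1) by (intro Max_ge) auto
    then show False using f[OF x(1)] anti[OF x(2)] by blast
  qed
  have "\<exists>x\<in>A 0. reach 0 x T" for T
  proof -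
    obtain y where "y \<in> A T" using ne by blast
    then obtain w where "\<forall>l\<le>T. w l \<in> A l" "\<forall>l<T. R (w l) (w (Suc l))"
      using finite_path_through_layers[of A R] pred by blast
    then show ?thesis unfolding reach_def by (intro bexI[of _ "w 0"] exI[of _ w]) auto
  qed
  from pull[OF fin this] have start: "\<exists>x. x \<in> A 0 \<and> (\<forall>T. reach 0 x T)" by blast
  have step: "\<exists>y. (y \<in> A (Suc j) \<and> (\<forall>T. reach (Suc j) y T)) \<and> R x y"
    if x: "x \<in> A j \<and> (\<forall>T. reach j x T)" for x j
  proof -
    have "\<exists>y\<in>{y \<in> A (Suc j). R x y}. reach (Suc j) y T" for T
    proof -
      have "reach j x (max T (Suc j))" using x by blast
      then obtain w where w: "w j = x" "\<forall>l\<in>{j..max T (Suc j)}. w l \<in> A l"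
        "\<forall>l\<in>{j..<max T (Suc j)}. R (w l) (w (Suc l))" unfolding reach_def by blast
      show ?thesis
        by (rule bexI[of _ "w (Suc j)"]) (use w in \<open>auto simp: reach_def intro!: exI[of _ w]\<close>)
    qed
    from pull[OF _ this] show ?thesis using fin by auto
  qed
  from dependent_nat_choice[of "\<lambda>j x. x \<in> A j \<and> (\<forall>T. reach j x T)" "\<lambda>j x y. R x y", OF start step]
  show ?thesis by blast
qed

text \<open>\<open>\<A>\<close> is a family of candidate sets within which the robber can stay. The
  condition \<open>B \<subseteq> nbh V E A\<close> provides predecessors of candidates rather than
  successors. Therefore the whole sequence of candidate sets is built first, and the trajectory that
  beats the strategy is then threaded through it by Koenig's lemma.\<close>

proposition not_cops_can_win:
  fixes \<A> :: "'a set \<Rightarrow> bool"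
  assumes V: "finite V" and start: "\<A> V"
    and \<A>: "\<And>A. \<A> A \<Longrightarrow> A \<subseteq> V" "\<And>A. \<A> A \<Longrightarrow> \<exists>x\<in>A. \<exists>y\<in>A. x \<noteq> y"
    and step: "\<And>A S. \<A> A \<Longrightarrow> S \<subseteq> V \<Longrightarrow> card S = k \<Longrightarrow> \<exists>B. \<A> B \<and> B \<subseteq> nbh V E A \<and>
      (\<forall>x\<in>B. \<forall>y\<in>B. dist_vector V E S x = dist_vector V E S y)"
  shows "\<not> cops_can_win V E k"
proof
  assume "cops_can_win V E k"
  then obtain \<sigma> where legal: "legal_strategy V k \<sigma>"
    and win: "\<And>v. (\<forall>t. trajectory V E t v) \<Longrightarrow> \<exists>t\<ge>1. cops_win_in_round V E \<sigma> v t"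
    unfolding cops_can_win_def by blast
  \<comment> \<open>A state pairs the candidates with the answers so far. The answer of a round is
    common to all new candidates, so the history is known before the robber's trajectory is.\<close>
  define Q where "Q z z' \<longleftrightarrow> fst z' \<subseteq> nbh V E (fst z) \<and>
    (\<exists>obs. snd z' = snd z @ [obs] \<and> (\<forall>x\<in>fst z'. dist_vector V E (\<sigma> (snd z)) x = obs))" for z z' :: "'a set \<times> ('a \<Rightarrow> enat) list"
  have "\<exists>f. \<forall>n. (\<A> (fst (f n)) \<and> (n = 0 \<longrightarrow> f n = (V, []))) \<and> Q (f n) (f (Suc n))"
  proof (rule dependent_nat_choice)
    show "\<exists>x. \<A> (fst x) \<and> (0 = 0 \<longrightarrow> x = (V, []))" using start by auto
  next
    fix z :: "'a set \<times> ('a \<Rightarrow> enat) list" and n :: nat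
    assume z: "\<A> (fst z) \<and> (n = 0 \<longrightarrow> z = (V, []))"
    have "\<sigma> (snd z) \<subseteq> V" "card (\<sigma> (snd z)) = k" using legal by (auto simp: legal_strategy_def)
    then obtain B where B: "\<A> B" "B \<subseteq> nbh V E (fst z)"
      "\<forall>x\<in>B. \<forall>y\<in>B. dist_vector V E (\<sigma> (snd z)) x = dist_vector V E (\<sigma> (snd z)) y"
      using step[of "fst z" "\<sigma> (snd z)"] z by auto
    obtain b where "b \<in> B" using \<A>(2)[OF B(1)] by blast
    then have b: "\<forall>x\<in>B. dist_vector V E (\<sigma> (snd z)) x = dist_vector V E (\<sigma> (snd z)) b"
      using B(3) by blast
    show "\<exists>y. (\<A> (fst y) \<and> (Suc n = 0 \<longrightarrow> y = (V, []))) \<and> Q z y"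
      by (intro exI[of _ "(B, snd z @ [dist_vector V E (\<sigma> (snd z)) b])"]) (simp add: Q_def B(1,2) b)
  qed
  then obtain f where ff: "\<forall>n. (\<A> (fst (f n)) \<and> (n = 0 \<longrightarrow> f n = (V, []))) \<and> Q (f n) (f (Suc n))"
    by (elim exE)
  have f: "\<A> (fst (f n))" "n = 0 \<longrightarrow> f n = (V, [])" "Q (f n) (f (Suc n))" for n
    using spec[OF ff, of n] by blast+
  define A where "A n = fst (f n)" for n
  define h where "h n = snd (f n)" for n
  have A: "\<A> (A n)" "A n \<subseteq> V" "finite (A n)" for n
    using f(1) \<A>(1) V finite_subset unfolding A_def by blast+
  have A0: "A 0 = V" "h 0 = []" using f(2)[of 0] by (simp_all add: A_def h_def)
  have AS: "A (Suc n) \<subseteq> nbh V E (A n)" for n using f(3)[of n] by (simp add: A_def Q_def)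
  obtain ob where ob: "h (Suc n) = h n @ [ob n]" "\<And>x. x \<in> A (Suc n) \<Longrightarrow> dist_vector V E (\<sigma> (h n)) x = ob n" for n
  proof -
    have "\<forall>n. \<exists>obs. snd (f (Suc n)) = snd (f n) @ [obs] \<and>
        (\<forall>x\<in>fst (f (Suc n)). dist_vector V E (\<sigma> (snd (f n))) x = obs)"
      using f(3) unfolding Q_def by blast
    from choice[OF this] show ?thesis using that unfolding A_def h_def by blast
  qed
  define R where "R x y \<longleftrightarrow> y = x \<or> {x, y} \<in> E" for x y
  have pred: "\<exists>x\<in>A t. R x y" if "y \<in> A (Suc t)" for y t
    using AS[of t] that by (auto simp: nbh_def R_def)
  obtain v where v: "\<And>t. v t \<in> A t" "\<And>t. R (v t) (v (Suc t))"
    using koenig_layers[of A R] A pred \<A>(2) by (metis empty_iff)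
  have traj: "\<forall>t. trajectory V E t v"
    using v A(2) by (auto simp: trajectory_def R_def)
  have obs: "observations V E \<sigma> v t = h t" for t
    by (induction t) (use ob v in \<open>auto simp: A0\<close>)
  obtain t where t: "t \<ge> 1" "cops_win_in_round V E \<sigma> v t" using win traj by blast
  have sens: "sensors V E \<sigma> v (Suc j) = \<sigma> (h j)" for j by (simp add: sensors_def obs)
  have path: "\<exists>w. w t = y \<and> (\<forall>l\<le>t. w l \<in> A l) \<and> (\<forall>l<t. R (w l) (w (Suc l)))" if "y \<in> A t" for y t
    using finite_path_through_layers[of A R] pred that by blast
  \<comment> \<open>Any path through the candidate sets produces the same answers as
    \<open>v\<close>; two such paths with different ends refute the win in round
    \<open>t\<close>.\<close>
  have compat: "trajectory V E t w \<and> (\<forall>j\<in>{1..t}. dist_vector V E (sensors V E \<sigma> v j) (w j) = dist_vector V E (sensors V E \<sigma> v j) (v j))"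
    if w: "\<forall>l\<le>t. w l \<in> A l" "\<forall>l<t. R (w l) (w (Suc l))" for w
  proof (intro conjI ballI)
    show "trajectory V E t w" using w A(2) by (force simp: trajectory_def R_def)
    fix j assume "j \<in> {1..t}"
    then obtain m where m: "j = Suc m" "Suc m \<le> t" by (cases j) auto
    then show "dist_vector V E (sensors V E \<sigma> v j) (w j) = dist_vector V E (sensors V E \<sigma> v j) (v j)"
      using ob(2) w(1) v(1)[of "Suc m"] by (simp add: sens)
  qed
  obtain x y where xy: "x \<in> A t" "y \<in> A t" "x \<noteq> y" using \<A>(2)[OF A(1)] by blast
  obtain wx where wx: "wx t = x" "\<forall>l\<le>t. wx l \<in> A l" "\<forall>l<t. R (wx l) (wx (Suc l))"
    using path[OF xy(1)] by blast
  obtain wy where wy: "wy t = y" "\<forall>l\<le>t. wy l \<in> A l" "\<forall>l<t. R (wy l) (wy (Suc l))"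
    using path[OF xy(2)] by blast
  have "wx t = wy t"
    using t(2) compat[OF wx(2,3)] compat[OF wy(2,3)] unfolding cops_win_in_round_def by blast
  then show False using wx wy xy by simp
qed

section \<open>Random subsets\<close>

text \<open>The ground set is arbitrary so that a random graph can be split into independent parts
  of the same kind.\<close>

definition rset :: "'a set \<Rightarrow> real \<Rightarrow> 'a set pmf" where
  "rset A p = map_pmf (\<lambda>X. {e \<in> A. X e}) (Pi_pmf A False (\<lambda>_. bernoulli_pmf p))"

abbreviation EV :: "'a pmf \<Rightarrow> ('a \<Rightarrow> real) \<Rightarrow> real" where
  "EV \<equiv> measure_pmf.expectation"

abbreviation PR :: "'a pmf \<Rightarrow> ('a \<Rightarrow> bool) \<Rightarrow> real" where
  "PR M P \<equiv> measure_pmf.prob M {x. P x}"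

lemma gnp_eq_rset: "gnp n p = rset (vertex_pairs n) p"
  by (simp add: gnp_def rset_def)

lemma set_rset_subset: "set_pmf (rset A p) \<subseteq> Pow A"
  by (auto simp: rset_def)

lemma finite_set_rset [simp]: "finite A \<Longrightarrow> finite (set_pmf (rset A p))"
  by (rule finite_subset[OF set_rset_subset]) simp

lemma integrable_rset [simp]:
  fixes f :: "'a set \<Rightarrow> real"
  shows "finite A \<Longrightarrow> integrable (rset A p) f"
  by (simp add: integrable_measure_pmf_finite)

lemma PR_eq_EV: "PR M P = EV M (\<lambda>x. of_bool (P x))"
proof -
  have "(\<lambda>x. of_bool (P x)) = (indicator {x. P x} :: 'a \<Rightarrow> real)"
    by (auto simp: indicator_def)
  then show ?thesis by simp
qed

lemma expectation_pair_pmf_finite: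
  fixes h :: "'a \<times> 'b \<Rightarrow> real"
  assumes "finite (set_pmf M)" "finite (set_pmf N)"
  shows "EV (pair_pmf M N) h = EV M (\<lambda>x. EV N (\<lambda>y. h (x, y)))"
proof -
  have "EV (pair_pmf M N) h = (\<Sum>z\<in>set_pmf M \<times> set_pmf N. h z * pmf (pair_pmf M N) z)"
    by (rule integral_measure_pmf_real) (use assms in auto)
  also have "\<dots> = (\<Sum>x\<in>set_pmf M. \<Sum>y\<in>set_pmf N. h (x, y) * (pmf M x * pmf N y))"
    by (simp add: sum.cartesian_product) (auto intro!: sum.cong simp: pmf_pair)
  also have "\<dots> = (\<Sum>x\<in>set_pmf M. EV N (\<lambda>y. h (x, y)) * pmf M x)"
    by (subst integral_measure_pmf_real[OF assms(2)]) (auto simp: sum_distrib_right sum_distrib_left mult_ac)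
  also have "\<dots> = EV M (\<lambda>x. EV N (\<lambda>y. h (x, y)))"
    by (rule integral_measure_pmf_real[symmetric]) (use assms in auto)
  finally show ?thesis .
qed

text \<open>The source of every independence statement below: what happens inside \<open>B\<close>
  is independent of what happens outside.\<close>

lemma rset_split:
  assumes "finite A" "B \<subseteq> A"
  shows "rset A p = map_pmf (\<lambda>(X, Y). X \<union> Y) (pair_pmf (rset B p) (rset (A - B) p))"
proof -
  let ?Q = "pair_pmf (Pi_pmf B False (\<lambda>_. bernoulli_pmf p)) (Pi_pmf (A - B) False (\<lambda>_. bernoulli_pmf p))"
  have fin: "finite B" by (rule finite_subset[OF assms(2,1)])
  have "Pi_pmf (B \<union> (A - B)) False (\<lambda>_. bernoulli_pmf p) =
      map_pmf (\<lambda>(f, g) x. if x \<in> B then f x else g x) ?Q"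
    by (rule Pi_pmf_union) (use assms fin in auto)
  moreover have "B \<union> (A - B) = A" using assms by auto
  ultimately have "rset A p = map_pmf (\<lambda>z. {e \<in> A. if e \<in> B then fst z e else snd z e}) ?Q"
    by (simp add: rset_def map_pmf_comp case_prod_unfold)
  also have "\<dots> = map_pmf (\<lambda>z. {e \<in> B. fst z e} \<union> {e \<in> A - B. snd z e}) ?Q"
    by (rule map_pmf_cong) (use assms in auto)
  also have "\<dots> = map_pmf (\<lambda>(X, Y). X \<union> Y) (pair_pmf (rset B p) (rset (A - B) p))"
    by (simp add: rset_def map_pair[symmetric] map_pmf_comp case_prod_unfold)
  finally show ?thesis .
qed

lemma expectation_rset_split:
  assumes "finite A" "B \<subseteq> A"
  shows "EV (rset A p) h = EV (rset B p) (\<lambda>X. EV (rset (A - B) p) (\<lambda>Y. h (X \<union> Y)))"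
proof -
  have "finite B" by (rule finite_subset[OF assms(2,1)])
  then show ?thesis
    using assms by (simp add: rset_split[OF assms] expectation_pair_pmf_finite case_prod_unfold)
qed

lemma EV_rset_cong:
  assumes "\<And>X. X \<subseteq> A \<Longrightarrow> f X = g X"
  shows "EV (rset A p) f = EV (rset A p) g"
  by (rule integral_cong_AE) (use assms set_rset_subset[of A p] in \<open>auto intro!: AE_pmfI\<close>)

lemma EV_rset_mono:
  assumes "finite A" "\<And>X. X \<subseteq> A \<Longrightarrow> f X \<le> g X"
  shows "EV (rset A p) f \<le> EV (rset A p) g"
  by (rule integral_mono_AE) (use assms set_rset_subset[of A p] in \<open>auto intro!: AE_pmfI\<close>)

lemma PR_mono:
  assumes "\<And>x. x \<in> set_pmf M \<Longrightarrow> P x \<Longrightarrow> Q x"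
  shows "PR M P \<le> PR M Q"
  by (rule measure_pmf.finite_measure_mono_AE) (use assms in \<open>auto intro!: AE_pmfI\<close>)

lemma PR_rset_mono:
  assumes "\<And>X. X \<subseteq> A \<Longrightarrow> P X \<Longrightarrow> Q X"
  shows "PR (rset A p) P \<le> PR (rset A p) Q"
  by (rule PR_mono) (use assms set_rset_subset[of A p] in auto)

lemma PR_union_bound:
  assumes "finite I" "\<And>i. i \<in> I \<Longrightarrow> PR M (P i) \<le> b i"
  shows "PR M (\<lambda>x. \<exists>i\<in>I. P i x) \<le> (\<Sum>i\<in>I. b i)"
proof -
  have "{x. \<exists>i\<in>I. P i x} = (\<Union>i\<in>I. {x. P i x})" by auto
  then have "PR M (\<lambda>x. \<exists>i\<in>I. P i x) \<le> (\<Sum>i\<in>I. PR M (P i))"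
    using measure_pmf.finite_measure_subadditive_finite[OF assms(1), of "\<lambda>i. {x. P i x}" M] by auto
  also have "\<dots> \<le> (\<Sum>i\<in>I. b i)" by (rule sum_mono) (rule assms(2))
  finally show ?thesis .
qed

lemma PR_disj_le: "PR M (\<lambda>x. P x \<or> Q x) \<le> PR M P + PR M Q"
proof -
  have "{x. P x \<or> Q x} = {x. P x} \<union> {x. Q x}" by auto
  then show ?thesis using measure_Un_le[of "{x. P x}" "measure_pmf M" "{x. Q x}"] by simp
qed

lemma PR_not: "PR M (\<lambda>x. \<not> P x) = 1 - PR M P"
proof -
  have "{x. \<not> P x} = space (measure_pmf M) - {x. P x}" by auto
  then show ?thesis using measure_pmf.prob_compl[of "{x. P x}" M] by simp
qed

lemma EV_rset_Int:
  assumes "finite A" "B \<subseteq> A"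
  shows "EV (rset A p) (\<lambda>E. f (E \<inter> B)) = EV (rset B p) f"
proof -
  have "EV (rset A p) (\<lambda>E. f (E \<inter> B)) =
      EV (rset B p) (\<lambda>X. EV (rset (A - B) p) (\<lambda>Y. f ((X \<union> Y) \<inter> B)))"
    by (rule expectation_rset_split[OF assms])
  also have "\<dots> = EV (rset B p) (\<lambda>X. EV (rset (A - B) p) (\<lambda>Y. f X))"
  proof (intro EV_rset_cong)
    fix X Y assume "X \<subseteq> B" "Y \<subseteq> A - B"
    then have "(X \<union> Y) \<inter> B = X" by auto
    then show "f ((X \<union> Y) \<inter> B) = f X" by simp
  qed
  finally show ?thesis by simp
qed

text \<open>The equations \<open>f E = f (E \<inter> B)\<close> and
  \<open>g E = g (E \<inter> C)\<close> encode that \<open>f\<close> and \<open>g\<close> look at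
  disjoint parts of the ground set; the product separates after splitting off
  \<open>A \<inter> B\<close>.\<close>

lemma EV_rset_indep:
  fixes f g :: "'a set \<Rightarrow> real"
  assumes A: "finite A" and BC: "B \<inter> C \<inter> A = {}"
    and f: "\<And>E. E \<subseteq> A \<Longrightarrow> f E = f (E \<inter> B)" and g: "\<And>E. E \<subseteq> A \<Longrightarrow> g E = g (E \<inter> C)"
  shows "EV (rset A p) (\<lambda>E. f E * g E) = EV (rset A p) f * EV (rset A p) g"
proof -
  define B' where "B' = A \<inter> B"
  have B': "B' \<subseteq> A" by (simp add: B'_def)
  have fX: "f (X \<union> Y) = f X" and gY: "g (X \<union> Y) = g Y" if "X \<subseteq> B'" "Y \<subseteq> A - B'" for X Y
  proof -
    have "(X \<union> Y) \<inter> B = X \<inter> B" "(X \<union> Y) \<inter> C = Y \<inter> C" "X \<subseteq> A" "Y \<subseteq> A" "X \<union> Y \<subseteq> A"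
      using that BC by (auto simp: B'_def)
    then show "f (X \<union> Y) = f X" "g (X \<union> Y) = g Y"
      using f[of "X \<union> Y"] f[of X] g[of "X \<union> Y"] g[of Y] by auto
  qed
  have split: "EV (rset A p) h = EV (rset B' p) (\<lambda>X. EV (rset (A - B') p) (\<lambda>Y. h (X \<union> Y)))" for h
    by (rule expectation_rset_split[OF A B'])
  have "EV (rset A p) (\<lambda>E. f E * g E) = EV (rset B' p) (\<lambda>X. EV (rset (A - B') p) (\<lambda>Y. f X * g Y))"
    unfolding split[of "\<lambda>E. f E * g E"] by (intro EV_rset_cong) (simp add: fX gY)
  also have "\<dots> = EV (rset B' p) f * EV (rset (A - B') p) g" by simp
  also have "EV (rset B' p) f = EV (rset A p) f"
  proof -
    have "EV (rset A p) f = EV (rset B' p) (\<lambda>X. EV (rset (A - B') p) (\<lambda>Y. f X))"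
      unfolding split[of f] by (intro EV_rset_cong) (simp add: fX)
    then show ?thesis by simp
  qed
  also have "EV (rset (A - B') p) g = EV (rset A p) g"
  proof -
    have "EV (rset A p) g = EV (rset B' p) (\<lambda>X. EV (rset (A - B') p) (\<lambda>Y. g Y))"
      unfolding split[of g] by (intro EV_rset_cong) (simp add: gY)
    then show ?thesis by simp
  qed
  finally show ?thesis .
qed

lemma PR_rset_indep:
  assumes A: "finite A" and BC: "B \<inter> C \<inter> A = {}"
    and P: "\<And>E. E \<subseteq> A \<Longrightarrow> P E \<longleftrightarrow> P (E \<inter> B)" and Q: "\<And>E. E \<subseteq> A \<Longrightarrow> Q E \<longleftrightarrow> Q (E \<inter> C)"
  shows "PR (rset A p) (\<lambda>E. P E \<and> Q E) = PR (rset A p) P * PR (rset A p) Q"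
proof -
  have "PR (rset A p) (\<lambda>E. P E \<and> Q E) = EV (rset A p) (\<lambda>E. of_bool (P E) * of_bool (Q E))"
    by (simp add: PR_eq_EV of_bool_conj)
  also have "\<dots> = PR (rset A p) P * PR (rset A p) Q"
    unfolding PR_eq_EV
  proof (rule EV_rset_indep[OF A BC])
    show "of_bool (P E) = (of_bool (P (E \<inter> B)) :: real)" if "E \<subseteq> A" for E using P[OF that] by simp
    show "of_bool (Q E) = (of_bool (Q (E \<inter> C)) :: real)" if "E \<subseteq> A" for E using Q[OF that] by simp
  qed
  finally show ?thesis .
qed

lemma EV_rset_prod:
  fixes f :: "'b \<Rightarrow> 'a set \<Rightarrow> real"
  assumes A: "finite A" and R: "finite R"
    and disj: "\<And>v w. v \<in> R \<Longrightarrow> w \<in> R \<Longrightarrow> v \<noteq> w \<Longrightarrow> F v \<inter> F w = {}"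
    and f: "\<And>v E. v \<in> R \<Longrightarrow> E \<subseteq> A \<Longrightarrow> f v E = f v (E \<inter> F v)"
  shows "EV (rset A p) (\<lambda>E. \<Prod>v\<in>R. f v E) = (\<Prod>v\<in>R. EV (rset A p) (f v))"
  using R disj f
proof (induction R rule: finite_induct)
  case (insert v R)
  have "EV (rset A p) (\<lambda>E. \<Prod>v\<in>insert v R. f v E) = EV (rset A p) (\<lambda>E. f v E * (\<Prod>v\<in>R. f v E))"
    using insert by simp
  also have "\<dots> = EV (rset A p) (f v) * EV (rset A p) (\<lambda>E. \<Prod>v\<in>R. f v E)"
  proof (rule EV_rset_indep[OF A, where B = "F v" and C = "\<Union>(F ` R)"])
    have "F v \<inter> F w = {}" if "w \<in> R" for w
      by (rule insert.prems(1)) (use that insert.hyps in auto)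
    then show "F v \<inter> \<Union> (F ` R) \<inter> A = {}" by auto
    show "f v E = f v (E \<inter> F v)" if "E \<subseteq> A" for E using insert.prems(2) that by auto
    show "(\<Prod>v\<in>R. f v E) = (\<Prod>v\<in>R. f v (E \<inter> \<Union> (F ` R)))" if E: "E \<subseteq> A" for E
    proof (rule prod.cong[OF refl])
      fix w assume w: "w \<in> R"
      have "E \<inter> \<Union> (F ` R) \<inter> F w = E \<inter> F w" using w by auto
      moreover have "f w (E \<inter> \<Union> (F ` R)) = f w (E \<inter> \<Union> (F ` R) \<inter> F w)"
        using insert.prems(2)[of w "E \<inter> \<Union> (F ` R)"] w E by auto
      ultimately show "f w E = f w (E \<inter> \<Union> (F ` R))" using insert.prems(2)[of w E] w E by simp
    qed
  qed
  also have "EV (rset A p) (\<lambda>E. \<Prod>v\<in>R. f v E) = (\<Prod>v\<in>R. EV (rset A p) (f v))"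
    by (rule insert.IH) (use insert.prems in auto)
  finally show ?case using insert by simp
qed simp

lemma PR_rset_mem:
  assumes A: "finite A" "e \<in> A" and p: "0 \<le> p" "p \<le> 1"
  shows "PR (rset A p) (\<lambda>E. e \<in> E) = p"
proof -
  have "PR (rset A p) (\<lambda>E. e \<in> E) = EV (rset A p) (\<lambda>E. of_bool (e \<in> E \<inter> {e}))"
    by (simp add: PR_eq_EV)
  also have "\<dots> = EV (rset {e} p) (\<lambda>E. of_bool (e \<in> E))"
    using EV_rset_Int[of A "{e}" p "\<lambda>E. of_bool (e \<in> E)"] A by simp
  also have "\<dots> = EV (bernoulli_pmf p) (\<lambda>b. of_bool b)"
    by (simp add: rset_def Pi_pmf_singleton)
  also have "\<dots> = p" using p by simp
  finally show ?thesis .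
qed

lemma PR_rset_Int_eq:
  assumes A: "finite A" "F \<subseteq> A" "Y \<subseteq> F" and p: "0 \<le> p" "p \<le> 1"
  shows "PR (rset A p) (\<lambda>E. E \<inter> F = Y) = p ^ card Y * (1 - p) ^ card (F - Y)"
proof -
  have fin: "finite F" "finite Y" using A by (auto intro: finite_subset)
  have one: "EV (rset A p) (\<lambda>E. of_bool (e \<in> E \<longleftrightarrow> e \<in> Y)) = (if e \<in> Y then p else 1 - p)" if "e \<in> F" for e
  proof -
    have "PR (rset A p) (\<lambda>E. e \<in> E) = p" using that A p by (intro PR_rset_mem) auto
    then show ?thesis using PR_not[of "rset A p" "\<lambda>E. e \<in> E"]
      by (simp add: PR_eq_EV[symmetric])
  qed
  have "of_bool (E \<inter> F = Y) = (\<Prod>e\<in>F. of_bool (e \<in> E \<longleftrightarrow> e \<in> Y) :: real)" for E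
  proof (cases "E \<inter> F = Y")
    case False
    then obtain e where "e \<in> F" "\<not> (e \<in> E \<longleftrightarrow> e \<in> Y)" using A by auto
    then have "(\<Prod>e\<in>F. of_bool (e \<in> E \<longleftrightarrow> e \<in> Y) :: real) = 0" using fin by (intro prod_zero) auto
    then show ?thesis using False by simp
  qed (auto intro!: prod.neutral[symmetric])
  then have "PR (rset A p) (\<lambda>E. E \<inter> F = Y) = EV (rset A p) (\<lambda>E. \<Prod>e\<in>F. of_bool (e \<in> E \<longleftrightarrow> e \<in> Y))"
    by (simp add: PR_eq_EV)
  also have "\<dots> = (\<Prod>e\<in>F. EV (rset A p) (\<lambda>E. of_bool (e \<in> E \<longleftrightarrow> e \<in> Y)))"
    by (rule EV_rset_prod[where F = "\<lambda>e. {e}"]) (use A fin in auto)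
  also have "\<dots> = (\<Prod>e\<in>F. if e \<in> Y then p else 1 - p)"
    using one by (intro prod.cong) auto
  also have "\<dots> = (\<Prod>e\<in>F \<inter> Y. p) * (\<Prod>e\<in>F - Y. 1 - p)"
    using prod.If_cases[OF fin(1), of "\<lambda>e. e \<in> Y" "\<lambda>_. p" "\<lambda>_. 1 - p"] by (simp add: set_diff_eq Int_def)
  also have "F \<inter> Y = Y" using A by auto
  finally show ?thesis by simp
qed

section \<open>Chernoff bounds for independent indicators\<close>

lemma exp_le_quadratic:
  fixes x :: real
  assumes "x \<le> 1"
  shows "exp x \<le> 1 + x + x\<^sup>2"
proof (cases "x \<ge> 0")
  case True
  then show ?thesis using exp_bound[of x] assms by simp
next
  case False
  define y where "y = - x"
  have y: "y \<ge> 0" using False by (simp add: y_def)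
  have "exp (- y) = 1 / exp y" by (simp add: exp_minus inverse_eq_divide)
  also have "\<dots> \<le> 1 / (1 + y)" using y exp_ge_add_one_self[of y] by (intro divide_left_mono) auto
  also have "\<dots> \<le> 1 - y + y\<^sup>2"
  proof -
    have "1 \<le> 1 + y ^ 3" using y by simp
    also have "\<dots> = (1 - y + y\<^sup>2) * (1 + y)" by (simp add: power2_eq_square power3_eq_cube algebra_simps)
    finally show ?thesis using y by (simp add: divide_simps)
  qed
  finally show ?thesis by (simp add: y_def)
qed

text \<open>Independence is encoded by locality: the event of \<open>v\<close> depends on the
  elements of \<open>F v\<close> only, and the sets \<open>F v\<close> are disjoint. With the common
  probability \<open>q\<close> the number of successes is binomial.\<close>

locale indep_indicators =
  fixes A :: "'a set" and p :: real and R :: "'b set" and F :: "'b \<Rightarrow> 'a set"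
    and Z :: "'b \<Rightarrow> 'a set \<Rightarrow> bool" and q :: real
  assumes A: "finite A" and R: "finite R"
    and disj: "\<And>v w. v \<in> R \<Longrightarrow> w \<in> R \<Longrightarrow> v \<noteq> w \<Longrightarrow> F v \<inter> F w = {}"
    and Z: "\<And>v E. v \<in> R \<Longrightarrow> E \<subseteq> A \<Longrightarrow> Z v E \<longleftrightarrow> Z v (E \<inter> F v)"
    and q: "\<And>v. v \<in> R \<Longrightarrow> PR (rset A p) (Z v) = q"
begin

lemma mgf: "EV (rset A p) (\<lambda>E. exp (t * real (card {v \<in> R. Z v E}))) = (1 + q * (exp t - 1)) ^ card R"
proof -
  have "exp (t * real (card {v \<in> R. Z v E})) = (\<Prod>v\<in>R. 1 + of_bool (Z v E) * (exp t - 1))" for E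
  proof -
    have "exp (t * real (card {v \<in> R. Z v E})) = (\<Prod>v\<in>{v \<in> R. Z v E}. exp t)"
      by (simp add: exp_of_nat2_mult)
    also have "\<dots> = (\<Prod>v\<in>R. if Z v E then exp t else 1)"
      using prod.inter_filter[OF R, of "\<lambda>_. exp t" "\<lambda>v. Z v E"] by simp
    also have "\<dots> = (\<Prod>v\<in>R. 1 + of_bool (Z v E) * (exp t - 1))"
      by (rule prod.cong) auto
    finally show ?thesis .
  qed
  then have "EV (rset A p) (\<lambda>E. exp (t * real (card {v \<in> R. Z v E}))) =
      EV (rset A p) (\<lambda>E. \<Prod>v\<in>R. 1 + of_bool (Z v E) * (exp t - 1))" by simp
  also have "\<dots> = (\<Prod>v\<in>R. EV (rset A p) (\<lambda>E. 1 + of_bool (Z v E) * (exp t - 1)))"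
  proof (rule EV_rset_prod[OF A R disj])
    fix v E assume "v \<in> R" "E \<subseteq> A"
    from Z[OF this] show "1 + of_bool (Z v E) * (exp t - 1) = 1 + of_bool (Z v (E \<inter> F v)) * (exp t - 1)" by simp
  qed auto
  also have "\<dots> = (\<Prod>v\<in>R. 1 + q * (exp t - 1))"
  proof (rule prod.cong[OF refl])
    fix v assume "v \<in> R"
    from q[OF this] show "EV (rset A p) (\<lambda>E. 1 + of_bool (Z v E) * (exp t - 1)) = 1 + q * (exp t - 1)"
      using A by (simp add: PR_eq_EV)
  qed
  finally show ?thesis by simp
qed

lemma q_bounds: "R \<noteq> {} \<Longrightarrow> 0 \<le> q \<and> q \<le> 1"
  using q by fastforce

text \<open>Multiplying the comparison of the mean with \<open>M\<close> by \<open>t\<close> treats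
  both tails at once: \<open>M\<close> bounds the mean from above for positive \<open>t\<close> and
  from below for negative \<open>t\<close>.\<close>

lemma mgf_le:
  assumes "t \<le> 1" "t * (real (card R) * q) \<le> t * M" "- 1 \<le> t"
  shows "EV (rset A p) (\<lambda>E. exp (t * real (card {v \<in> R. Z v E}))) \<le> exp ((t + t\<^sup>2) * M)"
proof (cases "R = {}")
  case True
  then have tM: "0 \<le> t * M" using assms by simp
  have "(t + t\<^sup>2) * M = (1 + t) * (t * M)" by (simp add: power2_eq_square algebra_simps)
  moreover have "0 \<le> (1 + t) * (t * M)" by (rule mult_nonneg_nonneg[OF _ tM]) (use assms in simp)
  ultimately show ?thesis using True by (simp only: mgf) simp
next
  case False
  note q01 = q_bounds[OF False]
  have e: "exp t - 1 \<le> t + t\<^sup>2" using exp_le_quadratic[OF assms(1)] by simp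
  have "0 \<le> 1 + q * (exp t - 1)"
  proof -
    have "0 \<le> (1 - q) + q * exp t" using q01 by (intro add_nonneg_nonneg mult_nonneg_nonneg) auto
    then show ?thesis by (simp add: algebra_simps)
  qed
  moreover have "1 + q * (exp t - 1) \<le> exp (q * (t + t\<^sup>2))"
    using exp_ge_add_one_self[of "q * (t + t\<^sup>2)"] mult_left_mono[OF e, of q] q01 by linarith
  ultimately have "(1 + q * (exp t - 1)) ^ card R \<le> exp (q * (t + t\<^sup>2)) ^ card R"
    by (rule power_mono[rotated])
  also have "\<dots> = exp ((1 + t) * (t * (real (card R) * q)))"
    by (simp add: exp_of_nat_mult[symmetric] power2_eq_square algebra_simps)
  also have "\<dots> \<le> exp ((1 + t) * (t * M))"
    using assms by (auto intro!: mult_left_mono)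
  also have "(1 + t) * (t * M) = (t + t\<^sup>2) * M" by (simp add: power2_eq_square algebra_simps)
  finally show ?thesis by (simp add: mgf)
qed

lemma chernoff_aux:
  assumes "t \<le> 1" "t * (real (card R) * q) \<le> t * M" "- 1 \<le> t"
  shows "PR (rset A p) (\<lambda>E. t * a \<le> t * real (card {v \<in> R. Z v E})) \<le> exp ((t + t\<^sup>2) * M - t * a)"
proof -
  have "PR (rset A p) (\<lambda>E. t * a \<le> t * real (card {v \<in> R. Z v E})) \<le>
      EV (rset A p) (\<lambda>E. exp (t * real (card {v \<in> R. Z v E})) * exp (- (t * a)))"
    unfolding PR_eq_EV by (rule EV_rset_mono[OF A]) (auto simp: mult_exp_exp)
  also have "\<dots> = EV (rset A p) (\<lambda>E. exp (t * real (card {v \<in> R. Z v E}))) * exp (- (t * a))"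
    by simp
  also have "\<dots> \<le> exp ((t + t\<^sup>2) * M) * exp (- (t * a))"
    by (rule mult_right_mono[OF mgf_le[OF assms]]) simp
  finally show ?thesis by (simp add: mult_exp_exp)
qed

text \<open>The choice t = \<delta> / 2 minimises t^2 - t \<delta>, and \<delta> <= 2 is what t <= 1
  requires.\<close>

lemma chernoff_upper:
  assumes M: "real (card R) * q \<le> M" and \<delta>: "0 < \<delta>" "\<delta> \<le> 2"
  shows "PR (rset A p) (\<lambda>E. (1 + \<delta>) * M \<le> real (card {v \<in> R. Z v E})) \<le> exp (- M * \<delta>\<^sup>2 / 4)"
proof -
  have "PR (rset A p) (\<lambda>E. (1 + \<delta>) * M \<le> real (card {v \<in> R. Z v E})) =
      PR (rset A p) (\<lambda>E. \<delta>/2 * ((1 + \<delta>) * M) \<le> \<delta>/2 * real (card {v \<in> R. Z v E}))"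
    using \<delta> by (subst mult_le_cancel_left_pos) auto
  also have "\<dots> \<le> exp ((\<delta>/2 + (\<delta>/2)\<^sup>2) * M - \<delta>/2 * ((1 + \<delta>) * M))"
    by (rule chernoff_aux) (use M \<delta> in auto)
  also have "(\<delta>/2 + (\<delta>/2)\<^sup>2) * M - \<delta>/2 * ((1 + \<delta>) * M) = - M * \<delta>\<^sup>2 / 4"
    by (simp add: power2_eq_square field_simps)
  finally show ?thesis .
qed

lemma chernoff_lower:
  assumes M: "M \<le> real (card R) * q" and \<delta>: "0 < \<delta>" "\<delta> \<le> 2"
  shows "PR (rset A p) (\<lambda>E. real (card {v \<in> R. Z v E}) \<le> (1 - \<delta>) * M) \<le> exp (- M * \<delta>\<^sup>2 / 4)"
proof -
  have "PR (rset A p) (\<lambda>E. real (card {v \<in> R. Z v E}) \<le> (1 - \<delta>) * M) =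
      PR (rset A p) (\<lambda>E. - \<delta>/2 * ((1 - \<delta>) * M) \<le> - \<delta>/2 * real (card {v \<in> R. Z v E}))"
    using \<delta> by (subst mult_le_cancel_left_neg) auto
  also have "\<dots> \<le> exp ((- \<delta>/2 + (- \<delta>/2)\<^sup>2) * M - - \<delta>/2 * ((1 - \<delta>) * M))"
    by (rule chernoff_aux) (use M \<delta> in auto)
  also have "(- \<delta>/2 + (- \<delta>/2)\<^sup>2) * M - - \<delta>/2 * ((1 - \<delta>) * M) = - M * \<delta>\<^sup>2 / 4"
    by (simp add: power2_eq_square field_simps)
  finally show ?thesis .
qed

end

text \<open>Multiplied out, so that values \<open>z\<close> of probability 0 need no special treatment.\<close>

lemma PR_le_by_cases:
  assumes "finite (set_pmf M)" "0 \<le> \<beta>"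
    and "\<And>z. PR M (\<lambda>x. f x = z \<and> Q z x) \<le> \<beta> * PR M (\<lambda>x. f x = z)"
  shows "PR M (\<lambda>x. Q (f x) x) \<le> \<beta>"
proof -
  define I where "I = f ` set_pmf M"
  have I: "finite I" using assms(1) by (simp add: I_def)
  have "PR M (\<lambda>x. Q (f x) x) \<le> PR M (\<lambda>x. \<exists>z\<in>I. f x = z \<and> Q z x)"
    by (rule PR_mono) (auto simp: I_def)
  also have "\<dots> \<le> (\<Sum>z\<in>I. \<beta> * PR M (\<lambda>x. f x = z))"
    by (rule PR_union_bound[OF I]) (rule assms(3))
  also have "\<dots> = \<beta> * (\<Sum>z\<in>I. PR M (\<lambda>x. f x = z))" by (simp add: sum_distrib_left)
  also have "(\<Sum>z\<in>I. PR M (\<lambda>x. f x = z)) = measure_pmf.prob M (\<Union>z\<in>I. {x. f x = z})"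
    by (rule measure_pmf.finite_measure_finite_Union[symmetric])
       (use I in \<open>auto simp: disjoint_family_on_def\<close>)
  also have "\<beta> * \<dots> \<le> \<beta> * 1" by (rule mult_left_mono) (use assms in auto)
  finally show ?thesis by simp
qed

section \<open>Exposing a random graph layer by layer\<close>

definition all_pairs :: "'a set \<Rightarrow> 'a set set" where
  "all_pairs V = {e. e \<subseteq> V \<and> card e = 2}"

lemma vertex_pairs_eq: "vertex_pairs n = all_pairs {1..n}"
  by (simp add: vertex_pairs_def all_pairs_def)

lemma finite_all_pairs [simp]: "finite V \<Longrightarrow> finite (all_pairs V)"
  by (rule finite_subset[of _ "Pow V"]) (auto simp: all_pairs_def)

lemma pair_in_all_pairs: "u \<in> V \<Longrightarrow> v \<in> V \<Longrightarrow> u \<noteq> v \<Longrightarrow> {u, v} \<in> all_pairs V"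
  by (auto simp: all_pairs_def)

abbreviation gr :: "'a set \<Rightarrow> real \<Rightarrow> 'a set set pmf" where
  "gr V p \<equiv> rset (all_pairs V) p"

definition adj :: "'a set set \<Rightarrow> 'a set \<Rightarrow> 'a \<Rightarrow> bool" where
  "adj E T v \<longleftrightarrow> (\<exists>u\<in>T. {u, v} \<in> E)"

definition cross :: "'a set \<Rightarrow> 'a set \<Rightarrow> 'a set set" where
  "cross T R = {e. \<exists>u\<in>T. \<exists>v\<in>R. e = {u, v}}"

text \<open>The edges revealed so far touch the previous ball, while the next layer is decided by
  the \<open>cross\<close> edges from the last layer to the unexplored vertices. The two kinds are
  disjoint, which is the basis of the layerwise exposure.\<close>

definition touching :: "'a set \<Rightarrow> 'a set set" where
  "touching T = {e. e \<inter> T \<noteq> {}}"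

lemma adj_Int_cross: "v \<in> R \<Longrightarrow> adj (E \<inter> cross T R) T v \<longleftrightarrow> adj E T v"
  by (auto simp: adj_def cross_def)

lemma PR_nonadj:
  assumes V: "finite V" and T: "T \<subseteq> V" and v: "v \<in> V - T" and p: "0 \<le> p" "p \<le> 1"
  shows "PR (gr V p) (\<lambda>E. \<not> adj E T v) = (1 - p) ^ card T"
proof -
  let ?F = "(\<lambda>u. {u, v}) ` T"
  have "PR (gr V p) (\<lambda>E. \<not> adj E T v) = PR (gr V p) (\<lambda>E. E \<inter> ?F = {})"
    by (rule arg_cong[where f = "measure_pmf.prob _"]) (auto simp: adj_def)
  also have "\<dots> = p ^ card ({} :: 'a set set) * (1 - p) ^ card (?F - {})"
    by (rule PR_rset_Int_eq) (use V T v p pair_in_all_pairs[of _ V v] in auto)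
  also have "card (?F - {}) = card T"
    unfolding Diff_empty by (intro card_image inj_onI) (auto simp: doubleton_eq_iff)
  finally show ?thesis by simp
qed

lemma indep_nonadj:
  assumes V: "finite V" and T: "T \<subseteq> V" "R \<subseteq> V" "T \<inter> R = {}" and p: "0 \<le> p" "p \<le> 1"
  shows "indep_indicators (all_pairs V) p R (\<lambda>v. (\<lambda>u. {u, v}) ` T) (\<lambda>v E. \<not> adj E T v) ((1 - p) ^ card T)"
proof
  show "finite (all_pairs V)" "finite R" using V T by (auto intro: finite_subset)
  show "(\<lambda>u. {u, v}) ` T \<inter> (\<lambda>u. {u, w}) ` T = {}" if "v \<in> R" "w \<in> R" "v \<noteq> w" for v w
    using that T by (auto simp: doubleton_eq_iff)
  show "(\<not> adj E T v) = (\<not> adj (E \<inter> (\<lambda>u. {u, v}) ` T) T v)" for v E by (auto simp: adj_def)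
  show "PR (gr V p) (\<lambda>E. \<not> adj E T v) = (1 - p) ^ card T" if "v \<in> R" for v
    by (rule PR_nonadj) (use that T V p in auto)
qed

lemma indep_adj:
  assumes V: "finite V" and T: "T \<subseteq> V" "R \<subseteq> V" "T \<inter> R = {}" and p: "0 \<le> p" "p \<le> 1"
  shows "indep_indicators (all_pairs V) p R (\<lambda>v. (\<lambda>u. {u, v}) ` T) (\<lambda>v E. adj E T v) (1 - (1 - p) ^ card T)"
proof -
  interpret N: indep_indicators "all_pairs V" p R "\<lambda>v. (\<lambda>u. {u, v}) ` T" "\<lambda>v E. \<not> adj E T v" "(1 - p) ^ card T"
    by (rule indep_nonadj[OF assms])
  show ?thesis
  proof
    show "PR (gr V p) (\<lambda>E. adj E T v) = 1 - (1 - p) ^ card T" if "v \<in> R" for v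
      using N.q[OF that] PR_not[of "gr V p" "\<lambda>E. adj E T v"] by simp
    show "adj E T v = adj (E \<inter> (\<lambda>u. {u, v}) ` T) T v" for v E by (auto simp: adj_def)
  qed (use N.A N.R N.disj in auto)
qed

text \<open>The value for \<open>l = 0\<close> makes \<open>W\<close> itself the layer \<open>gball V E W 0 - prev_ball V E W 0\<close>.\<close>

definition prev_ball :: "'a set \<Rightarrow> 'a set set \<Rightarrow> 'a set \<Rightarrow> nat \<Rightarrow> 'a set" where
  "prev_ball V E W l = (case l of 0 \<Rightarrow> {} | Suc m \<Rightarrow> gball V E W m)"

lemma prev_ball_0 [simp]: "prev_ball V E W 0 = {}"
  and prev_ball_Suc [simp]: "prev_ball V E W (Suc m) = gball V E W m"
  by (simp_all add: prev_ball_def)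

lemma prev_ball_subset: "prev_ball V E W l \<subseteq> gball V E W l"
  by (cases l) (auto simp: gball_Suc intro: subset_nbh[THEN subsetD])

text \<open>Only the last layer can reach new vertices, since the neighbours of earlier layers
  already belong to the ball.\<close>

lemma gball_Suc_layer:
  "gball V E W (Suc l) = gball V E W l \<union>
    {v \<in> V - gball V E W l. adj E (gball V E W l - prev_ball V E W l) v}"
proof (cases l)
  case 0
  then show ?thesis by (auto simp: gball_Suc nbh_def adj_def)
next
  case (Suc m)
  have "v \<in> gball V E W l" if "u \<in> gball V E W m" "{u, v} \<in> E" "v \<in> V" for u v
    using that by (auto simp: Suc gball_Suc nbh_def)
  then show ?thesis by (subst gball_Suc) (auto simp: nbh_def adj_def Suc)
qed

text \<open>Edges that avoid the ball of radius \<open>m\<close> have no influence on the balls up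
  to radius m + 1.\<close>

lemma gball_cong_touching:
  assumes "gball V E W m \<subseteq> A" "E \<inter> touching A = E' \<inter> touching A" "j \<le> Suc m"
  shows "gball V E W j = gball V E' W j"
  using assms(3)
proof (induction j)
  case (Suc j)
  then have IH: "gball V E W j = gball V E' W j" by simp
  have "gball V E W j \<subseteq> A" using gball_mono[of j m V E W] Suc.prems assms(1) by auto
  then have "{u, v} \<in> E \<longleftrightarrow> {u, v} \<in> E'" if "u \<in> gball V E W j" for u v
    using assms(2) that by (auto simp: touching_def set_eq_iff)
  then have "nbh V E (gball V E W j) = nbh V E' (gball V E W j)" by (auto simp: nbh_def)
  then show ?case by (simp add: gball_Suc IH)
qed simp

lemma state_cong_touching:
  assumes "prev_ball V E W l = A'" "gball V E W l = A" "E \<inter> touching A' = E' \<inter> touching A'"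
  shows "prev_ball V E' W l = A' \<and> gball V E' W l = A"
proof (cases l)
  case 0
  then show ?thesis using assms by auto
next
  case (Suc m)
  have "gball V E W j = gball V E' W j" if "j \<le> Suc m" for j
    by (rule gball_cong_touching[where m = m and A = A']) (use assms Suc that in auto)
  then show ?thesis using assms Suc by auto
qed

text \<open>The pair \<open>(prev_ball, gball)\<close> is determined by the edges that touch \<open>prev_ball\<close>, while
  \<open>Q\<close> only looks at edges that do not.\<close>

lemma PR_exposure:
  assumes V: "finite V" and W: "W \<subseteq> V" and \<beta>: "0 \<le> \<beta>"
    and dep: "\<And>T R E. Q T R E \<longleftrightarrow> Q T R (E \<inter> cross T R)"
    and bound: "\<And>A' A. A' \<subseteq> A \<Longrightarrow> A \<subseteq> V \<Longrightarrow> Inv A' A \<Longrightarrow>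
      PR (gr V p) (\<lambda>E. Q (A - A') (V - A) E) \<le> \<beta>"
  shows "PR (gr V p) (\<lambda>E. Inv (prev_ball V E W l) (gball V E W l) \<and>
      Q (gball V E W l - prev_ball V E W l) (V - gball V E W l) E) \<le> \<beta>"
proof -
  let ?M = "gr V p"
  define f where "f E = (prev_ball V E W l, gball V E W l)" for E
  have "PR ?M (\<lambda>E. Inv (fst (f E)) (snd (f E)) \<and> Q (snd (f E) - fst (f E)) (V - snd (f E)) E) \<le> \<beta>"
  proof (rule PR_le_by_cases[where f = f and Q = "\<lambda>z E. Inv (fst z) (snd z) \<and> Q (snd z - fst z) (V - snd z) E"])
    fix z :: "'a set \<times> 'a set"
    obtain A' A where z: "z = (A', A)" by (cases z)
    show "PR ?M (\<lambda>E. f E = z \<and> Inv (fst z) (snd z) \<and> Q (snd z - fst z) (V - snd z) E) \<le> \<beta> * PR ?M (\<lambda>E. f E = z)"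
    proof (cases "A' \<subseteq> A \<and> A \<subseteq> V \<and> Inv A' A")
      case True
      have "PR ?M (\<lambda>E. f E = z \<and> Inv (fst z) (snd z) \<and> Q (snd z - fst z) (V - snd z) E)
          = PR ?M (\<lambda>E. f E = z \<and> Q (A - A') (V - A) E)"
        using True by (simp add: z)
      also have "\<dots> = PR ?M (\<lambda>E. f E = z) * PR ?M (\<lambda>E. Q (A - A') (V - A) E)"
      proof (rule PR_rset_indep[where B = "touching A'" and C = "cross (A - A') (V - A)"])
        show "finite (all_pairs V)" using V by simp
        show "touching A' \<inter> cross (A - A') (V - A) \<inter> all_pairs V = {}"
          using True by (auto simp: touching_def cross_def)
        show "f E = z \<longleftrightarrow> f (E \<inter> touching A') = z" for E
        proof
          assume "f E = z"
          then show "f (E \<inter> touching A') = z"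
            using state_cong_touching[of V E W l A' A "E \<inter> touching A'"] by (auto simp: f_def z)
        next
          assume "f (E \<inter> touching A') = z"
          then show "f E = z"
            using state_cong_touching[of V "E \<inter> touching A'" W l A' A E] by (auto simp: f_def z)
        qed
        show "Q (A - A') (V - A) E \<longleftrightarrow> Q (A - A') (V - A) (E \<inter> cross (A - A') (V - A))" for E
          by (rule dep)
      qed
      also have "\<dots> \<le> PR ?M (\<lambda>E. f E = z) * \<beta>"
        by (rule mult_left_mono) (use bound True in auto)
      finally show ?thesis by (simp add: mult.commute)
    next
      case False
      have "\<not> (f E = z \<and> Inv (fst z) (snd z))" for E
        using False prev_ball_subset[of V E W l] gball_subset[OF W, of E l] by (auto simp: f_def z)
      then have "PR ?M (\<lambda>E. f E = z \<and> Inv (fst z) (snd z) \<and> Q (snd z - fst z) (V - snd z) E) = PR ?M (\<lambda>E. False)"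
        by (intro arg_cong[where f = "measure_pmf.prob _"]) auto
      then show ?thesis using \<beta> by simp
    qed
  qed (use V \<beta> in auto)
  then show ?thesis by (simp add: f_def)
qed

lemma one_minus_power_ge:
  fixes p :: real
  assumes "0 \<le> p" "p \<le> 1"
  shows "1 - (1 - p) ^ t \<le> p * t"
  using Bernoulli_inequality[of "- p" t] assms by (simp add: mult.commute)

lemma one_minus_power_le_exp:
  fixes p :: real
  assumes "p \<le> 1"
  shows "(1 - p) ^ t \<le> exp (- (p * t))"
proof -
  have "(1 - p) ^ t \<le> exp (- p) ^ t"
    using exp_ge_add_one_self[of "- p"] assms by (intro power_mono) auto
  then show ?thesis by (simp add: exp_of_nat_mult[symmetric] mult.commute)
qed

text \<open>The number of newly reached vertices is binomial with n - |A| trials and success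
  probability \<open>q\<close> between p t (1 - p t) and p t. By \<open>small\<close> its mean is at
  least (1 - \<delta> / 2) d t; the other half of the error is left to the Chernoff bound.\<close>

lemma PR_layer_bounds:
  fixes \<delta> d p :: real
  assumes V: "finite V" "V \<noteq> {}" and sub: "T \<subseteq> A" "A \<subseteq> V" and p: "0 \<le> p" "p \<le> 1"
    and d: "d = p * card V" and \<delta>: "0 < \<delta>" "\<delta> \<le> 1"
    and small: "card A / card V + p * card T \<le> \<delta> / 2"
  shows "PR (gr V p) (\<lambda>E. \<not> ((1 - \<delta>) * (d * card T) \<le> card {v \<in> V - A. adj E T v} \<and>
      card {v \<in> V - A. adj E T v} \<le> (1 + \<delta>) * (d * card T))) \<le> 2 * exp (- (d * card T * \<delta>\<^sup>2 / 32))"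
proof -
  let ?M = "gr V p"
  define n where "n = real (card V)"
  define t where "t = real (card T)"
  define q where "q = 1 - (1 - p) ^ card T"
  have n: "n > 0" using V by (simp add: n_def card_gt_0_iff)
  have fin: "finite A" by (rule finite_subset[OF sub(2) V(1)])
  interpret indep_indicators "all_pairs V" p "V - A" "\<lambda>v. (\<lambda>u. {u, v}) ` T" "\<lambda>v E. adj E T v" q
    unfolding q_def by (rule indep_adj) (use V sub p in auto)
  have cR: "real (card (V - A)) = n - card A"
    using card_Diff_subset[OF fin(1) sub(2)] card_mono[OF V(1) sub(2)] by (simp add: n_def of_nat_diff)
  have pt: "0 \<le> p * t" "p * t \<le> 1" using p \<delta> small by (auto simp: t_def intro: order_trans[rotated])
  have An: "0 \<le> card A / n" "card A / n \<le> 1" using card_mono[OF V(1) sub(2)] n by (auto simp: n_def)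
  have q_le: "q \<le> p * t" unfolding q_def t_def by (rule one_minus_power_ge[OF p])
  have q_ge: "p * t * (1 - p * t) \<le> q"
  proof -
    have "(1 - p) ^ card T \<le> exp (- (p * t))" unfolding t_def by (rule one_minus_power_le_exp) (rule p)
    also have "\<dots> \<le> 1 - p * t + (p * t)\<^sup>2" using exp_le_quadratic[of "- (p * t)"] pt by simp
    finally show ?thesis by (simp add: q_def power2_eq_square algebra_simps)
  qed
  have dt: "d * t = n * (p * t)" by (simp add: d n_def)
  have dt0: "0 \<le> d * t" using pt n by (simp add: dt)
  have up: "real (card (V - A)) * q \<le> d * t"
  proof -
    have "real (card (V - A)) * q \<le> n * (p * t)"
      by (rule mult_mono) (use q_le n q_ge pt in \<open>auto simp: cR intro: order_trans[rotated]\<close>)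
    then show ?thesis by (simp add: dt)
  qed
  have lo: "d * t * (1 - \<delta> / 2) \<le> real (card (V - A)) * q"
  proof -
    have "(1 - card A / n) * (1 - p * t) \<ge> 1 - \<delta> / 2"
    proof -
      have "(1 - x) * (1 - y) = 1 - x - y + x * y" for x y :: real
        by (simp add: algebra_simps)
      from this[of "card A / n" "p * t"] show ?thesis using small mult_nonneg_nonneg[OF An(1) pt(1)] by (simp add: n_def t_def)
    qed
    then have "d * t * (1 - \<delta> / 2) \<le> d * t * ((1 - card A / n) * (1 - p * t))"
      using dt0 by (rule mult_left_mono)
    also have "\<dots> = (n * (1 - card A / n)) * (p * t * (1 - p * t))" by (simp only: dt mult_ac)
    also have "\<dots> = (n - card A) * (p * t * (1 - p * t))" using n by (simp add: right_diff_distrib[of n])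
    also have "\<dots> \<le> (n - card A) * q"
      by (rule mult_left_mono[OF q_ge]) (use An n in \<open>simp add: divide_simps\<close>)
    finally show ?thesis by (simp add: cR)
  qed
  have U: "PR ?M (\<lambda>E. (1 + \<delta>) * (d * t) \<le> real (card {v \<in> V - A. adj E T v})) \<le> exp (- (d * t * \<delta>\<^sup>2 / 32))"
  proof -
    have "PR ?M (\<lambda>E. (1 + \<delta>) * (d * t) \<le> real (card {v \<in> V - A. adj E T v})) \<le> exp (- (d * t) * \<delta>\<^sup>2 / 4)"
      by (rule chernoff_upper[OF up]) (use \<delta> in auto)
    also have "\<dots> \<le> exp (- (d * t * \<delta>\<^sup>2 / 32))" using mult_nonneg_nonneg[OF dt0, of "\<delta>\<^sup>2"] by simp
    finally show ?thesis .
  qed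
  have L: "PR ?M (\<lambda>E. real (card {v \<in> V - A. adj E T v}) \<le> (1 - \<delta>) * (d * t)) \<le> exp (- (d * t * \<delta>\<^sup>2 / 32))"
  proof -
    have "(1 - \<delta>) * (d * t) \<le> (1 - \<delta>/2) * (d * t * (1 - \<delta> / 2))"
    proof -
      have "(1 - \<delta>/2) * (d * t * (1 - \<delta> / 2)) = (1 - \<delta>) * (d * t) + (\<delta>/2)\<^sup>2 * (d * t)"
        by (simp add: power2_eq_square field_simps)
      then show ?thesis using dt0 by simp
    qed
    then have "PR ?M (\<lambda>E. real (card {v \<in> V - A. adj E T v}) \<le> (1 - \<delta>) * (d * t)) \<le>
        PR ?M (\<lambda>E. real (card {v \<in> V - A. adj E T v}) \<le> (1 - \<delta>/2) * (d * t * (1 - \<delta> / 2)))"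
      by (intro PR_mono) auto
    also have "\<dots> \<le> exp (- (d * t * (1 - \<delta> / 2)) * (\<delta>/2)\<^sup>2 / 4)"
      by (rule chernoff_lower[OF lo]) (use \<delta> in auto)
    \<comment> \<open>32 = 4 * 4 * 2: the Chernoff constant, the halved deviation, and a mean of at
      least d t / 2.\<close>
    also have "\<dots> \<le> exp (- (d * t * \<delta>\<^sup>2 / 32))"
    proof -
      have "d * t * (1/2) \<le> d * t * (1 - \<delta> / 2)" using dt0 \<delta> by (intro mult_left_mono) auto
      then have "d * t * (1/2) * (\<delta>\<^sup>2 / 16) \<le> d * t * (1 - \<delta> / 2) * (\<delta>\<^sup>2 / 16)"
        by (rule mult_right_mono) simp
      then show ?thesis by (simp add: power_divide)
    qed
    finally show ?thesis .
  qed
  have "PR ?M (\<lambda>E. \<not> ((1 - \<delta>) * (d * t) \<le> card {v \<in> V - A. adj E T v} \<and>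
      card {v \<in> V - A. adj E T v} \<le> (1 + \<delta>) * (d * t))) \<le>
    PR ?M (\<lambda>E. (1 + \<delta>) * (d * t) \<le> real (card {v \<in> V - A. adj E T v}) \<or>
      real (card {v \<in> V - A. adj E T v}) \<le> (1 - \<delta>) * (d * t))"
    by (intro PR_mono) auto
  also have "\<dots> \<le> 2 * exp (- (d * t * \<delta>\<^sup>2 / 32))"
    using PR_disj_le[of ?M "\<lambda>E. (1 + \<delta>) * (d * t) \<le> real (card {v \<in> V - A. adj E T v})"
      "\<lambda>E. real (card {v \<in> V - A. adj E T v}) \<le> (1 - \<delta>) * (d * t)"] U L by simp
  finally show ?thesis by (simp add: t_def)
qed

section \<open>Growth of balls\<close>

text \<open>Relative error allowed when passing from the layer \<open>l - 1\<close> to the layer \<open>l\<close>. The first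
  summand dominates the fluctuations of the layer sizes, the second one the loss caused by the
  vertices that have already been explored; both are summable over \<open>l \<le> i\<close>.\<close>

definition dev :: "real \<Rightarrow> nat \<Rightarrow> nat \<Rightarrow> real" where
  "dev \<delta> i l = \<delta> * (1 / 2 ^ l + 1 / 2 ^ (i - l))"

definition lo :: "real \<Rightarrow> nat \<Rightarrow> nat \<Rightarrow> real" where
  "lo \<delta> i l = (\<Prod>j\<in>{1..l}. 1 - dev \<delta> i j)"

definition hi :: "real \<Rightarrow> nat \<Rightarrow> nat \<Rightarrow> real" where
  "hi \<delta> i l = (\<Prod>j\<in>{1..l}. 1 + dev \<delta> i j)"

lemma lo_hi_simps [simp]: "lo \<delta> i 0 = 1" "hi \<delta> i 0 = 1"
  "lo \<delta> i (Suc l) = lo \<delta> i l * (1 - dev \<delta> i (Suc l))"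
  "hi \<delta> i (Suc l) = hi \<delta> i l * (1 + dev \<delta> i (Suc l))"
  by (simp_all add: lo_def hi_def)

lemma sum_dev_le:
  assumes "0 \<le> \<delta>" "l \<le> i"
  shows "(\<Sum>j\<in>{1..l}. dev \<delta> i j) \<le> 3 * \<delta>"
proof -
  \<comment> \<open>Two geometric sums: the first is exactly 1 - 1 / 2 ^ l, the second at most 2 / 2
    ^ (i - l).\<close>
  have "(\<Sum>j\<in>{1..l}. dev \<delta> i j) \<le> \<delta> * (1 - 1 / 2 ^ l + 2 / 2 ^ (i - l))"
    using assms(2)
  proof (induction l)
    case (Suc l)
    then have "i - l = Suc (i - Suc l)" by simp
    then have "1 - 1 / 2 ^ l + 2 / 2 ^ (i - l) + (1 / 2 ^ Suc l + 1 / 2 ^ (i - Suc l)) =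
        1 - 1 / 2 ^ Suc l + 2 / 2 ^ (i - Suc l :: nat) - (0 :: real)"
      by (simp add: field_simps)
    then have "\<delta> * (1 - 1 / 2 ^ l + 2 / 2 ^ (i - l)) + dev \<delta> i (Suc l) =
        \<delta> * (1 - 1 / 2 ^ Suc l + 2 / 2 ^ (i - Suc l))"
      unfolding dev_def by (simp only: distrib_left[symmetric])  simp
    then show ?case using Suc by simp
  qed (use assms in simp)
  also have "\<dots> \<le> \<delta> * 3"
  proof (rule mult_left_mono)
    have "1 - 1 / 2 ^ l \<le> (1 :: real)" "2 / 2 ^ (i - l) \<le> (2 :: real)" by (simp_all add: divide_le_eq)
    then show "1 - 1 / 2 ^ l + 2 / 2 ^ (i - l) \<le> (3 :: real)" by linarith
  qed (use assms in simp)
  finally show ?thesis by simp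
qed

lemma dev_nonneg: "0 \<le> \<delta> \<Longrightarrow> 0 \<le> dev \<delta> i l"
  by (simp add: dev_def)

lemma dev_le: "0 \<le> \<delta> \<Longrightarrow> dev \<delta> i l \<le> 2 * \<delta>"
proof -
  assume "0 \<le> \<delta>"
  have "1 / 2 ^ l \<le> (1 :: real)" "1 / 2 ^ (i - l) \<le> (1 :: real)" by simp_all
  then have "1 / 2 ^ l + 1 / 2 ^ (i - l) \<le> (2 :: real)" by linarith
  then have "\<delta> * (1 / 2 ^ l + 1 / 2 ^ (i - l)) \<le> \<delta> * 2" using \<open>0 \<le> \<delta>\<close> by (rule mult_left_mono)
  then show ?thesis by (simp add: dev_def)
qed

lemma lo_ge:
  assumes "0 \<le> \<delta>" "\<delta> \<le> 1/2" "l \<le> i"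
  shows "1 - 3 * \<delta> \<le> lo \<delta> i l"
proof -
  have "1 - (\<Sum>j\<in>{1..l}. dev \<delta> i j) \<le> lo \<delta> i l \<and> 0 \<le> lo \<delta> i l \<and> lo \<delta> i l \<le> 1"
  proof (induction l)
    case (Suc l)
    define x where "x = dev \<delta> i (Suc l)"
    have x: "0 \<le> x" "x \<le> 1" using dev_nonneg[of \<delta> i "Suc l"] dev_le[of \<delta> i "Suc l"] assms by (auto simp: x_def)
    have "lo \<delta> i l * x \<le> 1 * x" by (rule mult_right_mono) (use Suc x in auto)
    moreover have "lo \<delta> i l * x \<le> lo \<delta> i l * 1" by (rule mult_left_mono) (use Suc x in auto)
    moreover have "lo \<delta> i l * (1 - x) \<le> 1 * 1" by (rule mult_mono) (use Suc x in auto)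
    ultimately show ?case using Suc x by (simp add: x_def[symmetric] algebra_simps)
  qed simp
  then show ?thesis using sum_dev_le[OF assms(1,3)] by linarith
qed

lemma hi_le:
  assumes "0 \<le> \<delta>" "l \<le> i"
  shows "hi \<delta> i l \<le> exp (3 * \<delta>)"
proof -
  have "hi \<delta> i l \<le> exp (\<Sum>j\<in>{1..l}. dev \<delta> i j)"
    unfolding hi_def by (rule prod_le_exp_sum) (use dev_nonneg assms in auto)
  also have "\<dots> \<le> exp (3 * \<delta>)" using sum_dev_le[OF assms] by simp
  finally show ?thesis .
qed

lemma hi_ge_1: "0 \<le> \<delta> \<Longrightarrow> 1 \<le> hi \<delta> i l"
  unfolding hi_def by (rule prod_ge_1) (simp add: dev_nonneg)

lemma exp_3_le: "0 \<le> \<delta> \<Longrightarrow> \<delta> \<le> 1/10 \<Longrightarrow> exp (3 * \<delta>) \<le> 1 + 4 * (\<delta>::real)"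
proof -
  assume d: "0 \<le> \<delta>" "\<delta> \<le> 1/10"
  have "exp (3 * \<delta>) \<le> 1 + 3 * \<delta> + (3 * \<delta>)\<^sup>2" by (rule exp_le_quadratic) (use d in simp)
  also have "(3 * \<delta>)\<^sup>2 \<le> \<delta>" using mult_left_mono[OF d(2) d(1)] d by (simp add: power2_eq_square)
  finally show ?thesis by simp
qed

text \<open>\<open>c\<close> is the number of centres, 1 or 2. The last clause bounds the entire
  ball: earlier layers amount to at most the fraction 2 / d of the bound for the last one, and the
  induction over \<open>l\<close> reproduces this.\<close>

definition layer_inv :: "real \<Rightarrow> real \<Rightarrow> real \<Rightarrow> nat \<Rightarrow> nat \<Rightarrow> 'a set \<Rightarrow> 'a set \<Rightarrow> bool" where
  "layer_inv c d \<delta> i l A' A \<longleftrightarrow>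
     c * d ^ l * lo \<delta> i l \<le> card (A - A') \<and> card (A - A') \<le> c * d ^ l * hi \<delta> i l \<and>
     card A \<le> (1 + 2 / d) * (c * d ^ l * hi \<delta> i l)"

text \<open>Given a good state, the next layer deviates with probability at most
  \<open>\<beta>\<close>, and the failures of the layers add up. Since \<open>W\<close> may be a
  pair, the union of two balls is explored as one object.\<close>

theorem bfs_concentration:
  fixes d p \<delta> :: real
  assumes V: "finite V" "V \<noteq> {}" and W: "W \<subseteq> V" "W \<noteq> {}" "card W \<le> 2" and p: "0 \<le> p" "p \<le> 1"
    and d: "d = p * card V" "8 \<le> d" and \<delta>: "0 < \<delta>" "\<delta> \<le> 1/10"
    and small: "d ^ i \<le> \<delta> / 10 * card V" and l: "l \<le> i"
  shows "PR (gr V p)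
      (\<lambda>E. \<not> layer_inv (card W) d \<delta> i l (prev_ball V E W l) (gball V E W l)) \<le> 2 * real l * exp (- (\<delta>\<^sup>2 * d / 256))"
  using l
proof (induction l)
  case 0
  then show ?case using d by (simp add: layer_inv_def mult_le_cancel_right1)
next
  case (Suc l)
  let ?M = "gr V p"
  define n where "n = real (card V)"
  define c where "c = real (card W)"
  define \<beta> where "\<beta> = 2 * exp (- (\<delta>\<^sup>2 * d / 256))"
  define x where "x = dev \<delta> i (Suc l)"
  define Q where "Q T R E \<longleftrightarrow> \<not> ((1 - x) * (d * card T) \<le> card {v \<in> R. adj E T v} \<and>
      card {v \<in> R. adj E T v} \<le> (1 + x) * (d * card T))" for T R :: "'a set" and E
  define Inv where "Inv l E = layer_inv c d \<delta> i l (prev_ball V E W l) (gball V E W l)" for l E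
  have n: "n > 0" using V by (simp add: n_def card_gt_0_iff)
  have c: "1 \<le> c" "c \<le> 2" using W V by (auto simp: c_def Suc_le_eq card_gt_0_iff intro: finite_subset)
  have x: "0 < x" "x \<le> 1" "\<delta> / 2 ^ Suc l \<le> x" "\<delta> / 2 ^ (i - Suc l) \<le> x"
    using dev_le[of \<delta> i "Suc l"] \<delta> by (auto simp: x_def dev_def intro!: mult_pos_pos add_pos_pos simp: distrib_left)
  have lo12: "1/2 \<le> lo \<delta> i l" using lo_ge[of \<delta> l i] \<delta> Suc.prems by simp
  have hi12: "1 \<le> hi \<delta> i l" "hi \<delta> i l \<le> 2"
    using hi_ge_1[of \<delta> i l] hi_le[of \<delta> l i] exp_3_le[of \<delta>] \<delta> Suc.prems by auto
  have bad: "PR ?M (\<lambda>E. Inv l E \<and> Q (gball V E W l - prev_ball V E W l) (V - gball V E W l) E) \<le> \<beta>"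
    unfolding Inv_def
  proof (rule PR_exposure[OF V(1) W(1)])
    show "0 \<le> \<beta>" by (simp add: \<beta>_def)
    show "Q T R E \<longleftrightarrow> Q T R (E \<inter> cross T R)" for T R E
      using adj_Int_cross[of _ R E T] by (simp add: Q_def cong: conj_cong)
    fix A' A :: "'a set" assume A: "A' \<subseteq> A" "A \<subseteq> V" and inv: "layer_inv c d \<delta> i l A' A"
    define t where "t = real (card (A - A'))"
    have t: "d ^ l / 2 \<le> t" "t \<le> 4 * d ^ l"
    proof -
      have "1 * d ^ l * (1/2) \<le> c * d ^ l * lo \<delta> i l"
        using c d lo12 by (intro mult_mono) auto
      also have "\<dots> \<le> t" using inv by (simp add: layer_inv_def t_def)
      finally show "d ^ l / 2 \<le> t" by simp
      have "t \<le> c * d ^ l * hi \<delta> i l" using inv by (simp add: layer_inv_def t_def)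
      also have "\<dots> \<le> 2 * d ^ l * 2" using c d hi12 by (intro mult_mono) auto
      finally show "t \<le> 4 * d ^ l" by simp
    qed
    have cA: "card A \<le> 8 * d ^ l"
    proof -
      have "card A \<le> (1 + 2 / d) * (c * d ^ l * hi \<delta> i l)" using inv by (simp add: layer_inv_def)
      also have "\<dots> \<le> 2 * (c * d ^ l * hi \<delta> i l)"
        using d c hi12 by (intro mult_right_mono) auto
      also have "c * d ^ l * hi \<delta> i l \<le> 2 * d ^ l * 2" using c d hi12 by (intro mult_mono) auto
      finally show ?thesis by simp
    qed
    \<comment> \<open>The explored fraction is at most d ^ (l + 1) / n and p t at most four times
      that; hence the 10 in \<open>small\<close>, as 5 / 10 = 1 / 2. Each layer still to come gains
      a factor d >= 2, which the second summand of \<open>dev\<close> matches.\<close>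
    have "card A / n + p * t \<le> x / 2"
    proof -
      have "card A / n \<le> 8 * d ^ l / n" using cA n by (simp add: divide_right_mono)
      also have "\<dots> \<le> d ^ Suc l / n" using d n by (intro divide_right_mono) (auto intro!: mult_right_mono)
      finally have 1: "card A / n \<le> d ^ Suc l / n" .
      have "p * t \<le> p * (4 * d ^ l)" using t p by (intro mult_left_mono) auto
      also have "\<dots> = 4 * (d ^ Suc l / n)" using n d by (simp add: n_def)
      finally have 2: "p * t \<le> 4 * (d ^ Suc l / n)" .
      have "2 ^ (i - Suc l) \<le> d ^ (i - Suc l)" using d by (intro power_mono) auto
      moreover have "d ^ Suc l > 0" using d by simp
      ultimately have "d ^ Suc l * 2 ^ (i - Suc l) \<le> d ^ Suc l * d ^ (i - Suc l)"
        by (intro mult_left_mono) auto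
      also have "\<dots> = d ^ i" using Suc.prems by (simp only: power_add[symmetric]) simp
      also have "\<dots> \<le> \<delta> / 10 * n" using small by (simp add: n_def)
      finally have "d ^ Suc l / n \<le> \<delta> / 2 ^ (i - Suc l) / 10" using n by (simp add: field_simps)
      moreover have "a + b \<le> x / 2" if "a \<le> y" "b \<le> 4 * y" "y \<le> z / 10" "z \<le> x" for a b y z :: real
        using that by linarith
      ultimately show ?thesis using 1 2 x(4) by blast
    qed
    then have "PR ?M (\<lambda>E. Q (A - A') (V - A) E) \<le> 2 * exp (- (d * card (A - A') * x\<^sup>2 / 32))"
      unfolding Q_def by (intro PR_layer_bounds) (use V A p d x in \<open>auto simp: n_def t_def\<close>)
    also have "\<dots> \<le> \<beta>"
    proof -
      \<comment> \<open>Squaring the first summand of \<open>dev\<close> loses 4 ^ l, which the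
        layer size d ^ l repays. The constant in \<open>\<beta>\<close> is 256 = 8 * 32.\<close>
      have "\<delta>\<^sup>2 * d / 8 = d * (1 / 2) * (\<delta> / 2)\<^sup>2" by (simp add: power_divide)
      also have "\<dots> = d * (1 / 2) * (\<delta> / 2)\<^sup>2 * 1" by simp
      also have "\<dots> \<le> d * (1 / 2) * (\<delta> / 2)\<^sup>2 * (d / 4) ^ l"
        using d by (intro mult_left_mono one_le_power) auto
      also have "\<dots> = d * (d ^ l / 2) * (\<delta> / 2 ^ Suc l)\<^sup>2"
        by (simp add: power_divide power_mult_distrib power_mult[symmetric] power_even_eq)
           (simp add: power_mult power2_eq_square field_simps power_mult_distrib[symmetric])
      also have "\<dots> \<le> d * t * x\<^sup>2"
        using t d x \<delta> by (intro mult_mono power_mono mult_left_mono) auto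
      finally show ?thesis by (simp add: \<beta>_def t_def mult.commute)
    qed
    finally show "PR ?M (\<lambda>E. Q (A - A') (V - A) E) \<le> \<beta>" .
  qed
  have step: "Inv (Suc l) E" if "Inv l E" "\<not> Q (gball V E W l - prev_ball V E W l) (V - gball V E W l) E" for E
  proof -
    define A where "A = gball V E W l"
    define T where "T = A - prev_ball V E W l"
    define Y where "Y = {v \<in> V - A. adj E T v}"
    have AS: "gball V E W (Suc l) = A \<union> Y" by (subst gball_Suc_layer) (simp add: A_def T_def Y_def)
    have L: "gball V E W (Suc l) - prev_ball V E W (Suc l) = Y" using AS by (auto simp: A_def Y_def)
    have T: "c * d ^ l * lo \<delta> i l \<le> card T" "card T \<le> c * d ^ l * hi \<delta> i l" "card A \<le> (1 + 2 / d) * (c * d ^ l * hi \<delta> i l)"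
      using that(1) by (auto simp: Inv_def layer_inv_def T_def A_def)
    have Y: "(1 - x) * (d * card T) \<le> card Y" "card Y \<le> (1 + x) * (d * card T)"
      using that(2) by (auto simp: Q_def T_def A_def Y_def)
    have "c * d ^ Suc l * lo \<delta> i (Suc l) = (1 - x) * (d * (c * d ^ l * lo \<delta> i l))"
      by (simp add: x_def)
    also have "\<dots> \<le> (1 - x) * (d * card T)" using T d x by (intro mult_left_mono) auto
    finally have Y1: "c * d ^ Suc l * lo \<delta> i (Suc l) \<le> card Y" using Y by linarith
    have "(1 + x) * (d * card T) \<le> (1 + x) * (d * (c * d ^ l * hi \<delta> i l))"
      using T d x by (intro mult_left_mono) auto
    also have "\<dots> = c * d ^ Suc l * hi \<delta> i (Suc l)" by (simp add: x_def)
    finally have Y2: "card Y \<le> c * d ^ Suc l * hi \<delta> i (Suc l)" using Y by linarith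
    \<comment> \<open>The old ball is absorbed: it is at most the fraction 2 / d of the bound for
      the new layer.\<close>
    have "(1 + 2 / d) * (c * d ^ l * hi \<delta> i l) \<le> 2 / d * (c * d ^ Suc l * hi \<delta> i (Suc l))"
    proof -
      have "(1 + 2 / d) * (c * d ^ l * hi \<delta> i l) * 1 \<le> 2 * (c * d ^ l * hi \<delta> i l) * (1 + x)"
        using d c hi12 x by (intro mult_mono) auto
      also have "2 * (c * d ^ l * hi \<delta> i l) * (1 + x) = 2 / d * (c * d ^ Suc l * hi \<delta> i (Suc l))"
        using d(2) by (simp add: x_def field_simps)
      finally show ?thesis by simp
    qed
    moreover have "card (A \<union> Y) \<le> card A + card Y" by (rule card_Un_le)
    ultimately have "card (A \<union> Y) \<le> 2 / d * (c * d ^ Suc l * hi \<delta> i (Suc l)) + c * d ^ Suc l * hi \<delta> i (Suc l)"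
      using T(3) Y2 by linarith
    also have "\<dots> = (1 + 2 / d) * (c * d ^ Suc l * hi \<delta> i (Suc l))" by (simp only: distrib_right mult_1 add.commute)
    finally have "card (A \<union> Y) \<le> (1 + 2 / d) * (c * d ^ Suc l * hi \<delta> i (Suc l))" .
    then show ?thesis unfolding Inv_def layer_inv_def L using Y1 Y2 AS by simp
  qed
  have "PR ?M (\<lambda>E. \<not> Inv (Suc l) E) \<le> PR ?M (\<lambda>E. \<not> Inv l E \<or>
      (Inv l E \<and> Q (gball V E W l - prev_ball V E W l) (V - gball V E W l) E))"
    by (rule PR_mono) (use step in blast)
  also have "\<dots> \<le> PR ?M (\<lambda>E. \<not> Inv l E) +
      PR ?M (\<lambda>E. Inv l E \<and> Q (gball V E W l - prev_ball V E W l) (V - gball V E W l) E)"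
    by (rule PR_disj_le)
  also have "\<dots> \<le> 2 * real l * exp (- (\<delta>\<^sup>2 * d / 256)) + \<beta>"
    using Suc bad by (intro add_mono) (auto simp: Inv_def c_def)
  also have "\<dots> = 2 * real (Suc l) * exp (- (\<delta>\<^sup>2 * d / 256))" by (simp add: \<beta>_def algebra_simps)
  finally show ?case by (simp add: Inv_def c_def)
qed

section \<open>Bounds that hold uniformly for all vertices and vertex sets\<close>

context indep_indicators
begin

lemma PR_all: "PR (rset A p) (\<lambda>E. \<forall>v\<in>R. Z v E) = q ^ card R"
proof -
  have "of_bool (\<forall>v\<in>R. Z v E) = (\<Prod>v\<in>R. of_bool (Z v E) :: real)" for E
  proof (cases "\<forall>v\<in>R. Z v E")
    case False
    then obtain v where "v \<in> R" "\<not> Z v E" by blast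
    then have "(\<Prod>v\<in>R. of_bool (Z v E) :: real) = 0" using R by (intro prod_zero) auto
    then show ?thesis using False by simp
  qed simp
  then have "PR (rset A p) (\<lambda>E. \<forall>v\<in>R. Z v E) = EV (rset A p) (\<lambda>E. \<Prod>v\<in>R. of_bool (Z v E))"
    by (simp add: PR_eq_EV)
  also have "\<dots> = (\<Prod>v\<in>R. EV (rset A p) (\<lambda>E. of_bool (Z v E)))"
  proof (rule EV_rset_prod[OF A R disj])
    fix v E assume "v \<in> R" "E \<subseteq> A"
    from Z[OF this] show "of_bool (Z v E) = (of_bool (Z v (E \<inter> F v)) :: real)" by simp
  qed auto
  also have "\<dots> = (\<Prod>v\<in>R. q)" using q by (intro prod.cong) (auto simp: PR_eq_EV)
  finally show ?thesis by simp
qed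

end

lemma card_subsets_le_power:
  assumes "finite R"
  shows "card {Z. Z \<subseteq> R \<and> card Z = m} \<le> card R ^ m"
  using assms by (cases "m \<le> card R") (auto simp: n_subsets binomial_le_pow binomial_eq_0)

lemma finite_subsets_card: "finite R \<Longrightarrow> finite {Z. Z \<subseteq> R \<and> card Z = m}"
  by simp

text \<open>The case x = y includes the single vertices, so one event serves balls around vertices
  and around pairs.\<close>

lemma PR_bfs_uniform:
  fixes d p \<delta> :: real
  assumes V: "finite V" "V \<noteq> {}" and p: "0 \<le> p" "p \<le> 1"
    and d: "d = p * card V" "8 \<le> d" and \<delta>: "0 < \<delta>" "\<delta> \<le> 1/10"
    and small: "d ^ i \<le> \<delta> / 10 * card V"
  shows "PR (gr V p) (\<lambda>E. \<exists>x\<in>V. \<exists>y\<in>V.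
      \<not> layer_inv (card {x, y}) d \<delta> i i (prev_ball V E {x, y} i) (gball V E {x, y} i))
    \<le> (card V)\<^sup>2 * (2 * real i * exp (- (\<delta>\<^sup>2 * d / 256)))"
proof -
  have "PR (gr V p) (\<lambda>E. \<exists>z\<in>V \<times> V.
      \<not> layer_inv (card {fst z, snd z}) d \<delta> i i (prev_ball V E {fst z, snd z} i) (gball V E {fst z, snd z} i))
    \<le> (\<Sum>z\<in>V \<times> V. 2 * real i * exp (- (\<delta>\<^sup>2 * d / 256)))"
  proof (rule PR_union_bound)
    fix z assume z: "z \<in> V \<times> V"
    show "PR (gr V p) (\<lambda>E.
      \<not> layer_inv (card {fst z, snd z}) d \<delta> i i (prev_ball V E {fst z, snd z} i) (gball V E {fst z, snd z} i))
      \<le> 2 * real i * exp (- (\<delta>\<^sup>2 * d / 256))"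
      by (rule bfs_concentration[OF V _ _ _ p d \<delta> small]) (use z in \<open>auto simp: card_insert_if\<close>)
  qed (use V in auto)
  then show ?thesis by (simp add: card_cartesian_product power2_eq_square)
qed

text \<open>The breadth-first estimate has a fixed relative error, but the lower bound raises
  degrees to powers and needs the finer error of order sqrt (ln n / d). The summand 1 is the vertex
  itself, which \<open>nbh\<close> contains.\<close>

lemma PR_degree:
  fixes d p \<epsilon> :: real
  assumes V: "finite V" and p: "0 \<le> p" "p \<le> 1" and d: "d = p * card V" and \<epsilon>: "0 < \<epsilon>" "\<epsilon> \<le> 2"
  shows "PR (gr V p) (\<lambda>E. \<exists>v\<in>V. (1 + \<epsilon>) * d + 1 < card (nbh V E {v}))
    \<le> card V * exp (- d * \<epsilon>\<^sup>2 / 4)"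
proof -
  have "PR (gr V p) (\<lambda>E. \<exists>v\<in>V. (1 + \<epsilon>) * d + 1 < card (nbh V E {v}))
      \<le> (\<Sum>v\<in>V. exp (- d * \<epsilon>\<^sup>2 / 4))"
  proof (rule PR_union_bound[OF V])
    fix v assume v: "v \<in> V"
    interpret I: indep_indicators "all_pairs V" p "V - {v}" "\<lambda>w. (\<lambda>u. {u, w}) ` {v}" "\<lambda>w E. adj E {v} w" "1 - (1 - p) ^ card {v}"
      by (rule indep_adj) (use V v p in auto)
    have "real (card (V - {v})) * (1 - (1 - p) ^ card {v}) \<le> card V * p"
      using p V by (auto intro!: mult_right_mono card_mono)
    then have up: "real (card (V - {v})) * (1 - (1 - p) ^ card {v}) \<le> d" by (simp add: d mult.commute)
    have "PR (gr V p) (\<lambda>E. (1 + \<epsilon>) * d + 1 < card (nbh V E {v})) \<le>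
        PR (gr V p) (\<lambda>E. (1 + \<epsilon>) * d \<le> real (card {w \<in> V - {v}. adj E {v} w}))"
    proof (rule PR_mono)
      fix E assume E: "(1 + \<epsilon>) * d + 1 < card (nbh V E {v})"
      have "nbh V E {v} \<subseteq> insert v {w \<in> V - {v}. adj E {v} w}" by (auto simp: nbh_def adj_def)
      then have "card (nbh V E {v}) \<le> card (insert v {w \<in> V - {v}. adj E {v} w})"
        using V by (intro card_mono) auto
      also have "\<dots> \<le> Suc (card {w \<in> V - {v}. adj E {v} w})" by (rule card_insert_le_m1) auto
      finally show "(1 + \<epsilon>) * d \<le> real (card {w \<in> V - {v}. adj E {v} w})" using E by linarith
    qed
    also have "\<dots> \<le> exp (- d * \<epsilon>\<^sup>2 / 4)" by (rule I.chernoff_upper[OF up \<epsilon>])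
    finally show "PR (gr V p) (\<lambda>E. (1 + \<epsilon>) * d + 1 < card (nbh V E {v})) \<le> exp (- d * \<epsilon>\<^sup>2 / 4)" .
  qed
  then show ?thesis by simp
qed

text \<open>First-moment bound over the \<open>m\<close>-subsets of \<open>R\<close>. In the
  application its base is a negative power of n, so a constant \<open>m\<close> suffices.\<close>

lemma PR_many_nonadj:
  fixes p :: real
  assumes V: "finite V" and T: "T \<subseteq> V" "R \<subseteq> V" "T \<inter> R = {}" and p: "0 \<le> p" "p \<le> 1"
  shows "PR (gr V p) (\<lambda>E. m \<le> card {v \<in> R. \<not> adj E T v}) \<le> (card R * (1 - p) ^ card T) ^ m"
proof -
  let ?I = "{Z. Z \<subseteq> R \<and> card Z = m}"
  have fR: "finite R" by (rule finite_subset[OF T(2) V])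
  have "PR (gr V p) (\<lambda>E. m \<le> card {v \<in> R. \<not> adj E T v}) \<le>
      PR (gr V p) (\<lambda>E. \<exists>Z\<in>?I. \<forall>v\<in>Z. \<not> adj E T v)"
  proof (rule PR_mono)
    fix E assume "m \<le> card {v \<in> R. \<not> adj E T v}"
    from obtain_subset_with_card_n[OF this] obtain Z where "Z \<subseteq> {v \<in> R. \<not> adj E T v}" "card Z = m"
      by blast
    then show "\<exists>Z\<in>?I. \<forall>v\<in>Z. \<not> adj E T v" by (intro bexI[of _ Z]) auto
  qed
  also have "\<dots> \<le> (\<Sum>Z\<in>?I. ((1 - p) ^ card T) ^ m)"
  proof (rule PR_union_bound)
    show "finite ?I" using fR by (rule finite_subsets_card)
    fix Z assume Z: "Z \<in> ?I"
    interpret I: indep_indicators "all_pairs V" p Z "\<lambda>w. (\<lambda>u. {u, w}) ` T" "\<lambda>w E. \<not> adj E T w" "(1 - p) ^ card T"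
      by (rule indep_nonadj) (use V T Z p in auto)
    show "PR (gr V p) (\<lambda>E. \<forall>v\<in>Z. \<not> adj E T v) \<le> ((1 - p) ^ card T) ^ m"
      using I.PR_all Z by simp
  qed
  also have "\<dots> = card ?I * ((1 - p) ^ card T) ^ m" by simp
  also have "\<dots> \<le> real (card R ^ m) * ((1 - p) ^ card T) ^ m"
    by (rule mult_right_mono) (use card_subsets_le_power[OF fR] p in \<open>auto simp del: of_nat_power\<close>)
  finally show ?thesis by (simp add: power_mult_distrib)
qed

text \<open>A vertex beyond radius i + 1 is an unexplored vertex without a neighbour in layer
  \<open>i\<close>. The exposure needs only the size of that layer, hence the invariant
  \<open>t \<le> card (A - A')\<close>.\<close>

lemma PR_far_vertices:
  fixes p :: real
  assumes V: "finite V" and p: "0 \<le> p" "p \<le> 1"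
  shows "PR (gr V p) (\<lambda>E. \<exists>u\<in>V. t \<le> card (gball V E {u} i - prev_ball V E {u} i) \<and>
      m \<le> card (V - gball V E {u} (Suc i))) \<le> card V * (card V * (1 - p) ^ t) ^ m"
proof -
  have "PR (gr V p) (\<lambda>E. \<exists>u\<in>V. t \<le> card (gball V E {u} i - prev_ball V E {u} i) \<and>
      m \<le> card (V - gball V E {u} (Suc i))) \<le> (\<Sum>u\<in>V. (card V * (1 - p) ^ t) ^ m)"
  proof (rule PR_union_bound[OF V])
    fix u assume u: "u \<in> V"
    define Q where "Q T R E \<longleftrightarrow> m \<le> card {v \<in> R. \<not> adj E T v}" for T R :: "'a set" and E
    have "V - gball V E {u} (Suc i) =
        {v \<in> V - gball V E {u} i. \<not> adj E (gball V E {u} i - prev_ball V E {u} i) v}" for E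
      by (subst gball_Suc_layer) auto
    then have "PR (gr V p) (\<lambda>E. t \<le> card (gball V E {u} i - prev_ball V E {u} i) \<and>
        m \<le> card (V - gball V E {u} (Suc i))) =
      PR (gr V p) (\<lambda>E. t \<le> card (gball V E {u} i - prev_ball V E {u} i) \<and>
        Q (gball V E {u} i - prev_ball V E {u} i) (V - gball V E {u} i) E)"
      by (simp add: Q_def)
    also have "\<dots> \<le> (card V * (1 - p) ^ t) ^ m"
    proof (rule PR_exposure[OF V, where Inv = "\<lambda>A' A. t \<le> card (A - A')"])
      show "{u} \<subseteq> V" using u by simp
      show "0 \<le> (card V * (1 - p) ^ t) ^ m" using p by simp
      show "Q T R E \<longleftrightarrow> Q T R (E \<inter> cross T R)" for T R E
        using adj_Int_cross[of _ R E T] by (simp add: Q_def cong: conj_cong)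
      fix A' A :: "'a set" assume A: "A' \<subseteq> A" "A \<subseteq> V" "t \<le> card (A - A')"
      have "PR (gr V p) (\<lambda>E. Q (A - A') (V - A) E) \<le> (card (V - A) * (1 - p) ^ card (A - A')) ^ m"
        unfolding Q_def by (rule PR_many_nonadj) (use V p A in auto)
      also have "\<dots> \<le> (card V * (1 - p) ^ t) ^ m"
        using p A V by (intro power_mono mult_mono power_decreasing) (auto intro!: card_mono)
      finally show "PR (gr V p) (\<lambda>E. Q (A - A') (V - A) E) \<le> (card V * (1 - p) ^ t) ^ m" .
    qed
    finally show "PR (gr V p) (\<lambda>E. t \<le> card (gball V E {u} i - prev_ball V E {u} i) \<and>
        m \<le> card (V - gball V E {u} (Suc i))) \<le> (card V * (1 - p) ^ t) ^ m" .
  qed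
  then show ?thesis by simp
qed

lemma PR_no_cross_edge:
  fixes p :: real
  assumes V: "finite V" and p: "0 \<le> p" "p \<le> 1"
  shows "PR (gr V p) (\<lambda>E. \<exists>A\<subseteq>V. \<exists>B\<subseteq>V. A \<inter> B = {} \<and> card A = m \<and> card B = m \<and>
      (\<forall>a\<in>A. \<forall>b\<in>B. {a, b} \<notin> E)) \<le> real (card V) ^ (2 * m) * (1 - p) ^ (m * m)"
proof -
  let ?I = "{A. A \<subseteq> V \<and> card A = m} \<times> {A. A \<subseteq> V \<and> card A = m}"
  have I: "finite ?I" using V by (intro finite_cartesian_product finite_subsets_card)
  have "PR (gr V p) (\<lambda>E. \<exists>A\<subseteq>V. \<exists>B\<subseteq>V. A \<inter> B = {} \<and> card A = m \<and> card B = m \<and>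
      (\<forall>a\<in>A. \<forall>b\<in>B. {a, b} \<notin> E)) \<le>
    PR (gr V p) (\<lambda>E. \<exists>z\<in>?I. fst z \<inter> snd z = {} \<and> (\<forall>b\<in>snd z. \<not> adj E (fst z) b))"
  proof (rule PR_mono, elim exE conjE)
    fix E A B assume "A \<subseteq> V" "B \<subseteq> V" "A \<inter> B = {}" "card A = m" "card B = m" "\<forall>a\<in>A. \<forall>b\<in>B. {a, b} \<notin> E"
    then show "\<exists>z\<in>?I. fst z \<inter> snd z = {} \<and> (\<forall>b\<in>snd z. \<not> adj E (fst z) b)"
      by (intro bexI[of _ "(A, B)"]) (auto simp: adj_def)
  qed
  also have "\<dots> \<le> (\<Sum>z\<in>?I. ((1 - p) ^ m) ^ m)"
  proof (rule PR_union_bound[OF I])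
    fix z assume z: "z \<in> ?I"
    show "PR (gr V p) (\<lambda>E. fst z \<inter> snd z = {} \<and> (\<forall>b\<in>snd z. \<not> adj E (fst z) b)) \<le> ((1 - p) ^ m) ^ m"
    proof (cases "fst z \<inter> snd z = {}")
      case True
      interpret I: indep_indicators "all_pairs V" p "snd z" "\<lambda>w. (\<lambda>u. {u, w}) ` fst z" "\<lambda>w E. \<not> adj E (fst z) w" "(1 - p) ^ card (fst z)"
        by (rule indep_nonadj) (use V p z True in auto)
      show ?thesis using I.PR_all z True by auto
    qed (use p in simp)
  qed
  also have "\<dots> = card ?I * ((1 - p) ^ m) ^ m" by simp
  also have "real (card ?I) \<le> real (card V ^ m * card V ^ m)"
    unfolding card_cartesian_product of_nat_le_iff by (intro mult_mono card_subsets_le_power V) auto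
  finally show ?thesis using p
    by (simp add: mult_right_mono power_mult[symmetric] mult_2 power_add)
qed

text \<open>Each \<open>T\<close> is fixed before any edge is revealed. It will stand for the ball
  of radius i - 1 around the sensors, whose dependence on the graph is thus paid for by the union
  bound.\<close>

lemma PR_few_nonneighbours:
  fixes M p :: real
  assumes V: "finite V" and p: "0 \<le> p" "p \<le> 1"
    and M: "M \<le> real (card V - k) * (1 - p) ^ k"
  shows "PR (gr V p) (\<lambda>E. \<exists>T\<subseteq>V. card T = k \<and> card (V - nbh V E T) \<le> M / 2)
    \<le> real (card V) ^ k * exp (- M / 16)"
proof -
  let ?I = "{A. A \<subseteq> V \<and> card A = k}"
  have I: "finite ?I" using V by (intro finite_subsets_card)
  have "PR (gr V p) (\<lambda>E. \<exists>T\<subseteq>V. card T = k \<and> card (V - nbh V E T) \<le> M / 2) \<le>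
    PR (gr V p) (\<lambda>E. \<exists>T\<in>?I. card (V - nbh V E T) \<le> M / 2)"
    by (rule PR_mono) auto
  also have "\<dots> \<le> (\<Sum>T\<in>?I. exp (- M / 16))"
  proof (rule PR_union_bound[OF I])
    fix T assume T: "T \<in> ?I"
    interpret I: indep_indicators "all_pairs V" p "V - T" "\<lambda>w. (\<lambda>u. {u, w}) ` T" "\<lambda>w E. \<not> adj E T w" "(1 - p) ^ card T"
      by (rule indep_nonadj) (use V p T in auto)
    have "V - nbh V E T = {v \<in> V - T. \<not> adj E T v}" for E by (auto simp: nbh_def adj_def)
    then have "PR (gr V p) (\<lambda>E. card (V - nbh V E T) \<le> M / 2)
        = PR (gr V p) (\<lambda>E. real (card {v \<in> V - T. \<not> adj E T v}) \<le> (1 - 1/2) * M)" by simp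
    also have "\<dots> \<le> exp (- M * (1/2)\<^sup>2 / 4)"
    proof (rule I.chernoff_lower)
      have "finite T" by (rule finite_subset[OF _ V]) (use T in auto)
      then show "M \<le> real (card (V - T)) * (1 - p) ^ card T" using M T card_Diff_subset[of T V] by auto
    qed auto
    also have "\<dots> = exp (- M / 16)" by (simp add: power2_eq_square)
    finally show "PR (gr V p) (\<lambda>E. card (V - nbh V E T) \<le> M / 2) \<le> exp (- M / 16)" .
  qed
  also have "\<dots> = card ?I * exp (- M / 16)" by simp
  also have "\<dots> \<le> real (card V ^ k) * exp (- M / 16)"
    by (rule mult_right_mono) (use card_subsets_le_power[OF V] in \<open>auto simp del: of_nat_power\<close>)
  finally show ?thesis by simp
qed

section \<open>Collisions of neighbourhoods\<close>

definition nbs :: "'a set set \<Rightarrow> 'a set \<Rightarrow> 'a \<Rightarrow> 'a set" where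
  "nbs E S v = {s \<in> S. {s, v} \<in> E}"

text \<open>The probability with which a vertex outside \<open>S\<close> has exactly the
  neighbourhood \<open>y\<close> in \<open>S\<close>.\<close>

definition wt :: "real \<Rightarrow> 'a set \<Rightarrow> 'a set \<Rightarrow> real" where
  "wt p S y = p ^ card y * (1 - p) ^ card (S - y)"

lemma PR_nbs_eq:
  assumes V: "finite V" and S: "S \<subseteq> V" "v \<in> V - S" "y \<subseteq> S" and p: "0 \<le> p" "p \<le> 1"
  shows "PR (gr V p) (\<lambda>E. nbs E S v = y) = wt p S y"
proof -
  let ?g = "\<lambda>s. {s, v}"
  have inj: "inj_on ?g X" if "X \<subseteq> S" for X
    using that S by (intro inj_onI) (auto simp: doubleton_eq_iff)
  have "nbs E S v = y \<longleftrightarrow> E \<inter> ?g ` S = ?g ` y" for E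
  proof
    assume "E \<inter> ?g ` S = ?g ` y"
    then have "s \<in> nbs E S v \<longleftrightarrow> s \<in> y" if "s \<in> S" for s
      using that inj_on_image_mem_iff[OF inj[OF subset_refl] that S(3)] by (auto simp: nbs_def)
    then show "nbs E S v = y" using S by (auto simp: nbs_def)
  qed (auto simp: nbs_def)
  then have "PR (gr V p) (\<lambda>E. nbs E S v = y) =
      PR (gr V p) (\<lambda>E. E \<inter> ?g ` S = ?g ` y)" by simp
  also have "\<dots> = p ^ card (?g ` y) * (1 - p) ^ card (?g ` S - ?g ` y)"
    by (rule PR_rset_Int_eq) (use V S p pair_in_all_pairs[of _ V v] in auto)
  also have "?g ` S - ?g ` y = ?g ` (S - y)"
    by (rule inj_on_image_set_diff[OF inj, symmetric, of S]) (use S in auto)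
  also have "card (?g ` (S - y)) = card (S - y)" by (rule card_image[OF inj]) auto
  also have "card (?g ` y) = card y" by (rule card_image[OF inj[OF S(3)]])
  finally show ?thesis by (simp add: wt_def)
qed

lemma EV_discrete:
  fixes f :: "'b \<Rightarrow> real"
  assumes fin: "finite (set_pmf M)" "finite Y" and g: "\<And>x. g x \<in> Y"
  shows "EV M (\<lambda>x. f (g x)) = (\<Sum>y\<in>Y. f y * PR M (\<lambda>x. g x = y))"
proof -
  have "f (g x) = (\<Sum>y\<in>Y. f y * of_bool (g x = y))" for x
  proof -
    have "(\<Sum>y\<in>Y. f y * of_bool (g x = y)) = (\<Sum>y\<in>Y. if g x = y then f y else 0)"
      by (rule sum.cong) auto
    then show ?thesis using fin g[of x] by simp
  qed
  then have "EV M (\<lambda>x. f (g x)) = EV M (\<lambda>x. \<Sum>y\<in>Y. f y * of_bool (g x = y))" by simp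
  also have "\<dots> = (\<Sum>y\<in>Y. EV M (\<lambda>x. f y * of_bool (g x = y)))"
    by (rule Bochner_Integration.integral_sum) (simp add: integrable_measure_pmf_finite fin)
  finally show ?thesis by (simp add: PR_eq_EV)
qed

lemma sum_Pow_powers:
  fixes a b :: real
  assumes "finite S"
  shows "(\<Sum>y\<in>Pow S. a ^ card y * b ^ card (S - y)) = (a + b) ^ card S"
  using prod_add[OF assms, of "\<lambda>_. a" "\<lambda>_. b"] by simp

lemma wt_power: "wt p S y ^ m = (p ^ m) ^ card y * ((1 - p) ^ m) ^ card (S - y)"
  by (simp add: wt_def power_mult_distrib power_mult[symmetric] mult.commute)

text \<open>For m = 2 and m = 3 these are the first two moments of the weight of a random
  neighbourhood: the probabilities that two, or three, vertices agree on \<open>S\<close>.\<close>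

lemma sum_wt_power:
  assumes "finite S"
  shows "(\<Sum>y\<in>Pow S. wt p S y ^ m) = (p ^ m + (1 - p) ^ m) ^ card S"
  using sum_Pow_powers[OF assms] by (simp add: wt_power)

lemma wt_nonneg: "0 \<le> p \<Longrightarrow> p \<le> 1 \<Longrightarrow> 0 \<le> wt p S y"
  by (simp add: wt_def)

text \<open>Birthday argument: split \<open>R\<close> into two halves. The total probability of the values taken on the
  first half is unlikely to be less than a quarter of its expectation \<open>N r\<close>, and the values on the
  second half have to avoid all of these.\<close>

lemma PR_inj_nbs:
  fixes p :: real
  assumes V: "finite V" and RS: "R \<subseteq> V" "S \<subseteq> V" "R \<inter> S = {}" and p: "0 \<le> p" "p \<le> 1"
    and N: "2 * N \<le> card R"
    and r: "r = (p\<^sup>2 + (1 - p)\<^sup>2) ^ card S" and s: "s = (p ^ 3 + (1 - p) ^ 3) ^ card S"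
  shows "PR (gr V p) (\<lambda>E. inj_on (nbs E S) R) \<le>
    exp (- (N * r\<^sup>2 / (8 * s))) + exp (- ((real N)\<^sup>2 * r / 4))"
proof -
  let ?M = "gr V p"
  have fin: "finite S" "finite R" "finite (all_pairs V)" using RS V by (auto intro: finite_subset)
  have finM: "finite (set_pmf ?M)" using V by simp
  obtain R1 where R1: "R1 \<subseteq> R" "card R1 = N" using obtain_subset_with_card_n[of N R] N by auto
  have fR1: "finite R1" using R1 fin by (auto intro: finite_subset)
  have "N \<le> card (R - R1)" using card_Diff_subset[OF fR1 R1(1)] R1 N by simp
  then obtain R2 where R2: "R2 \<subseteq> R - R1" "card R2 = N" using obtain_subset_with_card_n by blast
  have fR2: "finite R2" using R2(1) fin by (auto intro: finite_subset)
  define tot where "tot E = (\<Sum>v\<in>R1. wt p S (nbs E S v))" for E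
  define \<theta> where "\<theta> = N * r / 4"
  have s0: "s > 0"
  proof -
    have "p > 0 \<or> 1 - p > 0" by auto
    then have "p ^ 3 + (1 - p) ^ 3 > 0" using p by (auto intro: add_pos_nonneg add_nonneg_pos)
    then show ?thesis by (simp add: s)
  qed
  have nbs_local: "nbs E S v = nbs (E \<inter> cross S T) S v" if "v \<in> T" for E v T
    using that by (auto simp: nbs_def cross_def)
  have cross_disj: "cross S T \<inter> cross S T' = {}" if "T \<subseteq> R" "T' \<subseteq> R" "T \<inter> T' = {}" for T T'
    using that RS unfolding cross_def disjoint_iff by (fastforce simp: doubleton_eq_iff)
  have EVf: "EV ?M (\<lambda>E. f (nbs E S v)) = (\<Sum>y\<in>Pow S. f y * wt p S y)" if "v \<in> R" for f :: "'a set \<Rightarrow> real" and v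
  proof -
    have "EV ?M (\<lambda>E. f (nbs E S v)) = (\<Sum>y\<in>Pow S. f y * PR ?M (\<lambda>E. nbs E S v = y))"
      by (rule EV_discrete[OF finM]) (use fin in \<open>auto simp: nbs_def\<close>)
    also have "\<dots> = (\<Sum>y\<in>Pow S. f y * wt p S y)"
    proof (rule sum.cong[OF refl])
      fix y assume y: "y \<in> Pow S"
      have "PR ?M (\<lambda>E. nbs E S v = y) = wt p S y"
        by (rule PR_nbs_eq[OF V RS(2) _ _ p]) (use y RS that in auto)
      then show "f y * PR ?M (\<lambda>E. nbs E S v = y) = f y * wt p S y" by simp
    qed
    finally show ?thesis .
  qed
  have one: "PR ?M (\<lambda>E. tot E \<le> \<theta>) \<le> exp (- (N * r\<^sup>2 / (8 * s)))"
  proof -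
    \<comment> \<open>Minimises the exponent - t r + t^2 s of a single vertex. Together with
      \<open>\<theta>\<close> = N r / 4 the total is N r^2 / s times - 1/2 + 1/4 + 1/8 = -
      1/8.\<close>
    define t where "t = r / (2 * s)"
    have t0: "0 \<le> t" using s0 p by (simp add: t_def r)
    have "PR ?M (\<lambda>E. tot E \<le> \<theta>) \<le> EV ?M (\<lambda>E. exp (t * \<theta>) * exp (- t * tot E))"
      unfolding PR_eq_EV
    proof (rule EV_rset_mono)
      fix E
      have "1 \<le> exp (t * (\<theta> - tot E))" if "tot E \<le> \<theta>" using that t0 by simp
      then show "of_bool (tot E \<le> \<theta>) \<le> exp (t * \<theta>) * exp (- t * tot E)"
        by (simp add: mult_exp_exp right_diff_distrib)
    qed (use fin in auto)
    also have "\<dots> = exp (t * \<theta>) * EV ?M (\<lambda>E. \<Prod>v\<in>R1. exp (- t * wt p S (nbs E S v)))"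
      by (simp add: tot_def sum_distrib_left exp_sum fR1 sum_negf[symmetric])
    also have "EV ?M (\<lambda>E. \<Prod>v\<in>R1. exp (- t * wt p S (nbs E S v))) =
        (\<Prod>v\<in>R1. EV ?M (\<lambda>E. exp (- t * wt p S (nbs E S v))))"
    proof (rule EV_rset_prod[where F = "\<lambda>v. cross S {v}"])
      show "cross S {v} \<inter> cross S {w} = {}" if "v \<in> R1" "w \<in> R1" "v \<noteq> w" for v w
        by (rule cross_disj) (use that R1 in auto)
      show "exp (- t * wt p S (nbs E S v)) = exp (- t * wt p S (nbs (E \<inter> cross S {v}) S v))" for v E
        using nbs_local[of v "{v}" E] by simp
    qed (use fin fR1 in auto)
    also have "\<dots> \<le> (\<Prod>v\<in>R1. exp (- t * r + t\<^sup>2 * s))"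
    proof (rule prod_mono, intro conjI)
      fix v assume v: "v \<in> R1"
      show "0 \<le> EV ?M (\<lambda>E. exp (- t * wt p S (nbs E S v)))" by (intro integral_nonneg_AE) auto
      have "EV ?M (\<lambda>E. exp (- t * wt p S (nbs E S v))) = (\<Sum>y\<in>Pow S. exp (- t * wt p S y) * wt p S y)"
        by (rule EVf) (use v R1 in auto)
      also have "\<dots> \<le> (\<Sum>y\<in>Pow S. (1 - t * wt p S y + (t * wt p S y)\<^sup>2) * wt p S y)"
      proof (intro sum_mono mult_right_mono)
        fix y
        show "exp (- t * wt p S y) \<le> 1 - t * wt p S y + (t * wt p S y)\<^sup>2"
          using exp_le_quadratic[of "- (t * wt p S y)"] t0 wt_nonneg[OF p, of S y]
            mult_nonneg_nonneg[OF t0 wt_nonneg[OF p, of S y]] by simp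
        show "0 \<le> wt p S y" by (rule wt_nonneg[OF p])
      qed
      also have "\<dots> = (\<Sum>y\<in>Pow S. wt p S y ^ 1) - t * (\<Sum>y\<in>Pow S. wt p S y ^ 2) + t\<^sup>2 * (\<Sum>y\<in>Pow S. wt p S y ^ 3)"
        unfolding sum_distrib_left sum_subtractf[symmetric] sum.distrib[symmetric]
        by (rule sum.cong) (simp_all add: power2_eq_square power3_eq_cube algebra_simps)
      also have "\<dots> = 1 - t * r + t\<^sup>2 * s" by (simp only: sum_wt_power[OF fin(1)] r s) simp
      also have "\<dots> \<le> exp (- t * r + t\<^sup>2 * s)" using exp_ge_add_one_self[of "- t * r + t\<^sup>2 * s"] by linarith
      finally show "EV ?M (\<lambda>E. exp (- t * wt p S (nbs E S v))) \<le> exp (- t * r + t\<^sup>2 * s)" .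
    qed
    also have "\<dots> = exp (N * (- t * r + t\<^sup>2 * s))" using R1 by (simp add: exp_of_nat_mult)
    also have "exp (t * \<theta>) * \<dots> = exp (- (N * r\<^sup>2 / (8 * s)))"
    proof -
      have "t * \<theta> + N * (- t * r + t\<^sup>2 * s) = - (N * r\<^sup>2 / (8 * s))"
        using s0 by (simp add: t_def \<theta>_def field_simps power2_eq_square)
      then show ?thesis by (simp add: mult_exp_exp)
    qed
    finally show ?thesis by simp
  qed
  define C where "C = cross S R1"
  \<comment> \<open>\<open>z\<close> stands for the edges between \<open>S\<close> and the first
    half. Given those, the edges to the second half are still fresh.\<close>
  define Q where "Q z E \<longleftrightarrow> inj_on (nbs z S) R1 \<and> \<theta> \<le> tot z \<and> (\<forall>u\<in>R2. nbs E S u \<notin> nbs z S ` R1)" for z E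
  have two: "PR ?M (\<lambda>E. Q (E \<inter> C) E) \<le> exp (- ((real N)\<^sup>2 * r / 4))"
  proof (rule PR_le_by_cases[OF finM, where f = "\<lambda>E. E \<inter> C" and Q = Q])
    fix z
    show "PR ?M (\<lambda>E. E \<inter> C = z \<and> Q z E) \<le> exp (- ((real N)\<^sup>2 * r / 4)) * PR ?M (\<lambda>E. E \<inter> C = z)"
    proof (cases "inj_on (nbs z S) R1 \<and> \<theta> \<le> tot z")
      case True
      define D where "D = nbs z S ` R1"
      define q where "q = (\<Sum>y\<in>D. wt p S y)"
      have D: "D \<subseteq> Pow S" by (auto simp: D_def nbs_def)
      \<comment> \<open>Injectivity on the first half makes \<open>tot\<close> a sum over distinct
        values, that is, the probability that a new vertex hits one of them.\<close>
      have q: "\<theta> \<le> q" using True by (simp add: q_def D_def sum.reindex tot_def)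
      have "PR ?M (\<lambda>E. E \<inter> C = z \<and> Q z E) = PR ?M (\<lambda>E. E \<inter> C = z \<and> (\<forall>u\<in>R2. nbs E S u \<notin> D))"
        using True by (simp add: Q_def D_def)
      also have "\<dots> = PR ?M (\<lambda>E. E \<inter> C = z) * PR ?M (\<lambda>E. \<forall>u\<in>R2. nbs E S u \<notin> D)"
      proof (rule PR_rset_indep[where B = C and C = "cross S R2"])
        show "C \<inter> cross S R2 \<inter> all_pairs V = {}" using cross_disj[of R1 R2] R1 R2 by (auto simp: C_def)
        show "(\<forall>u\<in>R2. nbs E S u \<notin> D) = (\<forall>u\<in>R2. nbs (E \<inter> cross S R2) S u \<notin> D)" for E
          using nbs_local[of _ R2 E] by simp
      qed (use fin in \<open>auto simp: Int_assoc\<close>)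
      finally have eq: "PR ?M (\<lambda>E. E \<inter> C = z \<and> Q z E) =
          PR ?M (\<lambda>E. E \<inter> C = z) * PR ?M (\<lambda>E. \<forall>u\<in>R2. nbs E S u \<notin> D)" .
      have "PR ?M (\<lambda>E. \<forall>u\<in>R2. nbs E S u \<notin> D) \<le> exp (- ((real N)\<^sup>2 * r / 4))"
      proof -
        interpret I: indep_indicators "all_pairs V" p R2 "\<lambda>v. cross S {v}" "\<lambda>v E. nbs E S v \<notin> D" "1 - q"
        proof
          show "cross S {v} \<inter> cross S {w} = {}" if "v \<in> R2" "w \<in> R2" "v \<noteq> w" for v w
            by (rule cross_disj) (use that R2 in auto)
          show "(nbs E S v \<notin> D) = (nbs (E \<inter> cross S {v}) S v \<notin> D)" for v E
            using nbs_local[of v "{v}" E] by simp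
          fix v assume v: "v \<in> R2"
          have "PR ?M (\<lambda>E. nbs E S v \<in> D) = (\<Sum>y\<in>Pow S. of_bool (y \<in> D) * wt p S y)"
            unfolding PR_eq_EV by (rule EVf) (use v R2 in auto)
          also have "\<dots> = (\<Sum>y\<in>D. wt p S y)"
            using D fin by (intro sum.mono_neutral_cong_right) auto
          finally show "PR ?M (\<lambda>E. nbs E S v \<notin> D) = 1 - q" by (simp add: PR_not q_def)
        qed (use fin fR2 in auto)
        have "PR ?M (\<lambda>E. \<forall>u\<in>R2. nbs E S u \<notin> D) = (1 - q) ^ N" using I.PR_all R2 by simp
        also have "\<dots> \<le> exp (- q) ^ N"
        proof (cases "N = 0")
          case False
          then have "R2 \<noteq> {}" using R2 by auto
          then have "0 \<le> 1 - q" using I.q_bounds by simp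
          then show ?thesis using exp_ge_add_one_self[of "- q"] by (intro power_mono) auto
        qed simp
        also have "\<dots> \<le> exp (- \<theta>) ^ N" using q by (intro power_mono) auto
        also have "\<dots> = exp (- ((real N)\<^sup>2 * r / 4))"
          by (simp add: exp_of_nat_mult[symmetric] \<theta>_def power2_eq_square)
        finally show ?thesis .
      qed
      from mult_left_mono[OF this measure_nonneg] show ?thesis unfolding eq by (simp add: mult.commute)
    next
      case False
      then have "PR ?M (\<lambda>E. E \<inter> C = z \<and> Q z E) = PR ?M (\<lambda>_. False)"
        by (intro arg_cong[where f = "measure_pmf.prob _"]) (auto simp: Q_def)
      then show ?thesis by simp
    qed
  qed simp
  have "PR ?M (\<lambda>E. inj_on (nbs E S) R) \<le> PR ?M (\<lambda>E. tot E \<le> \<theta> \<or> Q (E \<inter> C) E)"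
  proof (rule PR_mono)
    fix E assume inj: "inj_on (nbs E S) R"
    have loc: "nbs (E \<inter> C) S v = nbs E S v" if "v \<in> R1" for v
      using nbs_local[OF that, of E] by (simp add: C_def)
    have "inj_on (nbs (E \<inter> C) S) R1"
      using inj_on_subset[OF inj R1(1)] loc by (simp add: inj_on_def)
    moreover have "tot (E \<inter> C) = tot E" using loc by (simp add: tot_def)
    moreover have "nbs (E \<inter> C) S ` R1 = nbs E S ` R1" using loc by (intro image_cong) auto
    moreover have "nbs E S u \<notin> nbs E S ` R1" if "u \<in> R2" for u
    proof
      assume "nbs E S u \<in> nbs E S ` R1"
      then obtain w where w: "w \<in> R1" "nbs E S u = nbs E S w" by blast
      then have "u = w" using inj that R1 R2 by (auto dest: inj_onD)
      then show False using w that R2 by auto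
    qed
    ultimately show "tot E \<le> \<theta> \<or> Q (E \<inter> C) E" by (auto simp: Q_def)
  qed
  also have "\<dots> \<le> PR ?M (\<lambda>E. tot E \<le> \<theta>) + PR ?M (\<lambda>E. Q (E \<inter> C) E)" by (rule PR_disj_le)
  finally show ?thesis using one two by simp
qed

text \<open>The product of 1 - x + x^2 / 2 and 1 + x + x^2 / 2 is 1 + x^4 / 4. The coefficient 1/2
  matters: at x = 2 p the bound is exactly p^2 + (1 - p)^2.\<close>

lemma exp_minus_le_quadratic:
  fixes x :: real
  assumes x: "0 \<le> x"
  shows "exp (- x) \<le> 1 - x + x\<^sup>2 / 2"
proof -
  have "1 \<le> 1 + x ^ 4 / 4" by simp
  also have "\<dots> = (1 - x + x\<^sup>2 / 2) * (1 + x + x\<^sup>2 / 2)"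
    by (simp add: power2_eq_square power4_eq_xxxx field_simps)
  also have "\<dots> \<le> (1 - x + x\<^sup>2 / 2) * exp x"
  proof (rule mult_left_mono[OF exp_lower_Taylor_quadratic[OF x]])
    have "1 - x + x\<^sup>2 / 2 = (1 - x)\<^sup>2 / 2 + 1 / 2" by (simp add: power2_eq_square field_simps)
    moreover have "0 \<le> (1 - x)\<^sup>2 / 2 + 1 / 2" by (intro add_nonneg_nonneg) auto
    ultimately show "0 \<le> 1 - x + x\<^sup>2 / 2" by (simp only:)
  qed
  finally show ?thesis by (simp add: exp_minus field_simps)
qed

text \<open>With q = p (1 - p) the two bases are 1 - 2 q and 1 - 3 q. Here (1 - 2 q)^2 exceeds (1 -
  q) (1 - 3 q) by q^2, and exp(- p) <= 1 - q.\<close>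

lemma collision_exponents:
  fixes p :: real and m k :: nat
  assumes p: "0 \<le> p" "p \<le> 1" and m: "m \<le> k"
  shows "exp (- (2 * p * k)) \<le> (p\<^sup>2 + (1 - p)\<^sup>2) ^ m"
    and "exp (- (p * k)) \<le> ((p\<^sup>2 + (1 - p)\<^sup>2) ^ m)\<^sup>2 / (p ^ 3 + (1 - p) ^ 3) ^ m"
proof -
  have mono: "exp (- (c * k)) \<le> exp (- c) ^ m" if "0 \<le> c" for c :: real
    using mult_left_mono[of "real m" k c] that m by (simp add: exp_of_nat_mult[symmetric] mult.commute)
  have "exp (- (2 * p)) \<le> 1 - 2 * p + (2 * p)\<^sup>2 / 2" by (rule exp_minus_le_quadratic) (use p in simp)
  also have "\<dots> = p\<^sup>2 + (1 - p)\<^sup>2" by (simp add: power2_eq_square field_simps)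
  finally have "exp (- (2 * p)) \<le> p\<^sup>2 + (1 - p)\<^sup>2" .
  then have "exp (- (2 * p)) ^ m \<le> (p\<^sup>2 + (1 - p)\<^sup>2) ^ m" by (rule power_mono) simp
  then show "exp (- (2 * p * k)) \<le> (p\<^sup>2 + (1 - p)\<^sup>2) ^ m" using mono[of "2 * p"] p by simp
  have pos: "p ^ 3 + (1 - p) ^ 3 > 0"
  proof -
    have "p > 0 \<or> 1 - p > 0" by auto
    then show ?thesis using p by (auto intro: add_pos_nonneg add_nonneg_pos)
  qed
  have "exp (- p) \<le> (p\<^sup>2 + (1 - p)\<^sup>2)\<^sup>2 / (p ^ 3 + (1 - p) ^ 3)"
  proof -
    define q where "q = p - p\<^sup>2"
    have "exp (- p) \<le> 1 - q" using exp_le_quadratic[of "- p"] p by (simp add: q_def)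
    then have "exp (- p) * (p ^ 3 + (1 - p) ^ 3) \<le> (1 - q) * (p ^ 3 + (1 - p) ^ 3)"
      using pos by (intro mult_right_mono) auto
    also have "p ^ 3 + (1 - p) ^ 3 = 1 - 3 * q"
      by (simp add: q_def power2_eq_square power3_eq_cube algebra_simps)
    also have "(1 - q) * (1 - 3 * q) \<le> (1 - 2 * q)\<^sup>2" by (simp add: power2_eq_square algebra_simps)
    also have "1 - 2 * q = p\<^sup>2 + (1 - p)\<^sup>2" by (simp add: q_def power2_eq_square algebra_simps)
    finally show ?thesis using pos by (simp add: field_simps q_def power2_eq_square power3_eq_cube)
  qed
  then have "exp (- p) ^ m \<le> ((p\<^sup>2 + (1 - p)\<^sup>2)\<^sup>2 / (p ^ 3 + (1 - p) ^ 3)) ^ m" by (rule power_mono) simp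
  also have "\<dots> = ((p\<^sup>2 + (1 - p)\<^sup>2) ^ m)\<^sup>2 / (p ^ 3 + (1 - p) ^ 3) ^ m"
    by (simp add: power_divide power_mult[symmetric] mult.commute)
  finally show "exp (- (p * k)) \<le> ((p\<^sup>2 + (1 - p)\<^sup>2) ^ m)\<^sup>2 / (p ^ 3 + (1 - p) ^ 3) ^ m"
    using mono[of p] p by simp
qed

lemma PR_inj_nbs':
  fixes p :: real
  assumes V: "finite V" and RS: "R \<subseteq> V" "S \<subseteq> V" "R \<inter> S = {}" and p: "0 \<le> p" "p \<le> 1"
    and N: "2 * N \<le> card R" and k: "card S \<le> k"
  shows "PR (gr V p) (\<lambda>E. inj_on (nbs E S) R) \<le>
    exp (- (N * exp (- (p * k)) / 8)) + exp (- ((N * exp (- (p * k)))\<^sup>2 / 4))"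
proof -
  define r where "r = (p\<^sup>2 + (1 - p)\<^sup>2) ^ card S"
  define s where "s = (p ^ 3 + (1 - p) ^ 3) ^ card S"
  note e = collision_exponents[OF p k, folded r_def s_def]
  have "PR (gr V p) (\<lambda>E. inj_on (nbs E S) R) \<le>
    exp (- (N * r\<^sup>2 / (8 * s))) + exp (- ((real N)\<^sup>2 * r / 4))"
    by (rule PR_inj_nbs[OF V RS p N r_def s_def])
  also have "\<dots> \<le> exp (- (N * exp (- (p * k)) / 8)) + exp (- ((N * exp (- (p * k)))\<^sup>2 / 4))"
  proof -
    have "N * exp (- (p * k)) \<le> N * (r\<^sup>2 / s)" using e(2) by (rule mult_left_mono) simp
    then have "exp (- (N * r\<^sup>2 / (8 * s))) \<le> exp (- (N * exp (- (p * k)) / 8))" by (simp add: field_simps)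
    moreover have "exp (- (p * k)) * exp (- (p * k)) = exp (- (2 * p * k))" by (simp add: mult_exp_exp)
    then have "(N * exp (- (p * k)))\<^sup>2 = (real N)\<^sup>2 * exp (- (2 * p * k))"
      by (simp add: power_mult_distrib power2_eq_square)
    then have "(N * exp (- (p * k)))\<^sup>2 \<le> (real N)\<^sup>2 * r" using e(1) by (simp add: mult_left_mono)
    then have "exp (- ((real N)\<^sup>2 * r / 4)) \<le> exp (- ((N * exp (- (p * k)))\<^sup>2 / 4))" by simp
    ultimately show ?thesis by (rule add_mono)
  qed
  finally show ?thesis .
qed

text \<open>The neighbourhood of \<open>a\<close> is random, so the edges at \<open>a\<close> are
  revealed first and the birthday bound is applied to the others. This is why \<open>a\<close> is
  removed from the sensors; it cannot distinguish its own neighbours anyway.\<close>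

lemma PR_no_collision:
  fixes p :: real
  assumes V: "finite V" and p: "0 \<le> p" "p \<le> 1"
    and \<beta>: "\<beta> = exp (- (N * exp (- (p * k)) / 8)) + exp (- ((N * exp (- (p * k)))\<^sup>2 / 4))"
  shows "PR (gr V p) (\<lambda>E. \<exists>a\<in>V. \<exists>S\<subseteq>V. card S = k \<and>
      2 * N \<le> card (nbs E V a - S) \<and> inj_on (nbs E (S - {a})) (nbs E V a - S)) \<le> real (card V) ^ (k + 1) * \<beta>"
proof -
  let ?M = "gr V p"
  let ?I = "V \<times> {S. S \<subseteq> V \<and> card S = k}"
  have I: "finite ?I" using V by (intro finite_cartesian_product finite_subsets_card)
  have \<beta>0: "0 \<le> \<beta>" by (simp add: \<beta>)
  have "PR ?M (\<lambda>E. \<exists>a\<in>V. \<exists>S\<subseteq>V. card S = k \<and>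
      2 * N \<le> card (nbs E V a - S) \<and> inj_on (nbs E (S - {a})) (nbs E V a - S)) \<le>
    PR ?M (\<lambda>E. \<exists>z\<in>?I. 2 * N \<le> card (nbs E V (fst z) - snd z) \<and>
      inj_on (nbs E (snd z - {fst z})) (nbs E V (fst z) - snd z))"
    by (rule PR_mono) auto
  also have "\<dots> \<le> (\<Sum>z\<in>?I. \<beta>)"
  proof (rule PR_union_bound[OF I])
    fix z assume z: "z \<in> ?I"
    obtain a S where aS: "z = (a, S)" "a \<in> V" "S \<subseteq> V" "card S = k" using z by auto
    define Q where "Q B E \<longleftrightarrow> 2 * N \<le> card (B - S) \<and> inj_on (nbs E (S - {a})) (B - S)" for B E
    have "PR ?M (\<lambda>E. Q (nbs E (V - {a}) a) E) \<le> \<beta>"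
    proof (rule PR_le_by_cases[where f = "\<lambda>E. nbs E (V - {a}) a" and Q = Q])
      show "finite (set_pmf ?M)" using V by simp
      fix B
      show "PR ?M (\<lambda>E. nbs E (V - {a}) a = B \<and> Q B E) \<le> \<beta> * PR ?M (\<lambda>E. nbs E (V - {a}) a = B)"
      proof (cases "B \<subseteq> V - {a} \<and> 2 * N \<le> card (B - S)")
        case True
        have "PR ?M (\<lambda>E. nbs E (V - {a}) a = B \<and> Q B E) =
            PR ?M (\<lambda>E. nbs E (V - {a}) a = B \<and> inj_on (nbs E (S - {a})) (B - S))"
          using True by (simp add: Q_def)
        also have "\<dots> = PR ?M (\<lambda>E. nbs E (V - {a}) a = B) * PR ?M (\<lambda>E. inj_on (nbs E (S - {a})) (B - S))"
        proof (rule PR_rset_indep[where B = "touching {a}" and C = "- touching {a}"])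
          show "(nbs E (V - {a}) a = B) = (nbs (E \<inter> touching {a}) (V - {a}) a = B)" for E
            by (simp add: nbs_def touching_def)
          fix E
          have "nbs (E \<inter> - touching {a}) (S - {a}) v = nbs E (S - {a}) v" if "v \<in> B - S" for v
            using that True by (auto simp: nbs_def touching_def)
          then show "inj_on (nbs E (S - {a})) (B - S) = inj_on (nbs (E \<inter> - touching {a}) (S - {a})) (B - S)"
            by (simp add: inj_on_def)
        qed (use V in auto)
        also have "\<dots> \<le> PR ?M (\<lambda>E. nbs E (V - {a}) a = B) * \<beta>"
        proof (rule mult_left_mono)
          have "finite S" by (rule finite_subset[OF aS(3) V])
          then have "card (S - {a}) \<le> k" using aS(4) by (metis card_Diff1_le)
          then show "PR ?M (\<lambda>E. inj_on (nbs E (S - {a})) (B - S)) \<le> \<beta>"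
            unfolding \<beta> by (intro PR_inj_nbs') (use True aS V p in auto)
        qed simp
        finally show ?thesis by (simp add: mult.commute)
      next
        case False
        then have "\<not> (nbs E (V - {a}) a = B \<and> Q B E)" for E by (auto simp: Q_def nbs_def)
        then have "PR ?M (\<lambda>E. nbs E (V - {a}) a = B \<and> Q B E) = PR ?M (\<lambda>_. False)"
          by (intro arg_cong[where f = "measure_pmf.prob _"]) auto
        then show ?thesis using \<beta>0 by simp
      qed
    qed (rule \<beta>0)
    moreover have "PR ?M (\<lambda>E. 2 * N \<le> card (nbs E V a - S) \<and> inj_on (nbs E (S - {a})) (nbs E V a - S))
        \<le> PR ?M (\<lambda>E. Q (nbs E (V - {a}) a) E)"
    proof (rule PR_rset_mono)
      fix E assume "E \<subseteq> all_pairs V"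
      then have "nbs E V a = nbs E (V - {a}) a" by (auto simp: nbs_def all_pairs_def)
      then show "2 * N \<le> card (nbs E V a - S) \<and> inj_on (nbs E (S - {a})) (nbs E V a - S) \<Longrightarrow>
          Q (nbs E (V - {a}) a) E" by (simp add: Q_def)
    qed
    ultimately show "PR ?M (\<lambda>E. 2 * N \<le> card (nbs E V (fst z) - snd z) \<and>
      inj_on (nbs E (snd z - {fst z})) (nbs E V (fst z) - snd z)) \<le> \<beta>" by (simp add: aS)
  qed
  also have "\<dots> = real (card ?I) * \<beta>" by simp
  also have "\<dots> \<le> real (card V * card V ^ k) * \<beta>"
    using card_subsets_le_power[OF V, of k] \<beta>0
    by (intro mult_right_mono) (auto simp: card_cartesian_product simp del: of_nat_mult of_nat_power)
  finally show ?thesis by simp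
qed

section \<open>From the random graph to the game\<close>

lemma gball_add: "gball V E (gball V E W a) b = gball V E W (a + b)"
  by (simp add: gball_def funpow_add add.commute[of a])

text \<open>A ball with at least \<open>m\<close> vertices around \<open>v\<close> must meet a ball
  around \<open>u\<close> that misses fewer than \<open>m\<close>.\<close>

lemma connected_graphI:
  assumes V: "finite V" "V \<noteq> {}"
    and far: "\<And>u. u \<in> V \<Longrightarrow> card (V - gball V E {u} j) < m"
    and large: "\<And>v. v \<in> V \<Longrightarrow> m \<le> card (gball V E {v} i)"
  shows "connected_graph V E"
  unfolding connected_graph_def
proof (intro conjI ballI)
  fix u v assume uv: "u \<in> V" "v \<in> V"
  have "\<exists>z. z \<in> gball V E {v} i \<inter> gball V E {u} j"
  proof (rule ccontr)
    assume "\<not> ?thesis"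
    then have "gball V E {v} i \<subseteq> V - gball V E {u} j" using gball_subset[of "{v}" V E i] uv by auto
    then have "card (gball V E {v} i) \<le> card (V - gball V E {u} j)" using V by (intro card_mono) auto
    then show False using far[OF uv(1)] large[OF uv(2)] by simp
  qed
  then obtain z where z: "z \<in> gball V E {v} i" "z \<in> gball V E {u} j" by blast
  then have "z \<in> V" using gball_subset[of "{v}" V E i] uv by auto
  then have "v \<in> gball V E {z} i" using z mem_gball_commute uv by metis
  moreover have "gball V E {z} i \<subseteq> gball V E (gball V E {u} j) i"
    using z by (subst (2) gball_eq_UN) auto
  ultimately have "v \<in> gball V E {u} (j + i)" by (auto simp: gball_add)
  from gball_walk[OF uv(1) this] show "\<exists>xs. walk_betw V E u xs v" by blast
qed (use V in auto)

lemma card_gball_le: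
  assumes V: "finite V" and S: "S \<subseteq> V" and g: "\<And>v. v \<in> V \<Longrightarrow> real (card (nbh V E {v})) \<le> g"
  shows "real (card (gball V E S j)) \<le> real (card S) * g ^ j"
proof (induction j)
  case (Suc j)
  have sub: "gball V E S j \<subseteq> V" by (rule gball_subset[OF S])
  have "real (card (gball V E S (Suc j))) \<le> real (card (gball V E S j)) * g"
    unfolding gball_Suc by (rule card_nbh_le) (use sub g V in \<open>auto intro: finite_subset\<close>)
  also have "\<dots> \<le> real (card S) * g ^ j * g"
  proof (cases "V = {}")
    case False
    then obtain v where "v \<in> V" by blast
    then have "0 \<le> g" using g[of v] by linarith
    then show ?thesis by (rule mult_right_mono[OF Suc.IH])
  qed (use S sub in auto)
  finally show ?case by (simp add: mult_ac)
qed simp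

text \<open>The ball around \<open>{w, x}\<close> is almost twice as large as those around \<open>w\<close> and \<open>x\<close>, which
  therefore are almost disjoint.\<close>

lemma separation_of_layer_inv:
  fixes d \<delta> :: real
  assumes V: "finite V" and inv: "\<And>x y. x \<in> V \<Longrightarrow> y \<in> V \<Longrightarrow>
      layer_inv (card {x, y}) d \<delta> i i (prev_ball V E {x, y} i) (gball V E {x, y} i)"
    and \<delta>: "0 < \<delta>" "\<delta> \<le> 1/10" and d: "2 / \<delta> \<le> d"
    and wx: "w \<in> V" "x \<in> V" "w \<noteq> x"
  shows "2 * (1 - 12 * \<delta>) * d ^ i \<le> card {s \<in> V. graph_dist V E s w \<noteq> graph_dist V E s x}"
proof -
  let ?B = "\<lambda>W. gball V E W i"
  have d0: "0 < d" using d \<delta> by (smt (verit) divide_pos_pos)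
  have sub: "?B W \<subseteq> V" if "W \<subseteq> V" for W by (rule gball_subset[OF that])
  have fin: "finite (?B W)" if "W \<subseteq> V" for W by (rule finite_subset[OF sub[OF that] V])
  have up: "card (?B {u}) \<le> (1 + 6 * \<delta>) * d ^ i" if u: "u \<in> V" for u
  proof -
    have "card (?B {u}) \<le> (1 + 2 / d) * (d ^ i * hi \<delta> i i)"
      using inv[OF u u] by (simp add: layer_inv_def)
    also have "\<dots> \<le> (1 + \<delta>) * (d ^ i * (1 + 4 * \<delta>))"
    proof (intro mult_mono)
      show "1 + 2 / d \<le> 1 + \<delta>" using d d0 \<delta> by (simp add: field_simps)
      show "hi \<delta> i i \<le> 1 + 4 * \<delta>" using hi_le[of \<delta> i i] exp_3_le[of \<delta>] \<delta> by simp
    qed (use d0 \<delta> hi_ge_1[of \<delta> i i] in auto)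
    also have "\<dots> = ((1 + \<delta>) * (1 + 4 * \<delta>)) * d ^ i" by simp
    also have "\<dots> \<le> (1 + 6 * \<delta>) * d ^ i"
    proof (rule mult_right_mono)
      have "4 * \<delta> * \<delta> \<le> 4 * \<delta> * (1/10)" using \<delta> by (intro mult_left_mono) auto
      then show "(1 + \<delta>) * (1 + 4 * \<delta>) \<le> 1 + 6 * \<delta>" using \<delta> by (simp add: algebra_simps)
    qed (use d0 in simp)
    finally show ?thesis .
  qed
  have low: "2 * (1 - 3 * \<delta>) * d ^ i \<le> card (?B {w, x})"
  proof -
    have "2 * d ^ i * (1 - 3 * \<delta>) \<le> 2 * d ^ i * lo \<delta> i i"
      using lo_ge[of \<delta> i i] \<delta> d0 by (intro mult_left_mono) auto
    also have "\<dots> \<le> card (?B {w, x} - prev_ball V E {w, x} i)"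
      using inv[OF wx(1,2)] wx(3) by (simp add: layer_inv_def)
    also have "\<dots> \<le> card (?B {w, x})" using fin[of "{w, x}"] wx by (intro of_nat_mono card_mono) auto
    finally show ?thesis by (simp add: algebra_simps)
  qed
  have un: "?B {w, x} = ?B {w} \<union> ?B {x}" using gball_Un[of V E "{w}" "{x}" i] by (simp add: insert_commute)
  let ?D = "(?B {w} - ?B {x}) \<union> (?B {x} - ?B {w})"
  have cw: "card (?B {w} \<union> ?B {x}) = card (?B {w} - ?B {x}) + card (?B {x})"
    using fin[of "{w}"] fin[of "{x}"] wx by (subst card_Un_disjoint[symmetric]) (auto intro: arg_cong[where f = card])
  have cx: "card (?B {w} \<union> ?B {x}) = card (?B {x} - ?B {w}) + card (?B {w})"
    using fin[of "{w}"] fin[of "{x}"] wx by (subst card_Un_disjoint[symmetric]) (auto intro: arg_cong[where f = card])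
  have cD: "card ?D = card (?B {w} - ?B {x}) + card (?B {x} - ?B {w})"
    using fin[of "{w}"] fin[of "{x}"] wx by (intro card_Un_disjoint) auto
  have "?D \<subseteq> {s \<in> V. graph_dist V E s w \<noteq> graph_dist V E s x}"
  proof
    fix s assume s: "s \<in> ?D"
    then have sV: "s \<in> V" using sub[of "{w}"] sub[of "{x}"] wx by auto
    have "graph_dist V E s w \<le> enat i \<longleftrightarrow> s \<in> ?B {w}" "graph_dist V E s x \<le> enat i \<longleftrightarrow> s \<in> ?B {x}"
      using graph_dist_le_iff[OF sV] mem_gball_commute[OF sV] wx by metis+
    then show "s \<in> {s \<in> V. graph_dist V E s w \<noteq> graph_dist V E s x}" using s sV by auto
  qed
  then have "card ?D \<le> card {s \<in> V. graph_dist V E s w \<noteq> graph_dist V E s x}"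
    using V by (intro card_mono) auto
  then have "real (card ?D) \<le> card {s \<in> V. graph_dist V E s w \<noteq> graph_dist V E s x}" by simp
  \<comment> \<open>Size of the symmetric difference; 2 * 2 (1 - 3 \<delta>) - 2 (1 + 6 \<delta>) =
    2 (1 - 12 \<delta>).\<close>
  moreover have "real (card ?D) = 2 * card (?B {w, x}) - card (?B {w}) - card (?B {x})"
    using cw cx cD un by simp
  ultimately show ?thesis using low up[OF wx(1)] up[OF wx(2)] by (simp add: algebra_simps)
qed

text \<open>The robber preserves candidate sets with at least \<open>m\<close> elements. From the
  unseen vertices are discarded those farther than i + 1 from some sensor, at most k l, and those
  not reachable from \<open>A\<close>, fewer than \<open>m\<close> by the edge condition. At least
  \<open>m\<close> remain, and all of them answer i + 1.\<close>

proposition not_cops_can_win_sparse: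
  assumes V: "finite V"
    and far: "\<And>s. s \<in> V \<Longrightarrow> card (V - gball V E {s} (Suc i)) \<le> l"
    and unseen: "\<And>S. S \<subseteq> V \<Longrightarrow> card S = k \<Longrightarrow> k * l + 2 * m \<le> card (V - gball V E S i)"
    and edges: "\<And>A B. A \<subseteq> V \<Longrightarrow> B \<subseteq> V \<Longrightarrow> A \<inter> B = {} \<Longrightarrow> card A = m \<Longrightarrow> card B = m \<Longrightarrow>
      \<exists>a\<in>A. \<exists>b\<in>B. {a, b} \<in> E"
    and m: "2 \<le> m" "m \<le> card V"
  shows "\<not> cops_can_win V E k"
proof (rule not_cops_can_win[where \<A> = "\<lambda>A. A \<subseteq> V \<and> m \<le> card A"])
  show "\<exists>x\<in>A. \<exists>y\<in>A. x \<noteq> y" if "A \<subseteq> V \<and> m \<le> card A" for A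
  proof (rule ccontr)
    assume "\<not> ?thesis"
    then have "card A \<le> Suc 0" using that V by (subst card_le_Suc0_iff_eq) (auto intro: finite_subset)
    then show False using that m by simp
  qed
  fix A S assume A: "A \<subseteq> V \<and> m \<le> card A" and S: "S \<subseteq> V" "card S = k"
  have fS: "finite S" by (rule finite_subset[OF S(1) V])
  define F where "F = (\<Union>s\<in>S. V - gball V E {s} (Suc i))"
  define U where "U = V - nbh V E A"
  define B where "B = V - gball V E S i - F - U"
  have cF: "card F \<le> k * l"
  proof -
    have "card F \<le> (\<Sum>s\<in>S. card (V - gball V E {s} (Suc i)))" unfolding F_def by (rule card_UN_le[OF fS])
    also have "\<dots> \<le> (\<Sum>s\<in>S. l)" by (rule sum_mono) (use far S in auto)
    finally show ?thesis using S by simp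
  qed
  have cU: "card U < m"
  proof (rule ccontr)
    assume "\<not> ?thesis"
    then obtain B0 where B0: "B0 \<subseteq> U" "card B0 = m" using obtain_subset_with_card_n[of m U] by auto
    obtain A0 where A0: "A0 \<subseteq> A" "card A0 = m" using obtain_subset_with_card_n[of m A] A by auto
    have "A0 \<inter> B0 = {}" using A0 B0 subset_nbh[of A V E] by (auto simp: U_def)
    moreover have "A0 \<subseteq> V" "B0 \<subseteq> V" using A0 B0 A by (auto simp: U_def)
    ultimately obtain a b where "a \<in> A0" "b \<in> B0" "{a, b} \<in> E" using edges[of A0 B0] A0 B0 by blast
    then show False using A0 B0 by (auto simp: U_def nbh_def)
  qed
  have fin: "finite F" "finite U" "finite B" using V fS by (auto simp: F_def U_def B_def)
  have "card (V - gball V E S i) \<le> card (B \<union> (F \<union> U))"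
    using V fin by (intro card_mono) (auto simp: B_def)
  also have "\<dots> \<le> card B + (card F + card U)"
    by (meson card_Un_le add_left_mono order_trans)
  finally have mB: "m \<le> card B" using unseen[OF S] cF cU by linarith
  have BA: "B \<subseteq> nbh V E A" "B \<subseteq> V" by (auto simp: B_def U_def)
  have "graph_dist V E s x = enat (Suc i)" if "x \<in> B" "s \<in> S" for x s
  proof (rule graph_dist_eq_Suc)
    show "s \<in> V" using that S by auto
    show "x \<in> gball V E {s} (Suc i)" using that by (auto simp: B_def F_def)
    have "gball V E {s} i \<subseteq> gball V E S i" using that by (subst (2) gball_eq_UN) auto
    then show "x \<notin> gball V E {s} i" using that by (auto simp: B_def)
  qed
  then have "\<forall>x\<in>B. \<forall>y\<in>B. dist_vector V E S x = dist_vector V E S y"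
    by (simp add: dist_vector_eq_iff)
  with mB BA show "\<exists>B. (B \<subseteq> V \<and> m \<le> card B) \<and> B \<subseteq> nbh V E A \<and>
      (\<forall>x\<in>B. \<forall>y\<in>B. dist_vector V E S x = dist_vector V E S y)"
    by blast
qed (use V m in auto)

text \<open>Two candidates suffice for the robber. In diameter 2 a vertex that is not a sensor
  answers 1 or 2 according to adjacency, so two neighbours of \<open>a\<close> outside
  \<open>S\<close> that agree on \<open>S - {a}\<close> give equal answers; if \<open>a\<close> is a
  sensor, both answer 1 to it.\<close>

proposition not_cops_can_win_dense:
  assumes V: "finite V" "2 \<le> card V"
    and diam: "\<And>s. s \<in> V \<Longrightarrow> V \<subseteq> gball V E {s} 2"
    and coll: "\<And>a S. a \<in> V \<Longrightarrow> S \<subseteq> V \<Longrightarrow> card S = k \<Longrightarrow> \<not> inj_on (nbs E (S - {a})) (nbs E V a - S)"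
  shows "\<not> cops_can_win V E k"
proof (rule not_cops_can_win[where \<A> = "\<lambda>A. A \<subseteq> V \<and> (\<exists>x\<in>A. \<exists>y\<in>A. x \<noteq> y)"])
  have "\<exists>x\<in>V. \<exists>y\<in>V. x \<noteq> y"
  proof (rule ccontr)
    assume "\<not> ?thesis"
    then have "card V \<le> Suc 0" using V by (subst card_le_Suc0_iff_eq) auto
    then show False using V by simp
  qed
  then show "V \<subseteq> V \<and> (\<exists>x\<in>V. \<exists>y\<in>V. x \<noteq> y)" by simp
  fix A S assume A: "A \<subseteq> V \<and> (\<exists>x\<in>A. \<exists>y\<in>A. x \<noteq> y)" and S: "S \<subseteq> V" "card S = k"
  then obtain a where a: "a \<in> A" "a \<in> V" by blast
  from coll[OF a(2) S] obtain w x where wx: "w \<in> nbs E V a - S" "x \<in> nbs E V a - S" "w \<noteq> x"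
    "nbs E (S - {a}) w = nbs E (S - {a}) x" by (auto simp: inj_on_def)
  have adjacent: "{s, w} \<in> E \<longleftrightarrow> {s, x} \<in> E" if "s \<in> S" for s
  proof (cases "s = a")
    case True
    then show ?thesis using wx by (auto simp: nbs_def insert_commute)
  next
    case False
    then have "s \<in> nbs E (S - {a}) w \<longleftrightarrow> s \<in> nbs E (S - {a}) x" using wx by simp
    then show ?thesis using that False by (simp add: nbs_def)
  qed
  have wV: "w \<in> V" "x \<in> V" using wx by (auto simp: nbs_def)
  have dist: "graph_dist V E s z = (if {s, z} \<in> E then enat 1 else enat 2)"
    if "s \<in> S" "z \<in> V - S" for s z
  proof -
    have s: "s \<in> V" using that S by auto
    have b1: "z \<in> gball V E {s} (Suc 0) \<longleftrightarrow> {s, z} \<in> E" using that by (auto simp: gball_Suc nbh_def)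
    have b2: "z \<in> gball V E {s} (Suc (Suc 0))" using diam[OF s] that by (auto simp: numeral_2_eq_2)
    show ?thesis
    proof (cases "{s, z} \<in> E")
      case True
      then have "graph_dist V E s z = enat (Suc 0)" by (intro graph_dist_eq_Suc) (use that s b1 in auto)
      then show ?thesis using True by simp
    next
      case False
      then have "graph_dist V E s z = enat (Suc (Suc 0))" by (intro graph_dist_eq_Suc) (use b1 b2 s in auto)
      then show ?thesis using False by (simp add: numeral_2_eq_2)
    qed
  qed
  have eq: "dist_vector V E S w = dist_vector V E S x"
    unfolding dist_vector_eq_iff using adjacent dist wx wV by simp
  show "\<exists>B. (B \<subseteq> V \<and> (\<exists>x\<in>B. \<exists>y\<in>B. x \<noteq> y)) \<and> B \<subseteq> nbh V E A \<and>
      (\<forall>x\<in>B. \<forall>y\<in>B. dist_vector V E S x = dist_vector V E S y)"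
  proof (intro exI[of _ "{w, x}"] conjI)
    show "{w, x} \<subseteq> nbh V E A" using wx a wV by (auto simp: nbh_def nbs_def insert_commute)
    show "\<exists>y\<in>{w, x}. \<exists>z\<in>{w, x}. y \<noteq> z" using wx by auto
    show "\<forall>y\<in>{w, x}. \<forall>z\<in>{w, x}. dist_vector V E S y = dist_vector V E S z" using eq by simp
  qed (use wV in auto)
qed (use V in auto)

section \<open>Failure probabilities\<close>

text \<open>What the asymptotic hypotheses provide for a single large n, so that all estimates below
  are explicit. The 1024 makes the breadth-first failure probability at most 2 i n^(-4) for each
  pair of centres; the 320 serves the union bound of the dense case.\<close>

locale large_params =
  fixes n i :: nat and p d l ll \<delta> :: real
  assumes p: "0 \<le> p" "p \<le> 1/10" and d: "d = p * n" and l: "l = ln n" and ll: "ll = ln l"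
    and \<delta>: "0 < \<delta>" "\<delta> \<le> 1/100" and ll_ge: "320 \<le> ll" and l_d: "1024 * l \<le> \<delta>\<^sup>2 * d"
    and i: "1 \<le> i" and di: "d ^ i \<le> \<delta> / 10 * n" and di1: "2 * n * l \<le> d ^ (i + 1)"
    and n_l: "16 * l ^ 4 \<le> n"
begin

lemma l_ge: "321 \<le> l"
proof -
  \<comment> \<open>\<open>ln 0 = 0\<close> in HOL, so l = 0 would give ll = 0.\<close>
  have "l > 0"
  proof (rule ccontr)
    assume "\<not> 0 < l"
    moreover have "0 \<le> l"
    proof (cases "n = 0")
      case True
      then have "l ^ 4 \<le> 0" using n_l by simp
      then show ?thesis by simp
    qed (simp add: l)
    ultimately have "l = 0" by simp
    then show False using ll_ge by (simp add: ll)
  qed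
  then have "l = exp ll" by (simp add: ll)
  then show ?thesis using exp_ge_add_one_self[of ll] ll_ge by linarith
qed

lemma exp_ll: "exp ll = l" using l_ge by (simp add: ll)

lemma n_ge: "16 * l \<le> n"
proof -
  have "l ^ 1 \<le> l ^ 4" using l_ge by (intro power_increasing) auto
  then show ?thesis using n_l by simp
qed

lemma n_pos: "0 < real n" using n_ge l_ge by linarith

lemma exp_l: "exp l = n" using n_pos by (simp add: l)

lemma exp_minus_l: "exp (- l) = 1 / n" by (simp add: exp_minus exp_l inverse_eq_divide)

lemma d_ge: "10240000 * l \<le> d"
proof -
  have "d > 0"
  proof (rule ccontr)
    assume "\<not> 0 < d"
    then have "\<delta>\<^sup>2 * d \<le> 0" by (intro mult_nonneg_nonpos) auto
    then show False using l_d l_ge by simp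
  qed
  moreover have "\<delta>\<^sup>2 \<le> (1/100)\<^sup>2" using \<delta> by (intro power_mono) auto
  ultimately have "\<delta>\<^sup>2 * d \<le> (1/100)\<^sup>2 * d" by (intro mult_right_mono) auto
  then show ?thesis using l_d by (simp add: power2_eq_square)
qed

lemma d_pos: "0 < d" using d_ge l_ge by linarith

lemma d_8: "8 \<le> d" using d_ge l_ge by linarith

lemma p_pos: "0 < p" using d_pos p by (cases "p = 0") (auto simp: d)

lemma d_le: "d \<le> n / 10" using mult_right_mono[OF p(2), of n] by (simp add: d)

lemma d_inv: "2 / \<delta> \<le> d"
proof -
  have "1024 * 1 \<le> 1024 * l" using l_ge by simp
  also have "\<dots> \<le> \<delta> * (\<delta> * d)" using l_d by (simp add: power2_eq_square mult_ac)
  also have "\<dots> \<le> 1 * (\<delta> * d)" using \<delta> d_pos by (intro mult_right_mono) auto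
  finally show ?thesis using \<delta> by (simp add: field_simps)
qed

lemma ln_d: "1 \<le> ln d" "ln d \<le> l" "i * ln d \<le> l"
proof -
  have "exp 1 \<le> (3 :: real)" by (rule exp_le)
  then have "ln (exp 1) \<le> ln d" using d_8 by (subst ln_le_cancel_iff) auto
  then show 1: "1 \<le> ln d" by simp
  have "d ^ i \<le> 1 * n" using di mult_right_mono[of "\<delta> / 10" 1 n] \<delta> by simp
  then have "ln (d ^ i) \<le> ln n" using d_pos n_pos by (subst ln_le_cancel_iff) auto
  then show 2: "i * ln d \<le> l" using d_pos by (simp add: ln_realpow l)
  have "1 * ln d \<le> i * ln d" using i 1 by (intro mult_right_mono) auto
  then show "ln d \<le> l" using 2 by simp
qed

lemma i_le: "i \<le> n"
proof -
  have "real i * 1 \<le> real i * ln d" using ln_d by (intro mult_left_mono) auto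
  then show ?thesis using ln_d n_ge l_ge by linarith
qed

lemma d_le_power: "d \<le> d ^ i"
  using power_increasing[OF i, of d] d_8 by simp

section \<open>Thresholds and exceptional events\<close>

definition "V = {1..n}"
definition "G = gr V p"
text \<open>Chosen such that the Chernoff exponent d \<epsilon>^2 / 4 of the degrees is 9 ln
  n.\<close>

definition "\<epsilon> = 6 * sqrt (l / d)"
definition "g = (1 + \<epsilon>) * d + 1"
text \<open>Below the layer size 97/100 d ^ i of typical graphs, and large enough that p t >= 3/2 ln
  n.\<close>

definition "t = nat \<lceil>3/4 * d ^ i\<rceil>"
definition "lower = (ln d - 3 * ll) * (n / d ^ i)"
text \<open>Then p m >= 4 ln n, so exp(- p m^2) beats the n^(2 m) pairs of
  \<open>m\<close>-sets.\<close>

definition "m = nat \<lceil>4 * n * l / d\<rceil>"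
definition "kmax = nat \<lfloor>lower\<rfloor>"
text \<open>Bounds the ball of radius i - 1 around fewer than \<open>lower\<close> sensors when
  closed neighbourhoods have at most \<open>g\<close> vertices.\<close>

definition "tmax = nat \<lfloor>lower * g ^ (i - 1)\<rfloor>"
text \<open>What is left of (ln n)^3 after (ln n)^2 for the union bound, (ln n)^(1/2) for 1 - p
  against exp(- p), and the constant exp(14) from \<open>p_tmax\<close>.\<close>

definition "w = exp (ll / 2 - 14)"
definition "unseen = n / (2 * d) * (l\<^sup>2 * w)"
text \<open>Below this threshold p^2 tmax <= p ln n stays under ln ln n / 2.\<close>

definition "is_sparse \<longleftrightarrow> l ^ 3 \<le> d \<and> p < ll / (2 * l)"
definition "is_dense \<longleftrightarrow> ll / (2 * l) \<le> p"
text \<open>After the removal of at most d / 4 sensors, every neighbourhood still contains two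
  halves of this size.\<close>

definition "N = nat \<lfloor>d / 4\<rfloor>"

lemma V: "finite V" "card V = n" "V \<noteq> {}"
  using n_pos by (auto simp: V_def)

lemma p1: "p \<le> 1" using p by simp

definition "bad1 E \<longleftrightarrow> (\<exists>x\<in>V. \<exists>y\<in>V.
  \<not> layer_inv (card {x, y}) d \<delta> i i (prev_ball V E {x, y} i) (gball V E {x, y} i))"
definition "bad2 E \<longleftrightarrow> (\<exists>v\<in>V. g < card (nbh V E {v}))"
definition "bad3 E \<longleftrightarrow> (\<exists>u\<in>V. t \<le> card (gball V E {u} i - prev_ball V E {u} i) \<and>
  4 \<le> card (V - gball V E {u} (Suc i)))"
definition "bad4 E \<longleftrightarrow> (\<exists>A\<subseteq>V. \<exists>B\<subseteq>V. A \<inter> B = {} \<and> card A = m \<and> card B = m \<and>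
  (\<forall>a\<in>A. \<forall>b\<in>B. {a, b} \<notin> E))"
definition "bad5 E \<longleftrightarrow> is_sparse \<and> (\<exists>T\<subseteq>V. card T = tmax \<and> card (V - nbh V E T) \<le> unseen / 2)"
definition "bad6 E \<longleftrightarrow> is_dense \<and> (\<exists>a\<in>V. \<exists>S\<subseteq>V. card S = kmax \<and>
  2 * N \<le> card (nbs E V a - S) \<and> inj_on (nbs E (S - {a})) (nbs E V a - S))"
definition "bad7 E \<longleftrightarrow> is_dense \<and> (\<exists>u\<in>V. t \<le> card (gball V E {u} i - prev_ball V E {u} i) \<and>
  1 \<le> card (V - gball V E {u} (Suc i)))"

lemma PR_bad1: "PR G bad1 \<le> 2 / n"
proof -
  have "PR G bad1 \<le> (card V)\<^sup>2 * (2 * real i * exp (- (\<delta>\<^sup>2 * d / 256)))"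
    unfolding G_def bad1_def
    by (rule PR_bfs_uniform) (use V p d d_8 \<delta> di in auto)
  also have "\<dots> \<le> (real n)\<^sup>2 * (2 * real n * exp (- (4 * l)))"
    unfolding V(2) of_nat_power using i_le l_d by (intro mult_left_mono mult_mono) auto
  also have "exp (- (4 * l)) = exp (- l) ^ 4" by (simp add: exp_of_nat_mult[symmetric])
  also have "(real n)\<^sup>2 * (2 * real n * exp (- l) ^ 4) = 2 / n"
    using n_pos by (simp add: exp_minus_l power_divide power2_eq_square power4_eq_xxxx)
  finally show ?thesis .
qed

lemma \<epsilon>: "0 < \<epsilon>" "\<epsilon> \<le> 1" "d * \<epsilon>\<^sup>2 = 36 * l"
proof -
  show "0 < \<epsilon>" using l_ge d_pos by (simp add: \<epsilon>_def)
  show eq: "d * \<epsilon>\<^sup>2 = 36 * l" using l_ge d_pos by (simp add: \<epsilon>_def power_mult_distrib)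
  have "d * \<epsilon>\<^sup>2 \<le> d * 1" using eq d_ge l_ge by simp
  then have "\<epsilon>\<^sup>2 \<le> 1\<^sup>2" using d_pos by simp
  then show "\<epsilon> \<le> 1" by (rule power2_le_imp_le) simp
qed

lemma PR_bad2: "PR G bad2 \<le> 1 / n"
proof -
  have "PR G bad2 \<le> card V * exp (- d * \<epsilon>\<^sup>2 / 4)"
    unfolding G_def bad2_def g_def by (rule PR_degree) (use V p d \<epsilon> in auto)
  also have "- d * \<epsilon>\<^sup>2 / 4 = - (9 * l)" using \<epsilon>(3) by simp
  also have "card V * exp (- (9 * l)) \<le> n * exp (- (2 * l))" unfolding V(2) using l_ge by (intro mult_left_mono) auto
  also have "exp (- (2 * l)) = exp (- l) ^ 2" by (simp add: exp_of_nat_mult[symmetric])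
  also have "n * exp (- l) ^ 2 = 1 / n" using n_pos by (simp add: exp_minus_l power2_eq_square)
  finally show ?thesis .
qed

lemma t_ge: "3/4 * d ^ i \<le> t" "t \<le> 3/4 * d ^ i + 1"
proof -
  have "0 \<le> 3/4 * d ^ i" using d_pos by simp
  then show "3/4 * d ^ i \<le> t" "t \<le> 3/4 * d ^ i + 1" unfolding t_def by linarith+
qed

lemma pt_ge: "3/4 * (d ^ (i + 1) / n) \<le> p * t"
proof -
  have "3/4 * (d ^ (i + 1) / n) = p * (3/4 * d ^ i)" using n_pos by (simp add: d)
  also have "\<dots> \<le> p * t" using t_ge(1) p by (intro mult_left_mono) auto
  finally show ?thesis .
qed

text \<open>Used with r = 4, c = 3/2 for \<open>bad3\<close> and with r = 1, c = 3 for
  \<open>bad7\<close>; both give the exponent - l.\<close>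

lemma PR_far_vertices_le:
  assumes c: "c * l \<le> p * t"
  shows "PR G (\<lambda>E. \<exists>u\<in>V. t \<le> card (gball V E {u} i - prev_ball V E {u} i) \<and>
    r \<le> card (V - gball V E {u} (Suc i))) \<le> exp ((1 + r * (1 - c)) * l)"
proof -
  have "PR G (\<lambda>E. \<exists>u\<in>V. t \<le> card (gball V E {u} i - prev_ball V E {u} i) \<and>
      r \<le> card (V - gball V E {u} (Suc i))) \<le> card V * (card V * (1 - p) ^ t) ^ r"
    unfolding G_def by (rule PR_far_vertices) (use V p in auto)
  also have "\<dots> \<le> n * exp ((1 - c) * l) ^ r"
  proof -
    have "(1 - p) ^ t \<le> exp (- (p * t))" by (rule one_minus_power_le_exp) (rule p1)
    also have "\<dots> \<le> exp (- (c * l))" using c by simp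
    finally have "n * (1 - p) ^ t \<le> exp l * exp (- (c * l))" unfolding exp_l by (rule mult_left_mono) simp
    also have "\<dots> = exp ((1 - c) * l)" by (simp add: mult_exp_exp left_diff_distrib)
    finally show ?thesis unfolding V(2) using p1 by (intro mult_left_mono power_mono) auto
  qed
  also have "\<dots> = exp ((1 + r * (1 - c)) * l)"
    by (simp add: exp_l[symmetric] exp_of_nat_mult[symmetric] mult_exp_exp distrib_right mult.assoc)
  finally show ?thesis .
qed

lemma PR_bad3: "PR G bad3 \<le> 1 / n"
proof -
  have "2 * l \<le> d ^ (i + 1) / n" using di1 n_pos by (simp add: field_simps)
  then have "3/2 * l \<le> p * t" using pt_ge by linarith
  from PR_far_vertices_le[OF this, of 4] show ?thesis by (simp add: bad3_def[abs_def] exp_minus_l)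
qed

lemma m_bounds: "4 * n * l / d \<le> m" "m \<le> 5 * (n * l / d)" "40 \<le> n * l / d"
proof -
  show 1: "4 * n * l / d \<le> m" by (simp add: m_def real_nat_ceiling_ge)
  have "40 * d \<le> 4 * n" using d_le by simp
  also have "\<dots> \<le> n * l" using l_ge n_pos by simp
  finally show 2: "40 \<le> n * l / d" using d_pos by (simp add: field_simps)
  have "m \<le> 4 * n * l / d + 1"
  proof -
    have "0 \<le> 4 * n * l / d" using d_pos l_ge by simp
    then show ?thesis unfolding m_def by linarith
  qed
  then have "m \<le> 4 * (n * l / d) + 1" by simp
  moreover have "y \<le> 5 * x" if "y \<le> 4 * x + 1" "40 \<le> x" for x y :: real using that by linarith
  ultimately show "m \<le> 5 * (n * l / d)" using 2 by blast
qed

lemma PR_bad4: "PR G bad4 \<le> 1 / n"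
proof -
  have pm: "4 * l \<le> p * m"
  proof -
    have "4 * l = p * (4 * n * l / d)" using n_pos p_pos by (simp add: d)
    also have "\<dots> \<le> p * m" using m_bounds(1) p by (intro mult_left_mono) auto
    finally show ?thesis .
  qed
  have m1: "1 \<le> real m" using m_bounds by linarith
  have "PR G bad4 \<le> real (card V) ^ (2 * m) * (1 - p) ^ (m * m)"
    unfolding G_def bad4_def by (rule PR_no_cross_edge) (use V p in auto)
  also have "\<dots> \<le> exp l ^ (2 * m) * exp (- (p * (m * m)))"
    unfolding V(2) exp_l using p1 one_minus_power_le_exp[of p "m * m"] by (intro mult_left_mono) auto
  also have "\<dots> = exp (m * (2 * l - p * m))"
    by (simp add: exp_of_nat_mult[symmetric] mult_exp_exp algebra_simps)
  also have "m * (2 * l - p * m) \<le> 1 * (2 * l - p * m)"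
    using m1 pm l_ge by (intro mult_right_mono_neg) auto
  also have "\<dots> \<le> - l" using pm l_ge by simp
  finally show ?thesis by (simp add: exp_minus_l)
qed

lemma w_ge: "147 \<le> w"
  using exp_ge_add_one_self[of "ll / 2 - 14"] ll_ge by (simp add: w_def)

lemma lower_le: "lower \<le> n * l / d"
proof (cases "0 \<le> ln d - 3 * ll")
  case True
  have "lower \<le> l * (n / d)" unfolding lower_def
    using True ln_d ll_ge d_le_power d_pos n_pos by (intro mult_mono divide_left_mono) auto
  then show ?thesis by (simp add: mult.commute)
next
  case False
  then have "lower \<le> 0" unfolding lower_def using d_pos by (intro mult_nonpos_nonneg) auto
  then show ?thesis using m_bounds(3) by linarith
qed

text \<open>This is the only place where \<open>d \<ge> (log n)\<^sup>3\<close> is needed: it keeps the accumulated relative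
  error \<open>i sqrt (log n / d)\<close> of the ball sizes below a constant multiple of \<open>1 / log d\<close>.\<close>

lemma p_tmax:
  assumes sp: "l ^ 3 \<le> d"
  shows "p * tmax \<le> ln d - 3 * ll + 14"
proof -
  define x where "x = ln d - 3 * ll"
  define s where "s = sqrt (l / d)"
  have x: "0 \<le> x" "x \<le> ln d"
  proof -
    have "ln (l ^ 3) \<le> ln d" using sp l_ge d_pos by (subst ln_le_cancel_iff) auto
    then show "0 \<le> x" using l_ge by (simp add: ln_realpow x_def ll)
    show "x \<le> ln d" using ll_ge by (simp add: x_def)
  qed
  have s0: "0 \<le> s" using l_ge d_pos by (simp add: s_def)
  have s1: "s * l \<le> 1"
  proof -
    have "(s * l)\<^sup>2 = l ^ 3 / d" using l_ge d_pos
      by (simp add: s_def power_mult_distrib) (simp add: power2_eq_square power3_eq_cube)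
    also have "\<dots> \<le> 1\<^sup>2" using sp d_pos by simp
    finally show ?thesis by (rule power2_le_imp_le) simp
  qed
  \<comment> \<open>7 = 6 + 1: the 6 of \<open>\<epsilon>\<close>, and the summand 1 in
    \<open>g\<close>, which is at most s d.\<close>
  have gd: "g \<le> (1 + 7 * s) * d"
  proof -
    have "1\<^sup>2 \<le> l * d" using mult_mono[of 1 l 1 d] l_ge d_8 by simp
    also have "l * d = (s * d)\<^sup>2" using l_ge d_pos
      by (simp add: s_def power_mult_distrib) (simp add: power2_eq_square)
    finally have "1 \<le> s * d" by (rule power2_le_imp_le) (use s0 d_pos in simp)
    then show ?thesis by (simp add: g_def \<epsilon>_def s_def algebra_simps)
  qed
  have g0: "0 \<le> g" using \<epsilon> d_pos by (simp add: g_def)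
  \<comment> \<open>Relative error accumulated over \<open>i\<close> factors. As i ln d <= ln n and
    s ln n <= 1, it satisfies y ln d <= 7; the 14 is 2 * 7.\<close>
  define y where "y = 7 * s * i"
  have y0: "0 \<le> y" using s0 by (simp add: y_def)
  have yd: "y * ln d \<le> 7"
  proof -
    have "y * ln d = 7 * (s * (i * ln d))" by (simp add: y_def)
    also have "\<dots> \<le> 7 * (s * l)" using ln_d s0 by (intro mult_left_mono) auto
    finally show ?thesis using s1 by simp
  qed
  have ld: "320 \<le> ln d" using x ll_ge by (simp add: x_def)
  have y1: "y \<le> 1"
  proof -
    have "y * 320 \<le> y * ln d" using ld y0 by (intro mult_left_mono) auto
    then show ?thesis using yd by linarith
  qed
  have "lower * g ^ (i - 1) \<ge> 0"
    using x g0 d_pos by (simp add: lower_def x_def)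
  then have "p * tmax \<le> p * (lower * g ^ (i - 1))"
    unfolding tmax_def using p by (intro mult_left_mono) auto
  also have "\<dots> \<le> p * (lower * ((1 + 7 * s) * d) ^ (i - 1))"
    using gd g0 p x d_pos by (intro mult_left_mono power_mono) (auto simp: lower_def x_def)
  also have "\<dots> = x * (1 + 7 * s) ^ (i - 1) * (p * n * d ^ (i - 1) / d ^ i)"
    by (simp add: lower_def x_def power_mult_distrib)
  also have "p * n * d ^ (i - 1) / d ^ i = 1"
  proof -
    have "d * d ^ (i - 1) = d ^ i" using i power_minus_mult[of i d] by (simp add: mult.commute)
    then show ?thesis using d_pos by (simp only: d[symmetric]) simp
  qed
  also have "x * (1 + 7 * s) ^ (i - 1) * 1 \<le> x * exp y"
  proof -
    have "(1 + 7 * s) ^ (i - 1) \<le> (1 + 7 * s) ^ i" using s0 by (intro power_increasing) auto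
    also have "\<dots> \<le> exp (7 * s) ^ i" using s0 exp_ge_add_one_self[of "7 * s"] by (intro power_mono) auto
    also have "\<dots> = exp y" by (simp add: y_def exp_of_nat_mult[symmetric] mult.commute)
    finally show ?thesis using x by (simp add: mult_left_mono)
  qed
  also have "\<dots> \<le> x * (1 + 2 * y)"
  proof (rule mult_left_mono[OF _ x(1)])
    have "y\<^sup>2 \<le> y" using mult_left_mono[OF y1 y0] by (simp add: power2_eq_square)
    then show "exp y \<le> 1 + 2 * y" using exp_le_quadratic[OF y1] by linarith
  qed
  also have "\<dots> \<le> x + 14"
  proof -
    have "x * y \<le> ln d * y" using x y0 by (intro mult_right_mono) auto
    then show ?thesis using yd by (simp add: algebra_simps)
  qed
  finally show ?thesis by (simp add: x_def)
qed

lemma tmax_le: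
  assumes "l ^ 3 \<le> d"
  shows "p * tmax \<le> l" "tmax \<le> n * l / d" "tmax \<le> n / 2"
proof -
  show 1: "p * tmax \<le> l" using p_tmax[OF assms] ln_d ll_ge by linarith
  then have "d * tmax \<le> n * l" using n_pos by (simp add: d mult_ac)
  then show 2: "tmax \<le> n * l / d" using d_pos by (simp add: field_simps)
  have "2 * (n * l) \<le> n * d" using d_ge l_ge n_pos by (simp add: mult_ac)
  then have "n * l / d \<le> n / 2" using d_pos by (simp add: field_simps)
  then show "tmax \<le> n / 2" using 2 by linarith
qed

text \<open>(1 - p) ^ tmax is compared with exp(- (p + p^2) tmax): the first term is bounded by
  \<open>p_tmax\<close>, the second is at most ll / 2 by sparsity. At least half of the vertices lie
  outside a set of \<open>tmax\<close> vertices, hence the factor n / 2.\<close>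

lemma unseen_le:
  assumes is_sparse
  shows "unseen \<le> real (card V - tmax) * (1 - p) ^ tmax"
proof -
  have sp: "l ^ 3 \<le> d" "p < ll / (2 * l)" using assms by (auto simp: is_sparse_def)
  have "n / 2 \<le> real (card V - tmax)"
    using tmax_le(3)[OF sp(1)] by (simp add: V of_nat_diff)
  have "l\<^sup>2 * w / d \<le> (1 - p) ^ tmax"
  proof -
    have "p\<^sup>2 * tmax \<le> p * l" using mult_left_mono[OF tmax_le(1)[OF sp(1)] p(1)] by (simp add: power2_eq_square mult_ac)
    also have "\<dots> \<le> ll / 2" using sp(2) l_ge by (simp add: field_simps)
    finally have a: "(p + p\<^sup>2) * tmax \<le> ln d - 3 * ll + 14 + ll / 2"
      using p_tmax[OF sp(1)] by (simp add: algebra_simps)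
    have "l\<^sup>2 * w / d = exp (2 * ll) * exp (ll / 2 - 14) / exp (ln d)"
      using d_pos by (simp add: w_def exp_ll exp_double)
    also have "\<dots> = exp (- (ln d - 3 * ll + 14 + ll / 2))"
      by (simp add: mult_exp_exp exp_diff[symmetric])
    also have "\<dots> \<le> exp (- ((p + p\<^sup>2) * tmax))" using a by simp
    also have "\<dots> = exp (- p - p\<^sup>2) ^ tmax" by (simp add: exp_of_nat_mult[symmetric] algebra_simps)
    also have "\<dots> \<le> (1 - p) ^ tmax"
    proof (rule power_mono)
      have "exp (- (p + p\<^sup>2)) \<le> 1 - (p + p\<^sup>2) + (p + p\<^sup>2)\<^sup>2 / 2"
        by (rule exp_minus_le_quadratic) (use p in simp)
      also have "(p + p\<^sup>2)\<^sup>2 \<le> 2 * p\<^sup>2"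
      proof -
        have "(1 + p)\<^sup>2 \<le> (1 + 1/10)\<^sup>2" using p by (intro power_mono) auto
        then have "p\<^sup>2 * (1 + p)\<^sup>2 \<le> p\<^sup>2 * 2" by (intro mult_left_mono) (auto simp: power2_eq_square)
        then show ?thesis by (simp add: power2_eq_square algebra_simps)
      qed
      finally show "exp (- p - p\<^sup>2) \<le> 1 - p" by simp
    qed simp
    finally show ?thesis .
  qed
  then have "n / 2 * (l\<^sup>2 * w / d) \<le> real (card V - tmax) * (1 - p) ^ tmax"
    using \<open>n / 2 \<le> real (card V - tmax)\<close> w_ge d_pos by (intro mult_mono) auto
  then show ?thesis by (simp add: unseen_def)
qed

text \<open>With y = n l^2 / d the choice of the set costs at most exp y, while the Chernoff
  exponent is y w / 32, at least 2 y.\<close>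

lemma PR_bad5: "PR G bad5 \<le> 1 / n"
proof (cases is_sparse)
  case True
  then have sp: "l ^ 3 \<le> d" by (simp add: is_sparse_def)
  have "PR G bad5 \<le> real (card V) ^ tmax * exp (- unseen / 16)"
    unfolding G_def bad5_def simp_thms if_True using PR_few_nonneighbours[OF V(1) p(1) p1 unseen_le[OF True]] True
    by simp
  also have "\<dots> = exp (tmax * l - unseen / 16)"
    by (simp add: V exp_l[symmetric] exp_of_nat_mult[symmetric] mult_exp_exp)
  also have "\<dots> \<le> exp (- l)"
  proof -
    have "tmax * l \<le> n * l / d * l" using tmax_le(2)[OF sp] l_ge by (intro mult_right_mono) auto
    moreover have "2 * (n * l / d * l) \<le> unseen / 16"
    proof -
      define y where "y = n * l\<^sup>2 / d"
      have "y * 64 \<le> y * w" unfolding y_def using w_ge d_pos by (intro mult_left_mono) auto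
      moreover have "n * l / d * l = y" "unseen = y * w / 2" by (simp_all add: y_def unseen_def power2_eq_square)
      ultimately show ?thesis by simp
    qed
    moreover have "1 * l \<le> n * l / d * l" using m_bounds(3) l_ge by (intro mult_right_mono) auto
    moreover have "exp (a - u) \<le> exp (- b)" if "a \<le> y" "2 * y \<le> u" "1 * b \<le> y" for a b u y :: real
      using that by simp
    ultimately show ?thesis by blast
  qed
  finally show ?thesis by (simp add: exp_minus_l)
next
  case False
  then show ?thesis by (simp add: bad5_def[abs_def])
qed

text \<open>Here 1 / p is at most of logarithmic order, so d^2 = n^2 p^2 exceeds n by a factor of at
  least 4 ln n, and d ^ i <= n forces i = 1.\<close>

lemma dense_facts:
  assumes is_dense
  shows "i = 1" "d\<^sup>2 \<ge> 4 * n * l" "160 \<le> l * p"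
proof -
  have pl: "160 \<le> l * p"
  proof -
    have "ll / 2 \<le> l * p" using assms l_ge by (simp add: is_dense_def field_simps)
    then show ?thesis using ll_ge by linarith
  qed
  then show "160 \<le> l * p" .
  have "1\<^sup>2 \<le> (l * p)\<^sup>2" using pl by (intro power_mono) auto
  then have "16 * l\<^sup>2 * 1 * l\<^sup>2 \<le> 16 * l\<^sup>2 * (l * p)\<^sup>2 * l\<^sup>2" by (intro mult_right_mono mult_left_mono) auto
  have nl: "4 * l \<le> n * p\<^sup>2"
  proof -
    have "4 * l * l\<^sup>2 \<le> 16 * l ^ 4" using l_ge by (simp add: power2_eq_square power4_eq_xxxx)
    also have "\<dots> \<le> real n * 1" using n_l by simp
    also have "\<dots> \<le> real n * (l * p)\<^sup>2" using \<open>1\<^sup>2 \<le> (l * p)\<^sup>2\<close> by (intro mult_left_mono) auto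
    finally have "4 * l * l\<^sup>2 \<le> n * p\<^sup>2 * l\<^sup>2" by (simp add: power_mult_distrib mult_ac)
    then show ?thesis using l_ge by simp
  qed
  then have "n * (4 * l) \<le> n * (n * p\<^sup>2)" by (intro mult_left_mono) auto
  then show d2: "d\<^sup>2 \<ge> 4 * n * l" by (simp add: d power_mult_distrib power2_eq_square mult_ac)
  show "i = 1"
  proof (rule ccontr)
    assume "i \<noteq> 1"
    then have "d ^ 2 \<le> d ^ i" using i d_8 by (intro power_increasing) auto
    also have "\<dots> \<le> 1 * n" using di mult_right_mono[of "\<delta> / 10" 1 n] \<delta> by simp
    finally have "4 * n * l \<le> n" using d2 by simp
    then show False using n_pos l_ge by simp
  qed
qed

lemma N_ge: "d / 5 \<le> N" "N \<le> d / 4"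
proof -
  have "d / 4 - 1 \<le> N" "N \<le> d / 4" using d_pos unfolding N_def by linarith+
  then show "d / 5 \<le> N" "N \<le> d / 4" using d_ge l_ge by linarith+
qed

lemma kmax_le: "kmax \<le> n * l / d"
proof -
  have "0 \<le> n * l / d" using m_bounds by linarith
  then show ?thesis using lower_le by (simp add: kmax_def) linarith
qed

text \<open>As exp(- p kmax) >= l^3 / d and N >= d / 5, the birthday argument fails with probability
  at most 2 exp(- l^3 / 40). The union bound costs exp((kmax + 1) l), which kmax <= l / p <= 2 l^2 /
  ll keeps below exp(l^3 / 80); this uses the dense threshold and 4 / 320 = 1 / 80.\<close>

lemma PR_bad6: "PR G bad6 \<le> 2 / n"
proof (cases is_dense)
  case True
  note D = dense_facts[OF True]
  define \<beta> where "\<beta> = exp (- (N * exp (- (p * kmax)) / 8)) + exp (- ((N * exp (- (p * kmax)))\<^sup>2 / 4))"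
  define z where "z = l ^ 3 / 5"
  have z1: "1 \<le> z" using power_mono[of 2 l 3] l_ge by (simp add: z_def)
  have "p * kmax \<le> ln d - 3 * ll \<or> kmax = 0"
  proof (cases "lower \<le> 0")
    case False
    then have "p * kmax \<le> p * lower" using p by (intro mult_left_mono) (auto simp: kmax_def)
    also have "\<dots> = (ln d - 3 * ll) * (p * n / d ^ i)" by (simp add: lower_def)
    also have "p * n / d ^ i = 1" unfolding D(1) using d_pos by (simp add: d[symmetric])
    finally have "p * kmax \<le> ln d - 3 * ll" by simp
    then show ?thesis ..
  qed (simp add: kmax_def)
  then have "l ^ 3 / d \<le> exp (- (p * kmax))"
  proof
    assume "p * kmax \<le> ln d - 3 * ll"
    then have "exp (3 * ll - ln d) \<le> exp (- (p * kmax))" by simp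
    moreover have "exp (3 * ll - ln d) = l ^ 3 / d"
      using d_pos exp_of_nat_mult[of 3 ll] by (simp add: exp_diff exp_ll)
    ultimately show ?thesis by simp
  next
    assume "kmax = 0"
    have "l ^ 3 \<le> d"
    proof -
      have "l ^ 3 * 16 \<le> 16 * l ^ 4 / l" using l_ge by (simp add: power4_eq_xxxx power3_eq_cube)
      also have "\<dots> \<le> n / l" using n_l l_ge by (intro divide_right_mono) auto
      also have "\<dots> \<le> n * p" using D(3) l_ge n_pos by (simp add: field_simps)
      finally have "l ^ 3 * 16 \<le> d" by (simp add: d mult.commute)
      moreover have "0 \<le> l ^ 3" using l_ge by simp
      ultimately show ?thesis by linarith
    qed
    then show ?thesis using \<open>kmax = 0\<close> d_pos by simp
  qed
  then have "d / 5 * (l ^ 3 / d) \<le> N * exp (- (p * kmax))"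
    using N_ge d_pos l_ge by (intro mult_mono) auto
  then have zN: "z \<le> N * exp (- (p * kmax))" using d_pos by (simp add: z_def)
  have "\<beta> \<le> exp (- (z / 8)) + exp (- (z / 8))"
    unfolding \<beta>_def
  proof (rule add_mono)
    show "exp (- (N * exp (- (p * kmax)) / 8)) \<le> exp (- (z / 8))" using zN by simp
    have "z / 8 \<le> z * z / 4" using mult_mono[OF z1 order_refl, of z] z1 by simp
    also have "z * z \<le> (N * exp (- (p * kmax)))\<^sup>2"
      unfolding power2_eq_square using zN z1 by (intro mult_mono) auto
    finally show "exp (- ((N * exp (- (p * kmax)))\<^sup>2 / 4)) \<le> exp (- (z / 8))" by simp
  qed
  then have \<beta>: "\<beta> \<le> 2 * exp (- (l ^ 3 / 40))" by (simp add: z_def)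
  have "PR G bad6 \<le> real (card V) ^ (kmax + 1) * \<beta>"
    unfolding G_def bad6_def using True
    by (simp only: simp_thms, intro PR_no_collision) (use V p \<beta>_def in auto)
  also have "\<dots> \<le> exp l ^ (kmax + 1) * (2 * exp (- (l ^ 3 / 40)))"
    unfolding V exp_l using \<beta> by (intro mult_left_mono) auto
  also have "\<dots> = 2 * exp ((kmax + 1) * l - l ^ 3 / 40)"
  proof -
    have "exp l ^ (kmax + 1) = exp ((kmax + 1) * l)" by (simp only: exp_of_nat_mult)
    then show ?thesis by (simp add: exp_diff exp_minus inverse_eq_divide)
  qed
  also have "(kmax + 1) * l - l ^ 3 / 40 \<le> - l"
  proof -
    have "kmax + 1 \<le> 2 * (l / p)"
    proof -
      have "n * l / d = l / p" using n_pos p_pos by (simp add: d)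
      then have "kmax \<le> l / p" using kmax_le by simp
      moreover have "1 \<le> l / p" using p_pos p l_ge by (simp add: field_simps)
      ultimately show ?thesis by simp
    qed
    also have "\<dots> \<le> 2 * (l * (2 * l / ll))"
    proof -
      have "1 / p \<le> 2 * l / ll" using True p_pos l_ge ll_ge by (simp add: is_dense_def field_simps)
      then have "l * (1 / p) \<le> l * (2 * l / ll)" using l_ge by (intro mult_left_mono) auto
      then show ?thesis by simp
    qed
    also have "\<dots> \<le> l * l / 80"
    proof -
      have "2 * (l * (2 * l / ll)) = 4 * (l * l) / ll" by simp
      also have "\<dots> \<le> 4 * (l * l) / 320" using ll_ge by (intro divide_left_mono) auto
      finally show ?thesis by simp
    qed
    finally have k: "kmax + 1 \<le> l * l / 80" .
    have l2: "80 * 80 \<le> l * l" using l_ge by (intro mult_mono) auto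
    have "y - x / 40 \<le> - 1" if "y \<le> x / 80" "80 * 80 \<le> x" for x y :: real using that by simp
    from this[OF k l2] have "(kmax + 1 - l * l / 40) * l \<le> - 1 * l" using l_ge by (intro mult_right_mono) auto
    moreover have "(kmax + 1) * l - l ^ 3 / 40 = (kmax + 1 - l * l / 40) * l"
      by (simp only: left_diff_distrib power3_eq_cube) simp
    ultimately show ?thesis by (simp only: mult_minus_left mult_1)
  qed
  finally show ?thesis by (simp add: exp_minus_l)
next
  case False
  then show ?thesis by (simp add: bad6_def[abs_def])
qed

lemma PR_bad7: "PR G bad7 \<le> 1 / n"
proof (cases is_dense)
  case True
  note D = dense_facts[OF True]
  have "4 * l \<le> d ^ (i + 1) / n" using D n_pos by (simp add: field_simps power2_eq_square)
  then have "3 * l \<le> p * t" using pt_ge by linarith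
  from PR_far_vertices_le[OF this, of 1] show ?thesis
    using True by (simp add: bad7_def[abs_def] exp_minus_l)
next
  case False
  then show ?thesis by (simp add: bad7_def[abs_def])
qed

definition "good E \<longleftrightarrow> \<not> (bad1 E \<or> bad2 E \<or> bad3 E \<or> bad4 E \<or> bad5 E \<or> bad6 E \<or> bad7 E)"

lemma PR_not_good: "PR G (\<lambda>E. \<not> good E) \<le> 9 / n"
proof -
  have "PR G (\<lambda>E. \<not> good E) \<le> PR G bad1 + (PR G bad2 + (PR G bad3 + (PR G bad4 + (PR G bad5 + (PR G bad6 + PR G bad7)))))"
    unfolding good_def not_not
    by (intro PR_disj_le[THEN order_trans] add_left_mono order_refl)
  also have "\<dots> \<le> 2 / n + (1 / n + (1 / n + (1 / n + (1 / n + (2 / n + 1 / n)))))"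
    by (intro add_mono PR_bad1 PR_bad2 PR_bad3 PR_bad4 PR_bad5 PR_bad6 PR_bad7)
  finally show ?thesis by simp
qed

end

section \<open>Graphs that avoid all exceptional events\<close>

context large_params
begin

lemma kmax_le_half: "kmax \<le> n / 2"
proof -
  have "2 * (n * l) \<le> n * d" using d_ge l_ge n_pos by (simp add: mult_ac)
  then have "n * l / d \<le> n / 2" using d_pos by (simp add: field_simps)
  then show ?thesis using kmax_le by linarith
qed

context
  fixes E :: "nat set set"
  assumes good: "good E"
begin

lemma layer_ge:
  assumes "u \<in> V"
  shows "97/100 * d ^ i \<le> card (gball V E {u} i - prev_ball V E {u} i)"
    and "t \<le> card (gball V E {u} i - prev_ball V E {u} i)"
proof -
  have "layer_inv (card {u, u}) d \<delta> i i (prev_ball V E {u, u} i) (gball V E {u, u} i)"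
    using good assms unfolding good_def bad1_def by blast
  then have "d ^ i * lo \<delta> i i \<le> card (gball V E {u} i - prev_ball V E {u} i)"
    by (simp add: layer_inv_def)
  moreover have "97/100 \<le> lo \<delta> i i" using lo_ge[of \<delta> i i] \<delta> by simp
  then have "d ^ i * (97/100) \<le> d ^ i * lo \<delta> i i" using d_pos by (intro mult_left_mono) auto
  ultimately show 1: "97/100 * d ^ i \<le> card (gball V E {u} i - prev_ball V E {u} i)" by linarith
  have "8 \<le> d ^ i" using d_le_power d_8 by linarith
  then have "real t \<le> 97/100 * d ^ i" using t_ge(2) by linarith
  then show "t \<le> card (gball V E {u} i - prev_ball V E {u} i)" using 1 by linarith
qed

lemma far_le: "u \<in> V \<Longrightarrow> card (V - gball V E {u} (Suc i)) \<le> 3"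
  using good layer_ge(2)[of u] unfolding good_def bad3_def by fastforce

lemma good_connected: "connected_graph V E"
proof (rule connected_graphI[OF V(1,3)])
  show "card (V - gball V E {u} (Suc i)) < 4" if "u \<in> V" for u using far_le[OF that] by simp
  show "4 \<le> card (gball V E {v} i)" if v: "v \<in> V" for v
  proof -
    have "finite (gball V E {v} i)" by (rule finite_subset[OF gball_subset V(1)]) (use v in simp)
    then have "card (gball V E {v} i - prev_ball V E {v} i) \<le> card (gball V E {v} i)"
      by (intro card_mono) auto
    moreover have "4 \<le> 97/100 * d ^ i" using d_le_power d_8 by linarith
    ultimately show ?thesis using layer_ge(1)[OF v] by linarith
  qed
qed

lemma nbh_le: "v \<in> V \<Longrightarrow> real (card (nbh V E {v})) \<le> g"
  using good unfolding good_def bad2_def by (auto simp: not_less)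

lemma g_bounds: "0 \<le> g" "g \<le> 3 * d"
proof -
  have "g = d + \<epsilon> * d + 1" by (simp add: g_def algebra_simps)
  then show "g \<le> 3 * d" using d_8 mult_right_mono[OF \<epsilon>(2), of d] by linarith
  show "0 \<le> g" using \<epsilon> d_pos by (simp add: g_def)
qed

lemma not_win_sparse:
  assumes is_sparse and k: "real k < lower"
  shows "\<not> cops_can_win V E k"
proof (rule not_cops_can_win_sparse[OF V(1), where l = 3 and m = m])
  have sp: "l ^ 3 \<le> d" using assms(1) by (simp add: is_sparse_def)
  show "card (V - gball V E {s} (Suc i)) \<le> 3" if "s \<in> V" for s by (rule far_le[OF that])
  show "\<exists>a\<in>A. \<exists>b\<in>B. {a, b} \<in> E"
    if "A \<subseteq> V" "B \<subseteq> V" "A \<inter> B = {}" "card A = m" "card B = m" for A B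
    using good that unfolding good_def bad4_def by blast
  have "m \<le> 5 * (n * l / d)" "4 * n * l / d \<le> m" "40 \<le> n * l / d" by (rule m_bounds)+
  then show "2 \<le> m" by simp
  have "5 * (n * l / d) \<le> n"
  proof -
    have "5 * (n * l) \<le> n * d" using d_ge l_ge n_pos by (simp add: mult_ac)
    then show ?thesis using d_pos by (simp add: field_simps)
  qed
  then show "m \<le> card V" using \<open>m \<le> 5 * (n * l / d)\<close> by (simp add: V)
  fix S assume S: "S \<subseteq> V" "card S = k"
  \<comment> \<open>The last step is split off: the ball of radius \<open>i\<close> is the
    neighbourhood of \<open>B\<close>, and \<open>B\<close> is padded to a set \<open>T\<close> of
    the size that \<open>bad5\<close> covers.\<close>
  define B where "B = gball V E S (i - 1)"
  have B: "B \<subseteq> V" unfolding B_def by (rule gball_subset[OF S(1)])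
  have "real (card B) \<le> real (card S) * g ^ (i - 1)"
    unfolding B_def by (rule card_gball_le[OF V(1) S(1) nbh_le])
  also have "\<dots> \<le> lower * g ^ (i - 1)" using k S g_bounds by (intro mult_right_mono) auto
  finally have "card B \<le> tmax" unfolding tmax_def by (simp add: le_nat_floor)
  moreover have "tmax \<le> card V" using tmax_le(3)[OF sp] by (simp add: V)
  ultimately obtain T where T: "B \<subseteq> T" "T \<subseteq> V" "card T = tmax"
    using exists_subset_between[of B tmax V] B V by blast
  have "unseen / 2 < card (V - nbh V E T)"
    using good T assms(1) unfolding good_def bad5_def by (meson not_le)
  also have "\<dots> \<le> card (V - gball V E S i)"
  proof (intro of_nat_mono card_mono)
    have "gball V E S i = nbh V E B" using gball_Suc[of V E S "i - 1"] i by (simp add: B_def)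
    then show "V - nbh V E T \<subseteq> V - gball V E S i" using nbh_mono[OF T(1)] by auto
  qed (use V in auto)
  finally have u: "unseen / 2 < card (V - gball V E S i)" .
  \<comment> \<open>13 = 3 + 2 * 5: at most 3 far vertices for each of at most n l / d sensors, and
    m <= 5 n l / d.\<close>
  have "13 * (n * l / d) \<le> unseen / 2"
  proof -
    have "52 * 1 \<le> w * l" using w_ge l_ge by (intro mult_mono) auto
    moreover define y where "y = n * l / d"
    ultimately have "y * 52 \<le> y * (w * l)" using m_bounds by (intro mult_left_mono) auto
    moreover have "unseen = y * (w * l) / 2" by (simp add: unseen_def power2_eq_square y_def mult_ac)
    ultimately show ?thesis unfolding y_def[symmetric] by simp
  qed
  moreover have "real k \<le> n * l / d" using k lower_le by linarith
  moreover have "a * 3 + 2 * b \<le> c"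
    if "13 * x \<le> y / 2" "a \<le> x" "y / 2 < c" "b \<le> 5 * x" for a b c x y :: real
    using that by linarith
  ultimately have "real (k * 3 + 2 * m) \<le> card (V - gball V E S i)"
    using u \<open>m \<le> 5 * (n * l / d)\<close> by (simp only: of_nat_add of_nat_mult of_nat_numeral)
  then show "k * 3 + 2 * m \<le> card (V - gball V E S i)" by simp
qed

lemma not_win_dense:
  assumes is_dense and k: "real k < lower"
  shows "\<not> cops_can_win V E k"
proof (rule not_cops_can_win_dense[OF V(1)])
  note D = dense_facts[OF assms(1)]
  show "2 \<le> card V" using n_ge l_ge by (simp add: V)
  show "V \<subseteq> gball V E {s} 2" if s: "s \<in> V" for s
  proof -
    have "\<not> 1 \<le> card (V - gball V E {s} (Suc i))"
      using good assms(1) layer_ge(2)[OF s] s unfolding good_def bad7_def by blast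
    then have "V - gball V E {s} (Suc i) = {}" using V(1) by (simp add: card_gt_0_iff not_le)
    then show ?thesis by (simp add: D(1) numeral_2_eq_2)
  qed
  fix a S assume a: "a \<in> V" and S: "S \<subseteq> V" "card S = k"
  \<comment> \<open>\<open>bad6\<close> concerns sets of exactly \<open>kmax\<close> sensors;
    vertices that agree on the larger set also agree on \<open>S\<close>.\<close>
  have "k \<le> kmax" using k by (simp add: kmax_def le_nat_floor)
  moreover have "kmax \<le> card V" using kmax_le_half by (simp add: V)
  ultimately obtain S' where S': "S \<subseteq> S'" "S' \<subseteq> V" "card S' = kmax"
    using exists_subset_between[of S kmax V] S V by blast
  have fin: "finite (nbs E V a)" "finite S'" using V S' by (auto simp: nbs_def intro: finite_subset)
  have "97/100 * d \<le> card (nbs E V a)"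
  proof -
    have "gball V E {a} 1 - prev_ball V E {a} 1 \<subseteq> nbs E V a"
      by (auto simp: gball_Suc nbh_def nbs_def insert_commute)
    then have "card (gball V E {a} 1 - prev_ball V E {a} 1) \<le> card (nbs E V a)"
      using fin by (intro card_mono)
    then show ?thesis using layer_ge(1)[OF a] D(1) by simp
  qed
  moreover have "kmax \<le> d / 4"
  proof -
    have "n * l / d \<le> d / 4" using D(2) d_pos by (simp add: field_simps power2_eq_square)
    then show ?thesis using kmax_le by linarith
  qed
  moreover have "card (nbs E V a) - kmax \<le> card (nbs E V a - S')"
    using diff_card_le_card_Diff[OF fin(2), of "nbs E V a"] S' by simp
  ultimately have "2 * N \<le> card (nbs E V a - S')" using N_ge(2) d_pos by linarith
  then have "\<not> inj_on (nbs E (S' - {a})) (nbs E V a - S')"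
    using good assms(1) a S' unfolding good_def bad6_def by blast
  then obtain x y where xy: "x \<in> nbs E V a - S'" "y \<in> nbs E V a - S'" "x \<noteq> y"
    "nbs E (S' - {a}) x = nbs E (S' - {a}) y" by (auto simp: inj_on_def)
  have "nbs E (S - {a}) z = nbs E (S' - {a}) z \<inter> S" for z using S' by (auto simp: nbs_def)
  then have "nbs E (S - {a}) x = nbs E (S - {a}) y" using xy by simp
  then show "\<not> inj_on (nbs E (S - {a})) (nbs E V a - S)"
    using xy S' unfolding inj_on_def by blast
qed

lemma not_win:
  assumes k: "real k < lower"
  shows "\<not> cops_can_win V E k"
proof -
  \<comment> \<open>Otherwise \<open>lower\<close> is not positive and there is no such
    \<open>k\<close>.\<close>
  have "l ^ 3 \<le> d"
  proof (rule ccontr)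
    assume "\<not> l ^ 3 \<le> d"
    then have "ln d \<le> ln (l ^ 3)" using d_pos l_ge by (subst ln_le_cancel_iff) auto
    then have "ln d - 3 * ll \<le> 0" using l_ge by (simp add: ln_realpow ll)
    then have "lower \<le> 0" unfolding lower_def using d_pos by (intro mult_nonpos_nonneg) auto
    then show False using k by simp
  qed
  then have "is_sparse \<or> is_dense" by (auto simp: is_sparse_def is_dense_def)
  then show ?thesis using not_win_sparse[OF _ k] not_win_dense[OF _ k] by blast
qed

text \<open>With at least D = 2 (1 - 12 \<delta>) d ^ i separating sensors per pair, K D / n >= 2 ln
  d + 4 ll. Against g^2 <= 9 d^2 this leaves 9 * 3 / l^4, where 3 bounds the factor exp 1 lost by
  rounding K down.\<close>

lemma win:
  assumes \<eta>: "0 < \<eta>" "\<eta> \<le> 1" "\<delta> = \<eta> / 100"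
    and K: "K = (1 + \<eta>) * (ln d + 2 * ll) * (n / d ^ i)"
  shows "cops_can_win V E (nat \<lfloor>K\<rfloor>)"
proof -
  define D where "D = 2 * (1 - 12 * \<delta>) * d ^ i"
  have s0: "0 \<le> ln d + 2 * ll" using ln_d ll_ge by simp
  have K0: "0 \<le> K" unfolding K using \<eta> s0 d_pos by simp
  have D0: "0 \<le> D" using \<delta> d_pos by (simp add: D_def)
  have Dn: "D \<le> n"
  proof -
    have "D \<le> 2 * d ^ i" unfolding D_def using \<delta> d_pos by (intro mult_right_mono) auto
    also have "d ^ i \<le> \<delta> / 10 * n" by (rule di)
    also have "\<delta> / 10 * n \<le> 1 / 2 * n" using \<delta> by (intro mult_right_mono) auto
    finally show ?thesis by simp
  qed
  have kn: "nat \<lfloor>K\<rfloor> \<le> card V"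
  proof -
    have "ll \<le> l" using exp_ge_add_one_self[of ll] by (simp add: exp_ll)
    then have "(1 + \<eta>) * (ln d + 2 * ll) \<le> 2 * (3 * l)" using ln_d \<eta> s0 by (intro mult_mono) auto
    also have "\<dots> \<le> d" using d_ge l_ge by simp
    also have "\<dots> \<le> d ^ i" by (rule d_le_power)
    finally have "K \<le> d ^ i * (n / d ^ i)" unfolding K using d_pos by (intro mult_right_mono) auto
    then show ?thesis using d_pos by (simp add: V) linarith
  qed
  have main: "g\<^sup>2 * (1 - D / n) ^ nat \<lfloor>K\<rfloor> < 1/2"
  proof -
    have "(1 - D / n) ^ nat \<lfloor>K\<rfloor> \<le> exp (- (D / n * nat \<lfloor>K\<rfloor>))"
      by (rule one_minus_power_le_exp) (use Dn n_pos in \<open>simp add: divide_le_eq\<close>)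
    also have "\<dots> \<le> exp (1 - (2 * ln d + 4 * ll))"
    proof -
      \<comment> \<open>As \<delta> = \<eta> / 100, the new factor is 1 + (88 \<eta> - 12 \<eta>^2)
        / 100, at least 1 for \<eta> <= 1: the increase of K by \<eta> pays for the overlap of the
        balls.\<close>
      have "(2 * ln d + 4 * ll) * 1 \<le> (2 * ln d + 4 * ll) * ((1 - 12 * \<delta>) * (1 + \<eta>))"
      proof (rule mult_left_mono)
        have "\<eta> * \<eta> \<le> \<eta> * 1" using \<eta> by (intro mult_left_mono) auto
        then show "1 \<le> (1 - 12 * \<delta>) * (1 + \<eta>)" unfolding \<eta>(3) using \<eta>(1) by (simp add: algebra_simps)
      qed (use s0 in simp)
      also have "\<dots> = D / n * K"
      proof -
        have "D / n * K = (2 * (1 - 12 * \<delta>)) * ((1 + \<eta>) * (ln d + 2 * ll)) * (d ^ i / n * (n / d ^ i))"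
          by (simp add: K D_def)
        also have "d ^ i / n * (n / d ^ i) = 1" using n_pos d_pos by simp
        finally show ?thesis by (simp add: algebra_simps)
      qed
      also have "\<dots> \<le> D / n * (nat \<lfloor>K\<rfloor> + 1)"
      proof (rule mult_left_mono)
        show "K \<le> real (nat \<lfloor>K\<rfloor> + 1)" using K0 by linarith
      qed (use D0 in simp)
      also have "\<dots> = D / n * nat \<lfloor>K\<rfloor> + D / n" by (simp add: distrib_left)
      finally have "2 * ln d + 4 * ll \<le> D / n * nat \<lfloor>K\<rfloor> + D / n" by simp
      moreover have "D / n \<le> 1" using Dn n_pos by simp
      ultimately show ?thesis unfolding exp_le_cancel_iff by linarith
    qed
    also have "\<dots> = exp 1 / (d\<^sup>2 * l ^ 4)"
      using d_pos exp_of_nat_mult[of 2 "ln d"] exp_of_nat_mult[of 4 ll] by (simp add: exp_diff exp_add exp_ll)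
    also have "\<dots> \<le> 3 / (d\<^sup>2 * l ^ 4)" using exp_le l_ge by (intro divide_right_mono) auto
    finally have "g\<^sup>2 * (1 - D / n) ^ nat \<lfloor>K\<rfloor> \<le> (3 * d)\<^sup>2 * (3 / (d\<^sup>2 * l ^ 4))"
      using g_bounds Dn n_pos by (intro mult_mono power_mono) (auto simp: divide_le_eq)
    also have "\<dots> = 27 / l ^ 4" using d_pos by (simp add: power_mult_distrib)
    also have "\<dots> < 1/2"
    proof -
      have "10 ^ 4 \<le> l ^ 4" using l_ge by (intro power_mono) auto
      then show ?thesis using l_ge by (simp add: divide_less_eq)
    qed
    finally show ?thesis .
  qed
  show ?thesis
  proof (rule cops_can_win_if_separating[OF V(1,3), where g = g and D = D])
    show "D \<le> card {s \<in> V. graph_dist V E s w \<noteq> graph_dist V E s x}"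
      if "w \<in> V" "x \<in> V" "w \<noteq> x" for w x
      unfolding D_def
    proof (rule separation_of_layer_inv[OF V(1) _ _ _ d_inv that])
      show "layer_inv (real (card {x, y})) d \<delta> i i (prev_ball V E {x, y} i) (gball V E {x, y} i)"
        if "x \<in> V" "y \<in> V" for x y using good that unfolding good_def bad1_def by blast
    qed (use \<delta> in auto)
  qed (use nbh_le main Dn kn V in auto)
qed

text \<open>A winning number exists by \<open>win\<close>, so the least one is itself winning and
  \<open>not_win\<close> applies to it.\<close>

lemma good_bounds:
  assumes \<eta>: "0 < \<eta>" "\<eta> \<le> 1" "\<delta> = \<eta> / 100"
  shows "lower \<le> localization_number V E"
    and "localization_number V E \<le> (1 + \<eta>) * (ln d + 2 * ll) * (n / d ^ i)"
proof -
  define K where "K = (1 + \<eta>) * (ln d + 2 * ll) * (n / d ^ i)"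
  have win: "cops_can_win V E (nat \<lfloor>K\<rfloor>)" by (rule win[OF \<eta> K_def])
  then have "cops_can_win V E (localization_number V E)"
    unfolding localization_number_def by (rule LeastI)
  then show "lower \<le> localization_number V E" using not_win by (meson not_le)
  have "localization_number V E \<le> nat \<lfloor>K\<rfloor>"
    unfolding localization_number_def by (rule Least_le[where P = "cops_can_win V E", OF win])
  moreover have "0 \<le> K" unfolding K_def using \<eta> ln_d ll_ge d_pos by simp
  ultimately show "localization_number V E \<le> (1 + \<eta>) * (ln d + 2 * ll) * (n / d ^ i)"
    unfolding K_def[symmetric] by linarith
qed

end

theorem localization_whp:
  assumes "0 < \<eta>" "\<eta> \<le> 1" "\<delta> = \<eta> / 100"
  shows "1 - 9 / n \<le> PR (gnp n p) (\<lambda>E. connected_graph {1..n} E \<and>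
    (ln d - 3 * ll) * (n / d ^ i) \<le> localization_number {1..n} E \<and>
    localization_number {1..n} E \<le> (1 + \<eta>) * (ln d + 2 * ll) * (n / d ^ i))"
proof -
  have "1 - 9 / n \<le> PR G good" using PR_not_good PR_not[of G good] by simp
  also have "\<dots> \<le> PR G (\<lambda>E. connected_graph V E \<and> lower \<le> localization_number V E \<and>
      localization_number V E \<le> (1 + \<eta>) * (ln d + 2 * ll) * (n / d ^ i))"
    by (rule PR_mono) (use good_connected good_bounds[OF _ assms] in blast)
  finally show ?thesis
    by (simp add: G_def V_def lower_def gnp_eq_rset vertex_pairs_eq)
qed

end

section \<open>Asymptotics\<close>

text \<open>Diagonal argument: \<open>\<kappa> n\<close> is the largest k <= n whose threshold has
  been passed at n, and 1 / (\<kappa> n + 1) tends to 0. The cap k <= n makes the maximum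
  exist.\<close>

lemma diagonal_null_sequence:
  fixes R :: "real \<Rightarrow> nat \<Rightarrow> bool"
  assumes R: "\<And>\<eta>. 0 < \<eta> \<Longrightarrow> \<eta> \<le> 1 \<Longrightarrow> \<forall>\<^sub>F n in sequentially. R \<eta> n"
  shows "\<exists>\<epsilon>. \<epsilon> \<longlonglongrightarrow> 0 \<and> (\<forall>\<^sub>F n in sequentially. R (\<epsilon> n) n)"
proof -
  have "\<exists>N. \<forall>n\<ge>N. R (1 / Suc k) n" for k
    using R[of "1 / Suc k"] by (simp add: eventually_sequentially)
  then obtain N where N: "\<And>k n. N k \<le> n \<Longrightarrow> R (1 / Suc k) n" by metis
  define I where "I n = {k. k \<le> n \<and> N k \<le> n}" for n
  define \<kappa> where "\<kappa> n = Max (I n)" for n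
  have fin: "finite (I n)" for n by (simp add: I_def)
  have mem: "\<kappa> n \<in> I n" if "N 0 \<le> n" for n
    unfolding \<kappa>_def by (rule Max_in[OF fin]) (use that in \<open>auto simp: I_def\<close>)
  have ge: "k \<le> \<kappa> n" if "k \<le> n" "N k \<le> n" for k n
    unfolding \<kappa>_def by (rule Max_ge[OF fin]) (use that in \<open>simp add: I_def\<close>)
  have "filterlim \<kappa> at_top sequentially"
    unfolding filterlim_at_top eventually_sequentially
  proof
    fix k
    show "\<exists>M. \<forall>n\<ge>M. k \<le> \<kappa> n" using ge[of k] by (intro exI[of _ "max k (N k)"]) auto
  qed
  then have "(\<lambda>n. 1 / Suc (\<kappa> n)) \<longlonglongrightarrow> 0"
    by (rule filterlim_compose[OF LIMSEQ_Suc[OF lim_1_over_n]])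
  moreover have "\<forall>\<^sub>F n in sequentially. R (1 / Suc (\<kappa> n)) n"
    unfolding eventually_sequentially
    using mem N by (intro exI[of _ "N 0"]) (auto simp: I_def)
  ultimately show ?thesis by blast
qed

lemma aas_if_eventually_ge:
  assumes "\<forall>\<^sub>F n in sequentially. f n \<le> PR (gnp n (p n)) (Q n)" "f \<longlonglongrightarrow> 1"
  shows "aas p Q"
  unfolding aas_def
proof (rule tendsto_sandwich[OF assms(1) _ assms(2) tendsto_const])
  show "\<forall>\<^sub>F n in sequentially. PR (gnp n (p n)) (Q n) \<le> 1" by simp
qed

lemma aas_mono:
  assumes "aas p Q" "\<forall>\<^sub>F n in sequentially. \<forall>E. Q n E \<longrightarrow> Q' n E"
  shows "aas p Q'"
proof (rule aas_if_eventually_ge)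
  show "(\<lambda>n. PR (gnp n (p n)) (Q n)) \<longlonglongrightarrow> 1" using assms(1) by (simp add: aas_def)
  show "\<forall>\<^sub>F n in sequentially. PR (gnp n (p n)) (Q n) \<le> PR (gnp n (p n)) (Q' n)"
    using assms(2) by eventually_elim (rule PR_mono, blast)
qed

text \<open>By the triangle inequality, a factor 1 + \<rho> in the reference function adds |\<rho>|
  to the relative error.\<close>

lemma aas_localization_number_sim_cong:
  assumes sim: "aas_localization_number_sim p f"
    and \<rho>: "\<rho> \<longlonglongrightarrow> 0" "\<forall>\<^sub>F n in sequentially. f n = (1 + \<rho> n) * f' n"
  shows "aas_localization_number_sim p f'"
proof -
  obtain \<epsilon> where \<epsilon>: "\<epsilon> \<longlonglongrightarrow> 0" "aas p (\<lambda>n E. connected_graph {1..n} E \<and>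
      \<bar>real (localization_number {1..n} E) - f n\<bar> \<le> \<epsilon> n * \<bar>f n\<bar>)"
    using sim by (auto simp: aas_localization_number_sim_def)
  show ?thesis
    unfolding aas_localization_number_sim_def
  proof (intro exI conjI)
    have "(\<lambda>n. \<bar>\<epsilon> n\<bar> * \<bar>1 + \<rho> n\<bar> + \<bar>\<rho> n\<bar>) \<longlonglongrightarrow> \<bar>0\<bar> * \<bar>1 + 0\<bar> + \<bar>0\<bar>"
      by (intro tendsto_intros \<epsilon> \<rho>)
    then show "(\<lambda>n. \<bar>\<epsilon> n\<bar> * \<bar>1 + \<rho> n\<bar> + \<bar>\<rho> n\<bar>) \<longlonglongrightarrow> 0" by simp
    show "aas p (\<lambda>n E. connected_graph {1..n} E \<and>
      \<bar>real (localization_number {1..n} E) - f' n\<bar> \<le> (\<bar>\<epsilon> n\<bar> * \<bar>1 + \<rho> n\<bar> + \<bar>\<rho> n\<bar>) * \<bar>f' n\<bar>)"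
    proof (rule aas_mono[OF \<epsilon>(2)])
      show "\<forall>\<^sub>F n in sequentially. \<forall>E. connected_graph {1..n} E \<and>
          \<bar>real (localization_number {1..n} E) - f n\<bar> \<le> \<epsilon> n * \<bar>f n\<bar> \<longrightarrow>
        connected_graph {1..n} E \<and>
          \<bar>real (localization_number {1..n} E) - f' n\<bar> \<le> (\<bar>\<epsilon> n\<bar> * \<bar>1 + \<rho> n\<bar> + \<bar>\<rho> n\<bar>) * \<bar>f' n\<bar>"
        using \<rho>(2)
      proof (eventually_elim, intro allI impI)
        fix n E
        assume f: "f n = (1 + \<rho> n) * f' n" and E: "connected_graph {1..n} E \<and>
          \<bar>real (localization_number {1..n} E) - f n\<bar> \<le> \<epsilon> n * \<bar>f n\<bar>"
        have "\<epsilon> n * \<bar>f n\<bar> \<le> \<bar>\<epsilon> n\<bar> * \<bar>f n\<bar>" by (intro mult_right_mono) auto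
        also have "\<dots> = \<bar>\<epsilon> n\<bar> * \<bar>1 + \<rho> n\<bar> * \<bar>f' n\<bar>" by (simp add: f abs_mult)
        finally have 1: "\<epsilon> n * \<bar>f n\<bar> \<le> \<bar>\<epsilon> n\<bar> * \<bar>1 + \<rho> n\<bar> * \<bar>f' n\<bar>" .
        have "\<bar>f n - f' n\<bar> = \<bar>\<rho> n\<bar> * \<bar>f' n\<bar>" by (simp add: f algebra_simps abs_mult)
        then show "connected_graph {1..n} E \<and>
          \<bar>real (localization_number {1..n} E) - f' n\<bar> \<le> (\<bar>\<epsilon> n\<bar> * \<bar>1 + \<rho> n\<bar> + \<bar>\<rho> n\<bar>) * \<bar>f' n\<bar>"
          using E 1 abs_triangle_ineq[of "real (localization_number {1..n} E) - f n" "f n - f' n"]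
          by (simp only: distrib_right) simp
      qed
    qed
  qed
qed

section \<open>The asymptotic regime\<close>

locale gnp_regime =
  fixes p d :: "nat \<Rightarrow> real" and i :: "nat \<Rightarrow> nat"
  assumes p: "\<And>n. 0 \<le> p n \<and> p n \<le> 1"
    and d: "\<And>n. d n = p n * real n"
    and d_lower: "(\<lambda>n. ln (real n)) \<in> o(d)"
    and d_upper: "d \<in> o(\<lambda>n. real n)"
    and di: "(\<lambda>n. d n ^ i n) \<in> o(\<lambda>n. real n)"
    and di1: "filterlim (\<lambda>n. d n ^ (i n + 1) / real n - 2 * ln (real n)) at_top sequentially"
begin

lemma d_nonneg: "0 \<le> d n" using p[of n] by (simp add: d)

lemma eventually_large_params:
  assumes \<delta>: "0 < \<delta>" "\<delta> \<le> 1/100"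
  shows "\<forall>\<^sub>F n in sequentially. large_params n (i n) (p n) (d n) (ln (real n)) (ln (ln (real n))) \<delta>"
proof -
  have "\<forall>\<^sub>F n in sequentially. norm (ln (real n)) \<le> \<delta>\<^sup>2 / 1024 * norm (d n)"
    by (rule landau_o.smallD[OF d_lower]) (use \<delta> in simp)
  moreover have "\<forall>\<^sub>F n in sequentially. norm (d n) \<le> 1/10 * norm (real n)"
    by (rule landau_o.smallD[OF d_upper]) simp
  moreover have "\<forall>\<^sub>F n in sequentially. norm (d n ^ i n) \<le> \<delta> / 10 * norm (real n)"
    by (rule landau_o.smallD[OF di]) (use \<delta> in simp)
  moreover have "\<forall>\<^sub>F n in sequentially. 0 \<le> d n ^ (i n + 1) / real n - 2 * ln (real n)"
    by (rule di1[unfolded filterlim_at_top, rule_format])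
  moreover have "\<forall>\<^sub>F n::nat in sequentially. 320 \<le> ln (ln (real n))" by real_asymp
  moreover have "\<forall>\<^sub>F n::nat in sequentially. 16 * ln (real n) ^ 4 \<le> real n" by real_asymp
  moreover have "\<forall>\<^sub>F n::nat in sequentially. 1 \<le> ln (real n)" by real_asymp
  moreover have "\<forall>\<^sub>F n::nat in sequentially. n > 0" by (rule eventually_gt_at_top)
  ultimately show ?thesis
  proof eventually_elim
    case (elim n)
    have n: "0 < real n" using elim by simp
    have d1: "2 * real n * ln (real n) \<le> d n ^ (i n + 1)" using elim(4) n by (simp add: field_simps)
    show ?case
    proof
      show "0 \<le> p n" using p by simp
      show "p n \<le> 1/10" using elim(2) n p[of n] by (simp add: d abs_mult)
      \<comment> \<open>For i = 0 the hypothesis \<open>di1\<close> would give 2 n ln n <= d <=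
        n.\<close>
      show "1 \<le> i n"
      proof (rule ccontr)
        assume "\<not> 1 \<le> i n"
        then have "i n = 0" by simp
        then have "2 * real n * ln (real n) \<le> 1 * real n"
          using d1 mult_right_mono[of "p n" 1 "real n"] p[of n] by (simp add: d)
        moreover have "2 * real n * 1 \<le> 2 * real n * ln (real n)"
          using elim(7) n by (intro mult_left_mono) auto
        ultimately show False using n by linarith
      qed
      show "1024 * ln (real n) \<le> \<delta>\<^sup>2 * d n" using elim(1,7) d_nonneg[of n] by simp
      show "d n ^ i n \<le> \<delta> / 10 * real n" using elim(3) d_nonneg[of n] by simp
    qed (use d1 elim \<delta> d in auto)
  qed
qed

lemma bounds:
  "\<exists>\<epsilon>. \<epsilon> \<longlonglongrightarrow> 0 \<and> aas p (\<lambda>n E. connected_graph {1..n} E \<and>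
     (ln (d n) - 3 * ln (ln (real n))) * (real n / d n ^ i n) \<le> real (localization_number {1..n} E) \<and>
     real (localization_number {1..n} E)
       \<le> (1 + \<epsilon> n) * (ln (d n) + 2 * ln (ln (real n))) * (real n / d n ^ i n))"
proof -
  define Q where "Q \<eta> n E \<longleftrightarrow> connected_graph {1..n} E \<and>
     (ln (d n) - 3 * ln (ln (real n))) * (real n / d n ^ i n) \<le> real (localization_number {1..n} E) \<and>
     real (localization_number {1..n} E)
       \<le> (1 + \<eta>) * (ln (d n) + 2 * ln (ln (real n))) * (real n / d n ^ i n)" for \<eta> n E
  have "\<forall>\<^sub>F n in sequentially. 1 - 9 / real n \<le> PR (gnp n (p n)) (Q \<eta> n)" if \<eta>: "0 < \<eta>" "\<eta> \<le> 1" for \<eta>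
  proof -
    have "\<forall>\<^sub>F n in sequentially. large_params n (i n) (p n) (d n) (ln (real n)) (ln (ln (real n))) (\<eta> / 100)"
      by (rule eventually_large_params) (use \<eta> in auto)
    then show ?thesis
    proof eventually_elim
      case (elim n)
      then interpret large_params n "i n" "p n" "d n" "ln (real n)" "ln (ln (real n))" "\<eta> / 100" .
      show ?case unfolding Q_def by (rule localization_whp) (use \<eta> in auto)
    qed
  qed
  \<comment> \<open>Diagonalising an inequality between probabilities keeps the null sequence
    deterministic.\<close>
  from diagonal_null_sequence[of "\<lambda>\<eta> n. 1 - 9 / real n \<le> PR (gnp n (p n)) (Q \<eta> n)", OF this]
  obtain \<epsilon> where \<epsilon>: "\<epsilon> \<longlonglongrightarrow> 0"
    "\<forall>\<^sub>F n in sequentially. 1 - 9 / real n \<le> PR (gnp n (p n)) (Q (\<epsilon> n) n)" by blast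
  have "(\<lambda>n::nat. 1 - 9 / real n) \<longlonglongrightarrow> 1" by real_asymp
  from aas_if_eventually_ge[OF \<epsilon>(2) this] \<epsilon>(1) show ?thesis unfolding Q_def by blast
qed

lemma sim:
  assumes \<omega>: "filterlim \<omega> at_top sequentially" "\<forall>\<^sub>F n in sequentially. ln (real n) powr \<omega> n \<le> d n"
  shows "aas_localization_number_sim p (\<lambda>n. real n * ln (d n) / d n ^ i n)"
proof -
  obtain \<epsilon> where \<epsilon>: "\<epsilon> \<longlonglongrightarrow> 0" "aas p (\<lambda>n E. connected_graph {1..n} E \<and>
     (ln (d n) - 3 * ln (ln (real n))) * (real n / d n ^ i n) \<le> real (localization_number {1..n} E) \<and>
     real (localization_number {1..n} E)
       \<le> (1 + \<epsilon> n) * (ln (d n) + 2 * ln (ln (real n))) * (real n / d n ^ i n))"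
    using bounds by blast
  \<comment> \<open>Size of ln ln n relative to ln d; at most 1 / \<omega> by the growth
    condition.\<close>
  define r where "r n = ln (ln (real n)) / ln (d n)" for n
  have ev: "\<forall>\<^sub>F n in sequentially. 1 \<le> ln (d n) \<and> 0 < d n \<and> 0 < ln (ln (real n))"
  proof (rule eventually_mono)
    show "\<forall>\<^sub>F n in sequentially. large_params n (i n) (p n) (d n) (ln (real n)) (ln (ln (real n))) (1/100)"
      by (rule eventually_large_params) auto
    fix n assume "large_params n (i n) (p n) (d n) (ln (real n)) (ln (ln (real n))) (1/100)"
    then interpret large_params n "i n" "p n" "d n" "ln (real n)" "ln (ln (real n))" "1/100" .
    show "1 \<le> ln (d n) \<and> 0 < d n \<and> 0 < ln (ln (real n))"
      using ln_d(1) d_pos ll_ge by linarith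
  qed
  have \<omega>1: "\<forall>\<^sub>F n in sequentially. 1 \<le> \<omega> n" using \<omega>(1) by (simp add: filterlim_at_top)
  have "\<forall>\<^sub>F n in sequentially. 0 \<le> r n \<and> r n \<le> 1 / \<omega> n"
    using ev \<omega>(2) \<omega>1 eventually_gt_at_top[of 1]
  proof eventually_elim
    case (elim n)
    have "ln (ln (real n) powr \<omega> n) \<le> ln (d n)"
      using elim by (subst ln_le_cancel_iff) auto
    then have "\<omega> n * ln (ln (real n)) \<le> ln (d n)" using elim by (simp add: ln_powr)
    moreover have "0 \<le> a / b \<and> a / b \<le> 1 / c" if "c * a \<le> b" "0 \<le> a" "1 \<le> b" "1 \<le> c" for a b c :: real
      using that by (simp add: field_simps)
    moreover have "0 \<le> ln (ln (real n))" "1 \<le> ln (d n)" using elim by linarith+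
    ultimately show ?case unfolding r_def using elim(3) by blast
  qed
  then have r0: "\<forall>\<^sub>F n in sequentially. 0 \<le> r n" and r1: "\<forall>\<^sub>F n in sequentially. r n \<le> 1 / \<omega> n"
    by (auto elim: eventually_mono)
  have "(\<lambda>n. 1 / \<omega> n) \<longlonglongrightarrow> 0"
    using tendsto_inverse_0_at_top[OF \<omega>(1)] by (simp add: inverse_eq_divide)
  then have r: "r \<longlonglongrightarrow> 0" by (rule tendsto_sandwich[OF r0 r1 tendsto_const])
  \<comment> \<open>Covers the deficit 3 r of the lower bound and the excess (1 + \<epsilon>) (1 + 2
    r) - 1 of the upper bound.\<close>
  define \<epsilon>' where "\<epsilon>' n = \<bar>\<epsilon> n\<bar> + 3 * r n + 2 * \<bar>\<epsilon> n\<bar> * r n" for n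
  show ?thesis
    unfolding aas_localization_number_sim_def
  proof (intro exI conjI)
    have "\<epsilon>' \<longlonglongrightarrow> \<bar>0\<bar> + 3 * 0 + 2 * \<bar>0\<bar> * 0"
      unfolding \<epsilon>'_def by (intro tendsto_intros \<epsilon> r)
    then show "\<epsilon>' \<longlonglongrightarrow> 0" by simp
    show "aas p (\<lambda>n E. connected_graph {1..n} E \<and>
      \<bar>real (localization_number {1..n} E) - real n * ln (d n) / d n ^ i n\<bar>
        \<le> \<epsilon>' n * \<bar>real n * ln (d n) / d n ^ i n\<bar>)"
    proof (rule aas_mono[OF \<epsilon>(2)])
      show "\<forall>\<^sub>F n in sequentially. \<forall>E. connected_graph {1..n} E \<and>
         (ln (d n) - 3 * ln (ln (real n))) * (real n / d n ^ i n) \<le> real (localization_number {1..n} E) \<and>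
         real (localization_number {1..n} E)
           \<le> (1 + \<epsilon> n) * (ln (d n) + 2 * ln (ln (real n))) * (real n / d n ^ i n) \<longrightarrow>
        connected_graph {1..n} E \<and>
        \<bar>real (localization_number {1..n} E) - real n * ln (d n) / d n ^ i n\<bar>
          \<le> \<epsilon>' n * \<bar>real n * ln (d n) / d n ^ i n\<bar>"
        using ev r0
      proof (eventually_elim, intro allI impI)
        fix n E
        assume ev: "1 \<le> ln (d n) \<and> 0 < d n \<and> 0 < ln (ln (real n))" and r0: "0 \<le> r n"
          and E: "connected_graph {1..n} E \<and>
         (ln (d n) - 3 * ln (ln (real n))) * (real n / d n ^ i n) \<le> real (localization_number {1..n} E) \<and>
         real (localization_number {1..n} E)
           \<le> (1 + \<epsilon> n) * (ln (d n) + 2 * ln (ln (real n))) * (real n / d n ^ i n)"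
        define f where "f = real n * ln (d n) / d n ^ i n"
        define z where "z = real (localization_number {1..n} E)"
        have "0 \<le> ln (d n)" by (rule order_trans[OF zero_le_one]) (use ev in blast)
        then have f0: "0 \<le> f" unfolding f_def
          by (intro divide_nonneg_nonneg mult_nonneg_nonneg zero_le_power d_nonneg of_nat_0_le_iff)
        have lnln: "ln (ln (real n)) = r n * ln (d n)"
        proof -
          have "d n \<noteq> 1" using ev by auto
          then show ?thesis using ev by (simp add: r_def)
        qed
        define y where "y = real n / d n ^ i n"
        have fy: "f = ln (d n) * y" by (simp add: f_def y_def)
        note E' = E[folded y_def z_def, unfolded lnln]
        have "(ln (d n) - 3 * (r n * ln (d n))) * y = (1 - 3 * r n) * f"
          by (simp add: fy algebra_simps)
        then have low: "(1 - 3 * r n) * f \<le> z" using E' by simp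
        have "(1 + \<epsilon> n) * (ln (d n) + 2 * (r n * ln (d n))) * y = (1 + \<epsilon> n) * (1 + 2 * r n) * f"
          by (simp add: fy algebra_simps)
        then have up: "z \<le> (1 + \<epsilon> n) * (1 + 2 * r n) * f" using E' by (simp only:)
        have "(1 + \<epsilon> n) * (1 + 2 * r n) * f \<le> (1 + \<epsilon>' n) * f"
        proof (rule mult_right_mono[OF _ f0])
          have "\<epsilon> n * r n \<le> \<bar>\<epsilon> n\<bar> * r n" using r0 by (intro mult_right_mono) auto
          moreover have "(1 + \<epsilon> n) * (1 + 2 * r n) = 1 + \<epsilon> n + 2 * r n + 2 * (\<epsilon> n * r n)"
            by (simp add: algebra_simps)
          moreover have "\<epsilon>' n = \<bar>\<epsilon> n\<bar> + 3 * r n + 2 * (\<bar>\<epsilon> n\<bar> * r n)" by (simp add: \<epsilon>'_def)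
          ultimately show "(1 + \<epsilon> n) * (1 + 2 * r n) \<le> 1 + \<epsilon>' n" using r0 by linarith
        qed
        moreover have "(1 - \<epsilon>' n) * f \<le> (1 - 3 * r n) * f"
        proof (rule mult_right_mono[OF _ f0])
          have "0 \<le> \<bar>\<epsilon> n\<bar> + 2 * \<bar>\<epsilon> n\<bar> * r n" using r0 by (intro add_nonneg_nonneg mult_nonneg_nonneg) auto
          then show "1 - \<epsilon>' n \<le> 1 - 3 * r n" by (simp add: \<epsilon>'_def)
        qed
        ultimately have "\<bar>z - f\<bar> \<le> \<epsilon>' n * f" using low up by (simp add: algebra_simps abs_le_iff)
        then show "connected_graph {1..n} E \<and>
          \<bar>real (localization_number {1..n} E) - real n * ln (d n) / d n ^ i n\<bar>
            \<le> \<epsilon>' n * \<bar>real n * ln (d n) / d n ^ i n\<bar>"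
          unfolding f_def[symmetric] z_def[symmetric] using E abs_of_nonneg[OF f0] by simp
      qed
    qed
  qed
qed

end

section \<open>Degrees that are powers of n\<close>

lemma sim_polynomial:
  fixes p d \<delta> :: "nat \<Rightarrow> real" and i :: nat and x :: real
  assumes p: "\<And>n. 0 \<le> p n \<and> p n \<le> 1" and d: "\<And>n. d n = p n * real n"
    and d_lower: "(\<lambda>n. ln (real n)) \<in> o(d)" and d_upper: "d \<in> o(\<lambda>n. real n)"
    and i: "1 \<le> i" and x: "1 / (real i + 1) < x" "x < 1 / real i"
    and \<delta>: "\<delta> \<longlonglongrightarrow> 0" "\<forall>\<^sub>F n in sequentially. d n = real n powr (x + \<delta> n)"
  shows "aas_localization_number_sim p (\<lambda>n. x * real n * ln (real n) / d n ^ i)"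
proof -
  have x0: "0 < x" using x(1) by (smt (verit) divide_pos_pos of_nat_0_le_iff)
  \<comment> \<open>Half of the gaps 1 - i x and (i + 1) x - 1; the other halves absorb \<delta>.
    Eventually d ^ i <= n^(1 - c1) and d ^ (i + 1) >= n^(1 + c2).\<close>
  define c1 where "c1 = (1 - i * x) / 2"
  define c2 where "c2 = ((i + 1) * x - 1) / 2"
  have c: "0 < c1" "0 < c2" using x i by (auto simp: c1_def c2_def field_simps)
  have lim: "(\<lambda>n. a * (x + \<delta> n)) \<longlonglongrightarrow> a * (x + 0)" for a by (intro tendsto_intros \<delta>)
  have "\<forall>\<^sub>F n in sequentially. i * (x + \<delta> n) < 1 - c1"
    by (rule order_tendstoD(2)[OF lim]) (use c in \<open>simp add: c1_def field_simps\<close>)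
  then have up: "\<forall>\<^sub>F n in sequentially. d n ^ i \<le> real n powr (1 - c1)"
    using \<delta>(2) eventually_gt_at_top[of 1]
  proof eventually_elim
    case (elim n)
    have "d n ^ i = real n powr (i * (x + \<delta> n))"
      using elim powr_realpow[of "real n powr (x + \<delta> n)" i] by (simp add: powr_powr mult.commute)
    also have "\<dots> \<le> real n powr (1 - c1)" using elim by (intro powr_mono) auto
    finally show ?case .
  qed
  have "\<forall>\<^sub>F n in sequentially. 1 + c2 < (i + 1) * (x + \<delta> n)"
    by (rule order_tendstoD(1)[OF lim]) (use c in \<open>simp add: c2_def field_simps\<close>)
  then have low: "\<forall>\<^sub>F n in sequentially. real n powr c2 - 2 * ln (real n) \<le> d n ^ (i + 1) / real n - 2 * ln (real n)"
    using \<delta>(2) eventually_gt_at_top[of 1]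
  proof eventually_elim
    case (elim n)
    have "real n powr c2 = real n powr (1 + c2) / real n" using elim by (simp add: powr_add)
    also have "\<dots> \<le> real n powr ((i + 1) * (x + \<delta> n)) / real n"
      using elim by (intro divide_right_mono powr_mono) auto
    also have "real n powr ((i + 1) * (x + \<delta> n)) = d n ^ (i + 1)"
      using elim powr_realpow[of "real n powr (x + \<delta> n)" "i + 1"] by (simp add: powr_powr mult.commute)
    finally show ?case by simp
  qed
  interpret gnp_regime p d "\<lambda>_. i"
  proof
    have "(\<lambda>n. d n ^ i) \<in> O(\<lambda>n. real n powr (1 - c1))"
      by (rule bigoI[of _ 1]) (use up d p in \<open>auto elim!: eventually_mono\<close>)
    also have "(\<lambda>n. real n powr (1 - c1)) \<in> o(\<lambda>n. real n)" using c by real_asymp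
    finally show "(\<lambda>n. d n ^ i) \<in> o(\<lambda>n. real n)" .
    have "filterlim (\<lambda>n::nat. real n powr c2 - 2 * ln (real n)) at_top sequentially" using c by real_asymp
    then show "filterlim (\<lambda>n. d n ^ (i + 1) / real n - 2 * ln (real n)) at_top sequentially"
      using low by (rule filterlim_at_top_mono)
  qed (use p d d_lower d_upper in auto)
  have "\<forall>\<^sub>F n in sequentially. x / 2 < x + \<delta> n"
    by (rule order_tendstoD(1)[OF tendsto_add[OF tendsto_const \<delta>(1)]]) (use x0 in simp)
  then have ln_d: "\<forall>\<^sub>F n in sequentially. ln (d n) = (x + \<delta> n) * ln (real n) \<and> x / 2 < x + \<delta> n \<and> 3 < n"
    using \<delta>(2) eventually_gt_at_top[of 3] by eventually_elim (simp add: ln_powr)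
  have "\<forall>\<^sub>F n::nat in sequentially. 0 < ln (ln (real n))" by real_asymp
  then have ev: "\<forall>\<^sub>F n in sequentially. ln (d n) = (x + \<delta> n) * ln (real n) \<and> x / 2 < x + \<delta> n \<and> 3 < n \<and>
      0 < ln (ln (real n))"
    using ln_d by eventually_elim simp
  have "aas_localization_number_sim p (\<lambda>n. real n * ln (d n) / d n ^ i)"
  proof (rule sim)
    \<comment> \<open>The witness is \<omega> = ln d / ln (ln n), for which (ln n)^\<omega> =
      d.\<close>
    have "filterlim (\<lambda>n::nat. x / 2 * ln (real n) / ln (ln (real n))) at_top sequentially"
      using x0 by real_asymp
    then show "filterlim (\<lambda>n. ln (d n) / ln (ln (real n))) at_top sequentially"
    proof (rule filterlim_at_top_mono)
      show "\<forall>\<^sub>F n in sequentially. x / 2 * ln (real n) / ln (ln (real n)) \<le> ln (d n) / ln (ln (real n))"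
        using ev
      proof eventually_elim
        case (elim n)
        then have "x / 2 * ln (real n) \<le> (x + \<delta> n) * ln (real n)" by (intro mult_right_mono) auto
        then have "x / 2 * ln (real n) / ln (ln (real n)) \<le> (x + \<delta> n) * ln (real n) / ln (ln (real n))"
          by (rule divide_right_mono) (use elim in linarith)
        then show ?case using elim by (simp only:)
      qed
    qed
    show "\<forall>\<^sub>F n in sequentially. ln (real n) powr (ln (d n) / ln (ln (real n))) \<le> d n"
      using ev \<delta>(2)
    proof eventually_elim
      case (elim n)
      have "0 < d n" using elim by simp
      moreover have "0 < ln (real n)" using elim by simp
      moreover define L where "L = ln (ln (real n))"
      moreover have "0 < L" using elim by (simp only: L_def)
      ultimately show ?case unfolding powr_def L_def[symmetric] by simp
    qed
  qed
  then show ?thesis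
  proof (rule aas_localization_number_sim_cong)
    \<comment> \<open>ln d = (x + \<delta>) ln n, and x + \<delta> = (1 + \<delta> / x) x.\<close>
    have "(\<lambda>n. \<delta> n / x) \<longlonglongrightarrow> 0 / x" by (intro tendsto_intros \<delta>) (use x0 in simp)
    then show "(\<lambda>n. \<delta> n / x) \<longlonglongrightarrow> 0" by simp
    show "\<forall>\<^sub>F n in sequentially. real n * ln (d n) / d n ^ i =
        (1 + \<delta> n / x) * (x * real n * ln (real n) / d n ^ i)"
      using ev
    proof eventually_elim
      case (elim n)
      have "(1 + \<delta> n / x) * x = x + \<delta> n" using x0 by (simp add: distrib_right)
      then have "real n * ln (d n) / d n ^ i = ((1 + \<delta> n / x) * x) * (real n * ln (real n) / d n ^ i)"
        using elim by (simp only:) (simp add: mult_ac)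
      then show ?case by (simp only: times_divide_eq_right mult.assoc)
    qed
  qed
qed

theorem theorem2p1:
  fixes p d :: "nat \<Rightarrow> real"
  assumes p: "\<And>n. 0 \<le> p n \<and> p n \<le> 1"
    and d: "\<And>n. d n = p n * real n"
    and d_lower: "(\<lambda>n. ln (real n)) \<in> o(d)"
    and d_upper: "d \<in> o(\<lambda>n. real n)"
  shows
    "(\<forall>i :: nat \<Rightarrow> nat.
        (\<lambda>n. d n ^ i n) \<in> o(\<lambda>n. real n) \<and>
        filterlim (\<lambda>n. d n ^ (i n + 1) / real n - 2 * ln (real n)) at_top sequentially \<longrightarrow>
          (\<exists>\<epsilon> :: nat \<Rightarrow> real. \<epsilon> \<longlonglongrightarrow> 0 \<and>
             aas p (\<lambda>n E. connected_graph {1..n} E \<and>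
               (ln (d n) - 3 * ln (ln (real n))) * (real n / d n ^ i n)
                 \<le> real (localization_number {1..n} E) \<and>
               real (localization_number {1..n} E)
                 \<le> (1 + \<epsilon> n) * (ln (d n) + 2 * ln (ln (real n))) * (real n / d n ^ i n))) \<and>
          ((\<exists>\<omega> :: nat \<Rightarrow> real. filterlim \<omega> at_top sequentially \<and>
              (\<forall>\<^sub>F n in sequentially. d n \<ge> ln (real n) powr \<omega> n)) \<longrightarrow>
             aas_localization_number_sim p (\<lambda>n. real n * ln (d n) / d n ^ i n)))
     \<and>
     (\<forall>(i :: nat) (x :: real).
        i \<ge> 1 \<and> 1 / (real i + 1) < x \<and> x < 1 / real i \<and>
        (\<exists>\<delta> :: nat \<Rightarrow> real. \<delta> \<longlonglongrightarrow> 0 \<and>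
           (\<forall>\<^sub>F n in sequentially. d n = real n powr (x + \<delta> n))) \<longrightarrow>
          aas_localization_number_sim p (\<lambda>n. x * real n * ln (real n) / d n ^ i))"
proof (intro conjI allI impI; elim conjE)
  fix i :: "nat \<Rightarrow> nat"
  assume i: "(\<lambda>n. d n ^ i n) \<in> o(\<lambda>n. real n)"
    "filterlim (\<lambda>n. d n ^ (i n + 1) / real n - 2 * ln (real n)) at_top sequentially"
  interpret gnp_regime p d i
    using p d d_lower d_upper i by unfold_locales
  show "\<exists>\<epsilon> :: nat \<Rightarrow> real. \<epsilon> \<longlonglongrightarrow> 0 \<and>
             aas p (\<lambda>n E. connected_graph {1..n} E \<and>
               (ln (d n) - 3 * ln (ln (real n))) * (real n / d n ^ i n)
                 \<le> real (localization_number {1..n} E) \<and>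
               real (localization_number {1..n} E)
                 \<le> (1 + \<epsilon> n) * (ln (d n) + 2 * ln (ln (real n))) * (real n / d n ^ i n))"
    by (rule bounds)
  assume "\<exists>\<omega> :: nat \<Rightarrow> real. filterlim \<omega> at_top sequentially \<and>
              (\<forall>\<^sub>F n in sequentially. d n \<ge> ln (real n) powr \<omega> n)"
  then show "aas_localization_number_sim p (\<lambda>n. real n * ln (d n) / d n ^ i n)"
    using sim by blast
next
  fix i :: nat and x :: real
  assume i: "i \<ge> 1" and x: "1 / (real i + 1) < x" "x < 1 / real i"
    and "\<exists>\<delta> :: nat \<Rightarrow> real. \<delta> \<longlonglongrightarrow> 0 \<and> (\<forall>\<^sub>F n in sequentially. d n = real n powr (x + \<delta> n))"
  then obtain \<delta> where \<delta>: "\<delta> \<longlonglongrightarrow> 0" "\<forall>\<^sub>F n in sequentially. d n = real n powr (x + \<delta> n)"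
    by blast
  show "aas_localization_number_sim p (\<lambda>n. x * real n * ln (real n) / d n ^ i)"
    by (rule sim_polynomial[OF p d d_lower d_upper i x \<delta>])
qed

end
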